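(* Let $n$ be a positive integer, $\boldsymbol{r}=(r_1,r_2,\ldots,r_n)$ an $n$-tuple of positive integers, and $m,p$ positive integers with $p\mid m$. Let $\mathbb{F}$ be a field of characteristic zero containing a primitive $m$-th root of unity, and let $q\in\mathbb{F}$ be nonzero and not a root of unity. Put $U=U_q^{m,p}(\boldsymbol{r})$, and let $\Gamma$, $K$, $L$, $\mathcal{M}$, $G$ be as defined in the context. Then there exists an injective $\mathbb{F}$-algebra homomorphism $$\varphi:U\longrightarrow (L\ast \mathcal{M})^G$$ given by $$\varphi({}^LX_k^\pm) = X_k^{\pm}\quad (k\in\{1,\dots,n-1\}),\qquad \varphi({}^L\gamma) =\gamma\quad (\gamma\in\Gamma).$$ Moreover, $$K\varphi(U)=\varphi(U)K =(L\ast\mathcal{M})^G.$$ In other words, $U$ is isomorphic to a Galois $\Gamma$-ring in $(L\ast\mathcal{M})^G$.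
   Context: "Algebra" means unital associative $\mathbb{F}$-algebra. **The groups.** Let $\boldsymbol{\mu}_m$ be the group of $m$-th roots of unity in $\mathbb{F}$. For $r\ge 1$ let $A(m,p,r)=\{\alpha\in(\boldsymbol{\mu}_m)^r : (\alpha_1\cdots\alpha_r)^{m/p}=1\}$ and $G(m,p,r)=S_r\ltimes A(m,p,r)$, with $S_r$ permuting the entries. Put $G=G(m,p,r_1)\times\cdots\times G(m,p,r_n)$. **The rings $\Lambda$, $L$, $\Gamma$, $K$.** Let $\Lambda=\mathbb{F}[x_{ki}^{\pm1}\mid 1\le k\le n,\ 1\le i\le r_k]$ be the Laurent polynomial algebra in $r_1+\cdots+r_n$ variables and $L$ its field of fractions. An element $g=(\sigma_1\alpha_1,\dots,\sigma_n\alpha_n)\in G$, with $\sigma_k\in S_{r_k}$, $\alpha_k=(\alpha_{k1},\dots,\alpha_{kr_k})\in A(m,p,r_k)$, acts on $\Lambda$ and $L$ by $\mathbb{F}$-algebra automorphisms with $g(x_{ki})=\alpha_{ki}x_{k\sigma_k(i)}$. Put $\Gamma=\Lambda^G$ and let $K$ be the field of fractions of $\Gamma$. **The skew group algebras.** Let $\widehat{\mathcal{M}}\simeq\mathbb{Z}^{r_1+\cdots+r_n}$ be the free abelian group, written multiplicatively, with basis $\{\delta^{ki}\mid 1\le k\le n,\ 1\le i\le r_k\}$, and let $\mathcal{M}\subseteq\widehat{\mathcal{M}}$ be the subgroup generated by the $\delta^{ki}$ with $1\le k\le n-1$, $1\le i\le r_k$. Let $\mathscr{V}=L\ast\widehat{\mathcal{M}}$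 be the skew group algebra with relations $\delta^{ki}x_{lj}=q^{-\delta_{kl}\delta_{ij}}x_{lj}\delta^{ki}$ (where $\delta_{kl},\delta_{ij}$ with lower indices are Kronecker deltas); it contains the skew group algebra $L\ast\mathcal{M}$. The group $G$ acts on $L\ast\mathcal{M}$ by $\mathbb{F}$-algebra automorphisms: for $g=(\sigma_1\alpha_1,\dots,\sigma_n\alpha_n)\in G$, with $\sigma_k\in S_{r_k}$ and $\alpha_k=(\alpha_{k1},\dots,\alpha_{kr_k})\in A(m,p,r_k)$, $g(x_{ki})=\alpha_{ki}x_{k\sigma_k(i)}$ and $g(\delta^{ki})=\delta^{k\sigma_k(i)}$. $(L\ast\mathcal{M})^G$ is the subring of invariants. **Quantum OGZ algebra.** For $k\in\{1,\dots,n-1\}$ put $$X_k^{\pm}=\sum_{i=1}^{r_k}(\delta^{ki})^{\pm1}\cdot A_{ki}^{\pm}\in L\ast\mathcal{M}\subseteq L\ast\widehat{\mathcal{M}},$$ $$A_{ki}^{\pm}=\mp x_{ki}^{-\frac{m}{p}(r_{k\pm 1}-r_k)}\frac{\prod_j \left\{ \left(x_{k\pm 1,j}x_{ki}^{-1}\right)^{-m/p} \left((x_{k\pm 1,j}x_{ki}^{-1})^m-1\right)/\left(q^{-m/p}(q^m-1)\right)\right\}}{\prod_{j\neq i} \left\{\left(x_{kj}x_{ki}^{-1}\right)^{-m/p} \left((x_{kj}x_{ki}^{-1})^m - 1\right)/\left(q^{-m/p}(q^m-1)\right)\right\}},$$ where in the numerator $j$ runs over $\{1,\dots,r_{k\pm1}\}$,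 in the denominator $j$ runs over $\{1,\dots,r_k\}\setminus\{i\}$, and $r_0=0$ by convention (empty products equal $1$). For $a\in\mathscr{V}$ let ${}^La\in\operatorname{End}_{\mathbb{F}}(\mathscr{V})$ denote left multiplication by $a$. The ($(m,p)$-form of the) quantum OGZ algebra of signature $\boldsymbol{r}$, denoted $U_q^{m,p}(\boldsymbol{r})$, is the $\mathbb{F}$-subalgebra of $\operatorname{End}_{\mathbb{F}}(\mathscr{V})$ generated by ${}^L\gamma$ for $\gamma\in\Gamma$ and ${}^LX_k^{\pm}$ for $k\in\{1,\dots,n-1\}$. **Galois rings.** Let $\Gamma$ be an integral domain with field of fractions $K$, $K\subseteq L$ a finite Galois extension with Galois group $G$, and $\mathcal{M}$ a monoid acting by automorphisms on $L$ such that the action is $K$-separating (if $h,h'\in\mathcal{M}$ satisfy $h(a)=h'(a)$ for all $a\in K$, then $h=h'$), with $G$ acting on $\mathcal{M}\subseteq\operatorname{Aut}(L)$ by conjugation and hence by automorphisms on the skew monoid ring $L\ast\mathcal{M}$. A subring $U'\subseteq(L\ast\mathcal{M})^G$ containing $\Gamma$ is a Galois $\Gamma$-ring in $(L\ast\mathcal{M})^G$ if $U'K=(L\ast\mathcal{M})^G=KU'$. Here, for subsets $A,B$ of a ring, $AB$ denotes the set of finite sums of products $ab$ with $a\in A$, $b\in B$. *)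

theory Defs
  imports
    "HOL-Library.Poly_Mapping"
    "HOL-Library.Product_Lexorder"
    "HOL-Computational_Algebra.Polynomial_Factorial"
    "HOL-Algebra.Product_Groups"
    "HOL-Algebra.Sym_Groups"
    "HOL-Algebra.Bij"
    "HOL-Algebra.Algebraic_Closure_Type"
begin

section \<open>Algebras over a field\<close>

text \<open>
  An algebra over the field \<open>'f\<close> (a type) is a \<open>module\<close> record: a not necessarily commutative
  unital ring with a scalar multiplication. The locale \<open>algebra\<close> of HOL-Algebra does not apply
  to it, as it requires commutativity.
\<close>

definition subalgebra_of :: "('f::field, 'a, 'z) module_scheme \<Rightarrow> 'a set \<Rightarrow> bool" where
  "subalgebra_of A S \<longleftrightarrow> subring S A \<and> (\<forall>c. \<forall>a\<in>S. c \<odot>\<^bsub>A\<^esub> a \<in> S)"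

definition generated_subalgebra :: "('f::field, 'a, 'z) module_scheme \<Rightarrow> 'a set \<Rightarrow> 'a set" where
  "generated_subalgebra A S = \<Inter>{B. subalgebra_of A B \<and> S \<subseteq> B}"

definition algebra_hom ::
    "('f::field, 'a, 'y) module_scheme \<Rightarrow> ('f, 'b, 'z) module_scheme \<Rightarrow> ('a \<Rightarrow> 'b) set" where
  "algebra_hom A B =
     {h \<in> ring_hom A B. \<forall>c. \<forall>a\<in>carrier A. h (c \<odot>\<^bsub>A\<^esub> a) = c \<odot>\<^bsub>B\<^esub> h a}"

definition End_algebra :: "('f::field, 'a, 'z) module_scheme \<Rightarrow> ('f, 'a \<Rightarrow> 'a) module" where
  "End_algebra V =
     \<lparr>carrier = {f \<in> carrier V \<rightarrow>\<^sub>E carrier V.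
        (\<forall>v\<in>carrier V. \<forall>w\<in>carrier V. f (v \<oplus>\<^bsub>V\<^esub> w) = f v \<oplus>\<^bsub>V\<^esub> f w) \<and>
        (\<forall>c. \<forall>v\<in>carrier V. f (c \<odot>\<^bsub>V\<^esub> v) = c \<odot>\<^bsub>V\<^esub> f v)},
      monoid.mult = compose (carrier V),
      one = (\<lambda>v\<in>carrier V. v),
      ring.zero = (\<lambda>v\<in>carrier V. \<zero>\<^bsub>V\<^esub>),
      ring.add = (\<lambda>f g. \<lambda>v\<in>carrier V. f v \<oplus>\<^bsub>V\<^esub> g v),
      module.smult = (\<lambda>c f. \<lambda>v\<in>carrier V. c \<odot>\<^bsub>V\<^esub> f v)\<rparr>"

definition left_mult :: "('a, 'z) monoid_scheme \<Rightarrow> 'a \<Rightarrow> ('a \<Rightarrow> 'a)" where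
  "left_mult V a = (\<lambda>v\<in>carrier V. a \<otimes>\<^bsub>V\<^esub> v)"

text \<open>The set of finite sums of products \<open>ab\<close> with \<open>a \<in> A\<close> and \<open>b \<in> B\<close>.\<close>

definition set_prod :: "('a, 'z) ring_scheme \<Rightarrow> 'a set \<Rightarrow> 'a set \<Rightarrow> 'a set" where
  "set_prod R A B =
     {(\<Oplus>\<^bsub>R\<^esub>i\<in>{..<N}. a i \<otimes>\<^bsub>R\<^esub> b i) | (N::nat) a b. (\<forall>i<N. a i \<in> A \<and> b i \<in> B)}"


section \<open>Galois extensions inside an ambient field\<close>

definition fractions_of :: "'l::field set \<Rightarrow> 'l set" where
  "fractions_of S = {a / b | a b. a \<in> S \<and> b \<in> S \<and> b \<noteq> 0}"

definition field_auts :: "'l::field set \<Rightarrow> ('l \<Rightarrow> 'l) set" where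
  "field_auts L = {f \<in> Bij L. \<forall>a\<in>L. \<forall>b\<in>L. f (a + b) = f a + f b \<and> f (a * b) = f a * f b}"

definition gal_group :: "'l::field set \<Rightarrow> 'l set \<Rightarrow> ('l \<Rightarrow> 'l) monoid" where
  "gal_group L K = (BijGroup L)\<lparr>carrier := {f \<in> field_auts L. \<forall>a\<in>K. f a = a}\<rparr>"

definition finite_galois :: "'l::field set \<Rightarrow> 'l set \<Rightarrow> bool" where
  "finite_galois K L \<longleftrightarrow>
     subfield K ring_of_type_algebra \<and> subfield L ring_of_type_algebra \<and> K \<subseteq> L \<and>
     ring.finite_dimension ring_of_type_algebra K L \<and>
     {a \<in> L. \<forall>f\<in>carrier (gal_group L K). f a = a} = K"


section \<open>Skew monoid rings and Galois rings\<close>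

text \<open>
  The monoid \<open>M\<close> is written additively. The finitely supported function \<open>f\<close> stands for the
  sum of the \<open>f(\<mu>) \<cdot> \<mu>\<close> with coefficients on the left, multiplied by \<open>\<mu> a = \<mu>(a) \<mu>\<close>. The product
  that the type class structure of \<open>\<Rightarrow>\<^sub>0\<close> provides is the untwisted one and is not the product
  used for this ring.
\<close>

definition skew_mult ::
    "('m::monoid_add \<Rightarrow> 'l::field \<Rightarrow> 'l) \<Rightarrow> ('m \<Rightarrow>\<^sub>0 'l) \<Rightarrow> ('m \<Rightarrow>\<^sub>0 'l) \<Rightarrow> ('m \<Rightarrow>\<^sub>0 'l)" where
  "skew_mult act f g =
     (\<Sum>\<mu>\<in>Poly_Mapping.keys f. \<Sum>\<nu>\<in>Poly_Mapping.keys g.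
        Poly_Mapping.single (\<mu> + \<nu>)
          (Poly_Mapping.lookup f \<mu> * act \<mu> (Poly_Mapping.lookup g \<nu>)))"

definition skew_ring ::
    "('m::monoid_add \<Rightarrow> 'l::field \<Rightarrow> 'l) \<Rightarrow> 'l set \<Rightarrow> 'm set \<Rightarrow> ('m \<Rightarrow>\<^sub>0 'l) ring" where
  "skew_ring act L M =
     \<lparr>carrier = {f. Poly_Mapping.keys f \<subseteq> M \<and> range (Poly_Mapping.lookup f) \<subseteq> L},
      monoid.mult = skew_mult act, one = Poly_Mapping.single 0 1, ring.zero = 0, ring.add = (+)\<rparr>"

abbreviation coef :: "'l \<Rightarrow> ('m::monoid_add \<Rightarrow>\<^sub>0 'l::field)" where
  "coef \<equiv> Poly_Mapping.single 0"

definition skew_action ::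
    "('g \<Rightarrow> 'l \<Rightarrow> 'l) \<Rightarrow> ('g \<Rightarrow> 'm \<Rightarrow> 'm) \<Rightarrow> 'g \<Rightarrow> ('m::monoid_add \<Rightarrow>\<^sub>0 'l::field) \<Rightarrow> ('m \<Rightarrow>\<^sub>0 'l)" where
  "skew_action gL gM g f =
     (\<Sum>\<mu>\<in>Poly_Mapping.keys f. Poly_Mapping.single (gM g \<mu>) (gL g (Poly_Mapping.lookup f \<mu>)))"

definition skew_invariants ::
    "('g, 'z) monoid_scheme \<Rightarrow> ('g \<Rightarrow> 'l \<Rightarrow> 'l) \<Rightarrow> ('g \<Rightarrow> 'm \<Rightarrow> 'm) \<Rightarrow>
     ('m::monoid_add \<Rightarrow> 'l::field \<Rightarrow> 'l) \<Rightarrow> 'l set \<Rightarrow> 'm set \<Rightarrow> ('m \<Rightarrow>\<^sub>0 'l) set" where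
  "skew_invariants G gL gM act L M =
     {f \<in> carrier (skew_ring act L M). \<forall>g\<in>carrier G. skew_action gL gM g f = f}"

text \<open>
  \<open>galois_setting\<close> collects the standing assumptions under which Galois rings are defined:
  \<open>\<Gamma>\<close> is an integral domain (as a subring of a field) with field of fractions \<open>K\<close>, \<open>L/K\<close> is
  finite Galois with group \<open>G\<close> (through the action \<open>gL\<close>), \<open>M\<close> acts on \<open>L\<close> by automorphisms
  (through \<open>act\<close>), \<open>K\<close>-separatingly, and the action \<open>gM\<close> of \<open>G\<close> on \<open>M\<close> is conjugation.
\<close>

definition galois_setting ::
    "'l::field set \<Rightarrow> 'l set \<Rightarrow> 'l set \<Rightarrow> ('g, 'z) monoid_scheme \<Rightarrow> ('g \<Rightarrow> 'l \<Rightarrow> 'l) \<Rightarrow>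
     'm::monoid_add set \<Rightarrow> ('m \<Rightarrow> 'l \<Rightarrow> 'l) \<Rightarrow> ('g \<Rightarrow> 'm \<Rightarrow> 'm) \<Rightarrow> bool" where
  "galois_setting \<Gamma> K L G gL M act gM \<longleftrightarrow>
     subring \<Gamma> ring_of_type_algebra \<and> K = fractions_of \<Gamma> \<and>
     finite_galois K L \<and> group G \<and> (\<lambda>g. restrict (gL g) L) \<in> iso G (gal_group L K) \<and>
     0 \<in> M \<and> (\<forall>\<mu>\<in>M. \<forall>\<nu>\<in>M. \<mu> + \<nu> \<in> M) \<and>
     (\<forall>\<mu>\<in>M. restrict (act \<mu>) L \<in> field_auts L) \<and>
     (\<forall>a\<in>L. act 0 a = a) \<and>
     (\<forall>\<mu>\<in>M. \<forall>\<nu>\<in>M. \<forall>a\<in>L. act (\<mu> + \<nu>) a = act \<mu> (act \<nu> a)) \<and>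
     (\<forall>\<mu>\<in>M. \<forall>\<nu>\<in>M. (\<forall>a\<in>K. act \<mu> a = act \<nu> a) \<longrightarrow> \<mu> = \<nu>) \<and>
     (\<forall>g\<in>carrier G. \<forall>\<mu>\<in>M. gM g \<mu> \<in> M \<and> (\<forall>a\<in>L. act (gM g \<mu>) (gL g a) = gL g (act \<mu> a)))"

definition galois_ring ::
    "'l::field set \<Rightarrow> 'l set \<Rightarrow> 'l set \<Rightarrow> ('g, 'z) monoid_scheme \<Rightarrow> ('g \<Rightarrow> 'l \<Rightarrow> 'l) \<Rightarrow>
     'm::monoid_add set \<Rightarrow> ('m \<Rightarrow> 'l \<Rightarrow> 'l) \<Rightarrow> ('g \<Rightarrow> 'm \<Rightarrow> 'm) \<Rightarrow> ('m \<Rightarrow>\<^sub>0 'l) set \<Rightarrow> bool" where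
  "galois_ring \<Gamma> K L G gL M act gM U \<longleftrightarrow>
     galois_setting \<Gamma> K L G gL M act gM \<and>
     subring U (skew_ring act L M) \<and> U \<subseteq> skew_invariants G gL gM act L M \<and> coef ` \<Gamma> \<subseteq> U \<and>
     set_prod (skew_ring act L M) U (coef ` K) = skew_invariants G gL gM act L M \<and>
     set_prod (skew_ring act L M) (coef ` K) U = skew_invariants G gL gM act L M"


section \<open>The groups \<open>G(m,p,r)\<close>\<close>

definition roots_of_unity :: "nat \<Rightarrow> 'f::field set" where
  "roots_of_unity m = {z. z ^ m = 1}"

definition A_set :: "nat \<Rightarrow> nat \<Rightarrow> nat \<Rightarrow> (nat \<Rightarrow> 'f::field) set" where
  "A_set m p r = {\<alpha> \<in> {1..r} \<rightarrow>\<^sub>E roots_of_unity m. (\<Prod>i\<in>{1..r}. \<alpha> i) ^ (m div p) = 1}"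

text \<open>
  The pair \<open>(\<sigma>, \<alpha>)\<close> stands for the element \<open>\<sigma>\<alpha>\<close> of the semidirect product. The product is the
  one for which \<open>x\<^sub>i \<mapsto> \<alpha>\<^sub>i x\<^bsub>\<sigma>(i)\<^esub>\<close> is a left action.
\<close>

definition G_single :: "nat \<Rightarrow> nat \<Rightarrow> nat \<Rightarrow> ((nat \<Rightarrow> nat) \<times> (nat \<Rightarrow> 'f::field)) monoid" where
  "G_single m p r =
     \<lparr>carrier = carrier (sym_group r) \<times> A_set m p r,
      monoid.mult = (\<lambda>(\<sigma>, \<alpha>) (\<tau>, \<beta>). (\<sigma> \<circ> \<tau>, \<lambda>i\<in>{1..r}. \<alpha> (\<tau> i) * \<beta> i)),
      one = (id, \<lambda>i\<in>{1..r}. 1)\<rparr>"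

definition G_group ::
    "nat \<Rightarrow> (nat \<Rightarrow> nat) \<Rightarrow> nat \<Rightarrow> nat \<Rightarrow> (nat \<Rightarrow> (nat \<Rightarrow> nat) \<times> (nat \<Rightarrow> 'f::field)) monoid" where
  "G_group n r m p = product_group {1..n} (\<lambda>k. G_single m p (r k))"


section \<open>Laurent polynomials and rational functions\<close>

text \<open>
  The types below contain the variables \<open>x\<^sub>v\<close> for all pairs \<open>v\<close>. The actual
  rings are cut out as subsets by restricting to the variables in \<open>vars n r\<close>.
\<close>

type_synonym expo = "nat \<times> nat \<Rightarrow>\<^sub>0 int"
type_synonym 'f laurent = "expo \<Rightarrow>\<^sub>0 'f"
type_synonym 'f ratfun = "'f laurent fract"
type_synonym 'f skew = "expo \<Rightarrow>\<^sub>0 'f ratfun"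

definition vars :: "nat \<Rightarrow> (nat \<Rightarrow> nat) \<Rightarrow> (nat \<times> nat) set" where
  "vars n r = {(k, i). k \<in> {1..n} \<and> i \<in> {1..r k}}"

definition lattice_on :: "(nat \<times> nat) set \<Rightarrow> expo set" where
  "lattice_on I = {\<mu>. Poly_Mapping.keys \<mu> \<subseteq> I}"

definition const :: "'f::field \<Rightarrow> 'f ratfun" where
  "const c = to_fract (Poly_Mapping.single 0 c)"

definition x_var :: "nat \<Rightarrow> nat \<Rightarrow> 'f::field ratfun" where
  "x_var k i = to_fract (Poly_Mapping.single (Poly_Mapping.single (k, i) 1) 1)"

definition Lambda :: "nat \<Rightarrow> (nat \<Rightarrow> nat) \<Rightarrow> 'f::field ratfun set" where
  "Lambda n r = to_fract ` {f. Poly_Mapping.keys f \<subseteq> lattice_on (vars n r)}"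

definition L_field :: "nat \<Rightarrow> (nat \<Rightarrow> nat) \<Rightarrow> 'f::field ratfun set" where
  "L_field n r = fractions_of (Lambda n r)"


section \<open>Monomial automorphisms\<close>

definition expo_map :: "(nat \<times> nat \<Rightarrow> nat \<times> nat) \<Rightarrow> expo \<Rightarrow> expo" where
  "expo_map \<pi> a =
     (\<Sum>v\<in>Poly_Mapping.keys a. Poly_Mapping.single (\<pi> v) (Poly_Mapping.lookup a v))"

text \<open>The substitution \<open>x\<^sub>v \<mapsto> c\<^sub>v x\<^bsub>\<pi>(v)\<^esub>\<close>, first on Laurent polynomials, then on fractions.\<close>

definition laurent_subst ::
    "(nat \<times> nat \<Rightarrow> nat \<times> nat) \<Rightarrow> (nat \<times> nat \<Rightarrow> 'f::field) \<Rightarrow> 'f laurent \<Rightarrow> 'f laurent" where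
  "laurent_subst \<pi> c f =
     (\<Sum>a\<in>Poly_Mapping.keys f. Poly_Mapping.single (expo_map \<pi> a)
        (Poly_Mapping.lookup f a *
          (\<Prod>v\<in>Poly_Mapping.keys a. c v powi Poly_Mapping.lookup a v)))"

definition map_fract :: "('a::idom \<Rightarrow> 'a) \<Rightarrow> 'a fract \<Rightarrow> 'a fract" where
  "map_fract h z = (THE w. \<exists>a b. b \<noteq> 0 \<and> z = Fract a b \<and> w = Fract (h a) (h b))"

lemma map_fract_Fract:
  fixes h :: "'a::idom \<Rightarrow> 'a"
  assumes "\<And>a b. h (a * b) = h a * h b" "\<And>a. h a = 0 \<longleftrightarrow> a = 0" "b \<noteq> 0"
  shows "map_fract h (Fract a b) = Fract (h a) (h b)"
  unfolding map_fract_def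
proof (rule the_equality)
  show "\<exists>a' b'. b' \<noteq> 0 \<and> Fract a b = Fract a' b' \<and> Fract (h a) (h b) = Fract (h a') (h b')"
    using assms(3) by blast
next
  fix w assume "\<exists>a' b'. b' \<noteq> 0 \<and> Fract a b = Fract a' b' \<and> w = Fract (h a') (h b')"
  then obtain a' b' where *: "b' \<noteq> 0" "Fract a b = Fract a' b'" "w = Fract (h a') (h b')"
    by blast
  have "a * b' = a' * b" using * assms(3) by (simp add: eq_fract)
  hence "h a * h b' = h a' * h b" by (simp flip: assms(1))
  thus "w = Fract (h a) (h b)" using * assms by (simp add: eq_fract)
qed

text \<open>
  The automorphism \<open>x\<^sub>v \<mapsto> q\<^bsup>-\<mu>(v)\<^esup> x\<^sub>v\<close>. It encodes the relations
  \<open>\<delta>\<^sup>v x\<^sub>w = q\<^bsup>-[v=w]\<^esup> x\<^sub>w \<delta>\<^sup>v\<close>.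
\<close>

definition shift_act :: "'f::field \<Rightarrow> expo \<Rightarrow> 'f ratfun \<Rightarrow> 'f ratfun" where
  "shift_act q \<mu> = map_fract (laurent_subst id (\<lambda>v. q powi (- Poly_Mapping.lookup \<mu> v)))"

text \<open>Variables outside \<open>vars n r\<close> are fixed.\<close>

definition G_perm ::
    "nat \<Rightarrow> (nat \<Rightarrow> nat) \<Rightarrow> (nat \<Rightarrow> (nat \<Rightarrow> nat) \<times> (nat \<Rightarrow> 'f::field)) \<Rightarrow>
     nat \<times> nat \<Rightarrow> nat \<times> nat" where
  "G_perm n r g v = (if v \<in> vars n r then (fst v, fst (g (fst v)) (snd v)) else v)"

definition G_coef ::
    "nat \<Rightarrow> (nat \<Rightarrow> nat) \<Rightarrow> (nat \<Rightarrow> (nat \<Rightarrow> nat) \<times> (nat \<Rightarrow> 'f::field)) \<Rightarrow> nat \<times> nat \<Rightarrow> 'f" where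
  "G_coef n r g v = (if v \<in> vars n r then snd (g (fst v)) (snd v) else 1)"

definition G_act ::
    "nat \<Rightarrow> (nat \<Rightarrow> nat) \<Rightarrow> (nat \<Rightarrow> (nat \<Rightarrow> nat) \<times> (nat \<Rightarrow> 'f::field)) \<Rightarrow>
     'f ratfun \<Rightarrow> 'f ratfun" where
  "G_act n r g = map_fract (laurent_subst (G_perm n r g) (G_coef n r g))"

definition G_act_expo ::
    "nat \<Rightarrow> (nat \<Rightarrow> nat) \<Rightarrow> (nat \<Rightarrow> (nat \<Rightarrow> nat) \<times> (nat \<Rightarrow> 'f::field)) \<Rightarrow> expo \<Rightarrow> expo" where
  "G_act_expo n r g = expo_map (G_perm n r g)"

definition Gamma :: "nat \<Rightarrow> (nat \<Rightarrow> nat) \<Rightarrow> nat \<Rightarrow> nat \<Rightarrow> 'f::field ratfun set" where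
  "Gamma n r m p = {a \<in> Lambda n r. \<forall>g\<in>carrier (G_group n r m p). G_act n r g a = a}"

definition K_field :: "nat \<Rightarrow> (nat \<Rightarrow> nat) \<Rightarrow> nat \<Rightarrow> nat \<Rightarrow> 'f::field ratfun set" where
  "K_field n r m p = fractions_of (Gamma n r m p)"


section \<open>The quantum OGZ algebra\<close>

text \<open>
  \<open>skew_algebra n r q I\<close> is the skew group algebra of the free abelian group on \<open>I\<close> over \<open>L\<close>.
  Taking all of \<open>vars n r\<close> for \<open>I\<close> gives \<open>\<V>\<close>, and \<open>vars (n - 1) r\<close> gives \<open>L * \<M>\<close>.
\<close>

definition skew_algebra ::
    "nat \<Rightarrow> (nat \<Rightarrow> nat) \<Rightarrow> 'f::field \<Rightarrow> (nat \<times> nat) set \<Rightarrow> ('f, 'f skew) module" where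
  "skew_algebra n r q I =
     (let R = skew_ring (shift_act q) (L_field n r) (lattice_on I) in
      \<lparr>carrier = carrier R, monoid.mult = monoid.mult R, one = one R, ring.zero = ring.zero R, ring.add = ring.add R,
       module.smult = (\<lambda>c f. monoid.mult R (coef (const c)) f)\<rparr>)"

abbreviation V_algebra :: "nat \<Rightarrow> (nat \<Rightarrow> nat) \<Rightarrow> 'f::field \<Rightarrow> ('f, 'f skew) module" where
  "V_algebra n r q \<equiv> skew_algebra n r q (vars n r)"

abbreviation M_group :: "nat \<Rightarrow> (nat \<Rightarrow> nat) \<Rightarrow> expo set" where
  "M_group n r \<equiv> lattice_on (vars (n - 1) r)"

abbreviation LM_algebra :: "nat \<Rightarrow> (nat \<Rightarrow> nat) \<Rightarrow> 'f::field \<Rightarrow> ('f, 'f skew) module" where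
  "LM_algebra n r q \<equiv> skew_algebra n r q (vars (n - 1) r)"

definition LM_invariants ::
    "nat \<Rightarrow> (nat \<Rightarrow> nat) \<Rightarrow> nat \<Rightarrow> nat \<Rightarrow> 'f::field \<Rightarrow> 'f skew set" where
  "LM_invariants n r m p q =
     skew_invariants (G_group n r m p :: (nat \<Rightarrow> (nat \<Rightarrow> nat) \<times> (nat \<Rightarrow> 'f)) monoid)
       (G_act n r) (G_act_expo n r) (shift_act q) (L_field n r) (M_group n r)"

abbreviation LM_inv_algebra ::
    "nat \<Rightarrow> (nat \<Rightarrow> nat) \<Rightarrow> nat \<Rightarrow> nat \<Rightarrow> 'f::field \<Rightarrow> ('f, 'f skew) module" where
  "LM_inv_algebra n r m p q \<equiv> (LM_algebra n r q)\<lparr>carrier := LM_invariants n r m p q\<rparr>"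

text \<open>The convention \<open>r\<^sub>0 = 0\<close>.\<close>

definition sig :: "(nat \<Rightarrow> nat) \<Rightarrow> nat \<Rightarrow> nat" where
  "sig r k = (if k = 0 then 0 else r k)"

text \<open>The factors \<open>z\<^bsup>-m/p\<^esup> (z\<^sup>m - 1) / (q\<^bsup>-m/p\<^esup> (q\<^sup>m - 1))\<close> occurring in \<open>A\<^sub>k\<^sub>i\<^sup>\<plusminus>\<close>.\<close>

definition bracket :: "nat \<Rightarrow> nat \<Rightarrow> 'f::field \<Rightarrow> 'f ratfun \<Rightarrow> 'f ratfun" where
  "bracket m p q z =
     z powi (- int (m div p)) * (z ^ m - 1) /
       (const q powi (- int (m div p)) * (const q ^ m - 1))"

text \<open>In \<open>A_coef\<close> and \<open>X_gen\<close> the sign is \<open>s = 1\<close> or \<open>s = -1\<close>.\<close>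

definition A_coef ::
    "(nat \<Rightarrow> nat) \<Rightarrow> nat \<Rightarrow> nat \<Rightarrow> 'f::field \<Rightarrow> int \<Rightarrow> nat \<Rightarrow> nat \<Rightarrow> 'f ratfun" where
  "A_coef r m p q s k i =
     (let k' = nat (int k + s) in
      - of_int s * x_var k i powi (- (int (m div p) * (int (sig r k') - int (sig r k)))) *
      ((\<Prod>j\<in>{1..sig r k'}. bracket m p q (x_var k' j * inverse (x_var k i))) /
       (\<Prod>j\<in>{1..sig r k} - {i}. bracket m p q (x_var k j * inverse (x_var k i)))))"

definition X_gen ::
    "(nat \<Rightarrow> nat) \<Rightarrow> nat \<Rightarrow> nat \<Rightarrow> 'f::field \<Rightarrow> int \<Rightarrow> nat \<Rightarrow> 'f skew" where
  "X_gen r m p q s k =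
     (\<Sum>i\<in>{1..r k}. skew_mult (shift_act q)
        (Poly_Mapping.single (Poly_Mapping.single (k, i) s) 1) (coef (A_coef r m p q s k i)))"

definition OGZ :: "nat \<Rightarrow> (nat \<Rightarrow> nat) \<Rightarrow> nat \<Rightarrow> nat \<Rightarrow> 'f::field \<Rightarrow> ('f skew \<Rightarrow> 'f skew) set" where
  "OGZ n r m p q =
     generated_subalgebra (End_algebra (V_algebra n r q))
       (left_mult (V_algebra n r q) `
         (coef ` Gamma n r m p \<union> {X_gen r m p q s k | s k. s \<in> {1, -1} \<and> k \<in> {1..n - 1}}))"

abbreviation OGZ_algebra ::
    "nat \<Rightarrow> (nat \<Rightarrow> nat) \<Rightarrow> nat \<Rightarrow> nat \<Rightarrow> 'f::field \<Rightarrow> ('f, 'f skew \<Rightarrow> 'f skew) module" where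
  "OGZ_algebra n r m p q \<equiv> (End_algebra (V_algebra n r q))\<lparr>carrier := OGZ n r m p q\<rparr>"

end

theory Submission
  imports Defs
begin

text \<open>
  The map \<open>\<phi>\<close> is evaluation at \<open>1\<close>, which turns left multiplication by \<open>a\<close> into \<open>a\<close>. Its image
  lies in the invariants because \<open>G\<close> permutes the summands of \<open>X\<^sub>k\<^sup>\<plusminus>\<close>.

  For the Galois property, the invariants are spanned by the traces \<open>tr(b\<mu>) = \<Sum>\<^sub>g g(b\<mu>)\<close>
  with \<open>b \<in> L\<close> and \<open>\<mu> \<in> \<M>\<close>. Let \<open>u = \<Sum>\<^sub>\<nu> u\<^sub>\<nu> \<nu>\<close> be an element of the image with \<open>u\<^sub>\<mu> \<noteq> 0\<close>.
  Distinct \<open>\<nu>\<close> in its support restrict to distinct characters of \<open>\<Gamma>\<close>, so there are \<open>a\<^sub>i \<in> L\<close> and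
  \<open>\<gamma>\<^sub>i \<in> \<Gamma>\<close> such that \<open>\<Sum>\<^sub>i a\<^sub>i \<nu>(\<gamma>\<^sub>i)\<close> is \<open>1\<close> for \<open>\<nu> = \<mu>\<close> and \<open>0\<close> otherwise. Then
  \<open>\<Sum>\<^sub>i tr(a a\<^sub>i) u \<gamma>\<^sub>i = tr(a u\<^sub>\<mu> \<mu>)\<close> for all \<open>a \<in> L\<close>, and all traces over \<open>\<mu>\<close> are
  obtained; the right-hand version uses \<open>\<nu>\<^sup>-\<^sup>1\<close> in place of \<open>\<nu>\<close>. The same interpolation shows
  that the exponents which occur in supports are closed under addition, and those of the \<open>X\<^sub>k\<^sup>\<plusminus>\<close>
  generate \<open>\<M>\<close>. That \<open>L\<close> is Galois over \<open>K\<close> with group \<open>G\<close> is Artin's theorem, which follows from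
  the interpolation as well.
\<close>

text \<open>Shifts are told apart on \<Gamma> by the power sums over i of \<open>x_ki^m\<close>: the
  shift by \<mu> multiplies the term \<open>x_ki^m\<close> by q^(-m \<mu>(k,i)), and no positive
  power of q is 1. The interpolating a_i lie only in L, while products with elements of K are
  wanted; this forces the passage to traces. Since u is invariant and each \<gamma>_i is fixed, the
  translate of the a_i by g interpolates at g(\<mu>) in place of \<mu>, and the sum over g is a
  trace again. The coefficient of u at \<mu> is invertible in L, so every b in L is reached. Traces
  span the invariants because some t in L has trace 1, whence f = tr(t) f = tr(t f) for invariant f.
  For the exponents, the obstacle is cancellation: a product u w may lose the exponent \<mu> +
  \<rho>, and an element of \<Gamma> put between the factors separates the contributions. That the
  X_k have full support rests on two facts: m-th powers of distinct variables differ, and q^m is not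
  1, so no factor of a coefficient vanishes. Evaluation at 1 is injective because the left
  multiplications by invariants already form a subalgebra.\<close>

section \<open>Subrings and subfields of the field given by a type\<close>

lemma subring_type_algebraI:
  fixes S :: "'l::field set"
  assumes "1 \<in> S" "\<And>a. a \<in> S \<Longrightarrow> - a \<in> S" "\<And>a b. a \<in> S \<Longrightarrow> b \<in> S \<Longrightarrow> a + b \<in> S"
    "\<And>a b. a \<in> S \<Longrightarrow> b \<in> S \<Longrightarrow> a * b \<in> S"
  shows "subring S ring_of_type_algebra"
proof -
  interpret F: field "ring_of_type_algebra :: 'l ring" by rule
  have neg: "\<ominus>\<^bsub>ring_of_type_algebra\<^esub> a = - a" for a :: 'l
    by (rule F.minus_equality) (auto simp: ring_of_type_algebra_def)
  show ?thesis
    by (rule F.subringI) (use assms in \<open>auto simp: neg\<close>, auto simp: ring_of_type_algebra_def)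
qed

lemma subfield_type_algebraI:
  fixes S :: "'l::field set"
  assumes "1 \<in> S" "\<And>a. a \<in> S \<Longrightarrow> - a \<in> S" "\<And>a b. a \<in> S \<Longrightarrow> b \<in> S \<Longrightarrow> a + b \<in> S"
    "\<And>a b. a \<in> S \<Longrightarrow> b \<in> S \<Longrightarrow> a * b \<in> S" "\<And>a. a \<in> S \<Longrightarrow> a \<noteq> 0 \<Longrightarrow> inverse a \<in> S"
  shows "subfield S ring_of_type_algebra"
proof -
  interpret F: field "ring_of_type_algebra :: 'l ring" by rule
  show ?thesis
  proof (rule F.subfieldI')
    show "subring S ring_of_type_algebra" using assms(1-4) by (rule subring_type_algebraI)
    fix k :: 'l assume k: "k \<in> S - {\<zero>\<^bsub>ring_of_type_algebra\<^esub>}"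
    hence k: "k \<in> S" "k \<noteq> 0" by (auto simp: ring_of_type_algebra_def)
    have "inverse k = inv\<^bsub>ring_of_type_algebra\<^esub> k"
      by (rule F.inv_unique') (use k in \<open>auto simp: ring_of_type_algebra_def\<close>)
    thus "inv\<^bsub>ring_of_type_algebra\<^esub> k \<in> S" using assms(5)[OF k] by simp
  qed
qed

lemma subring_type_algebraD:
  fixes S :: "'l::field set"
  assumes "subring S ring_of_type_algebra"
  shows "0 \<in> S" "1 \<in> S" "a \<in> S \<Longrightarrow> - a \<in> S" "a \<in> S \<Longrightarrow> b \<in> S \<Longrightarrow> a + b \<in> S"
    "a \<in> S \<Longrightarrow> b \<in> S \<Longrightarrow> a * b \<in> S"
proof -
  interpret F: field "ring_of_type_algebra :: 'l ring" by rule
  have neg: "\<ominus>\<^bsub>ring_of_type_algebra\<^esub> a = - a" for a :: 'l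
    by (rule F.minus_equality) (auto simp: ring_of_type_algebra_def)
  note * = subringE[OF assms]
  show "0 \<in> S" "1 \<in> S" "a \<in> S \<Longrightarrow> - a \<in> S" "a \<in> S \<Longrightarrow> b \<in> S \<Longrightarrow> a + b \<in> S"
    "a \<in> S \<Longrightarrow> b \<in> S \<Longrightarrow> a * b \<in> S"
    using *(2-7) neg by (auto simp: ring_of_type_algebra_def)
qed

text \<open>The rule for inverses carries no condition a \<noteq> 0, since
  \<open>inverse 0 = 0\<close>. Quotients, written as products with an inverse, are then covered by
  the closure rules without side conditions.\<close>

lemma subfield_type_algebraD:
  fixes S :: "'l::field set"
  assumes "subfield S ring_of_type_algebra"
  shows "0 \<in> S" "1 \<in> S" "a \<in> S \<Longrightarrow> - a \<in> S" "a \<in> S \<Longrightarrow> b \<in> S \<Longrightarrow> a + b \<in> S"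
    "a \<in> S \<Longrightarrow> b \<in> S \<Longrightarrow> a * b \<in> S" "a \<in> S \<Longrightarrow> inverse a \<in> S"
proof -
  interpret F: field "ring_of_type_algebra :: 'l ring" by rule
  have sub: "subring S ring_of_type_algebra" using subfieldE(1)[OF assms] .
  note * = subring_type_algebraD[OF sub]
  show "0 \<in> S" "1 \<in> S" "a \<in> S \<Longrightarrow> - a \<in> S" "a \<in> S \<Longrightarrow> b \<in> S \<Longrightarrow> a + b \<in> S"
    "a \<in> S \<Longrightarrow> b \<in> S \<Longrightarrow> a * b \<in> S"
    using * by auto
  have inv: "inv\<^bsub>ring_of_type_algebra\<^esub> a = inverse a" if "a \<noteq> 0" for a :: 'l
    by (rule F.inv_unique'[symmetric]) (use that in \<open>auto simp: ring_of_type_algebra_def\<close>)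
  show "a \<in> S \<Longrightarrow> inverse a \<in> S"
    using F.subfield_m_inv(1)[OF assms, of a] inv[of a] *(1)
    by (cases "a = 0") (auto simp: ring_of_type_algebra_def)
qed

lemma sum_closed:
  fixes f :: "'i \<Rightarrow> 'a::comm_monoid_add"
  assumes "0 \<in> S" "\<And>a b. a \<in> S \<Longrightarrow> b \<in> S \<Longrightarrow> a + b \<in> S" "\<And>i. i \<in> I \<Longrightarrow> f i \<in> S"
  shows "sum f I \<in> S"
  using assms(3) by (induction I rule: infinite_finite_induct) (auto intro: assms(1,2))

lemma prod_closed:
  fixes f :: "'i \<Rightarrow> 'a::comm_monoid_mult"
  assumes "1 \<in> S" "\<And>a b. a \<in> S \<Longrightarrow> b \<in> S \<Longrightarrow> a * b \<in> S" "\<And>i. i \<in> I \<Longrightarrow> f i \<in> S"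
  shows "prod f I \<in> S"
  using assms(3) by (induction I rule: infinite_finite_induct) (auto intro: assms(1,2))

lemma fractions_of_subfield:
  assumes "subring S ring_of_type_algebra"
  shows "subfield (fractions_of S) ring_of_type_algebra"
proof (rule subfield_type_algebraI)
  note S = subring_type_algebraD[OF assms]
  have I: "a \<in> S \<Longrightarrow> b \<in> S \<Longrightarrow> b \<noteq> 0 \<Longrightarrow> z = a / b \<Longrightarrow> z \<in> fractions_of S" for a b z
    unfolding fractions_of_def by blast
  show "1 \<in> fractions_of S" by (rule I[of 1 1]) (auto intro: S)
  fix x assume "x \<in> fractions_of S"
  then obtain a b where ab: "a \<in> S" "b \<in> S" "b \<noteq> 0" "x = a / b" unfolding fractions_of_def by blast
  show "- x \<in> fractions_of S" by (rule I[of "- a" b]) (use ab S in auto)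
  show "x \<noteq> 0 \<Longrightarrow> inverse x \<in> fractions_of S" by (rule I[of b a]) (use ab S in auto)
  fix y assume "y \<in> fractions_of S"
  then obtain c d where cd: "c \<in> S" "d \<in> S" "d \<noteq> 0" "y = c / d" unfolding fractions_of_def by blast
  show "x * y \<in> fractions_of S" by (rule I[of "a * c" "b * d"]) (use ab cd S in auto)
  show "x + y \<in> fractions_of S"
    by (rule I[of "a * d + c * b" "b * d"]) (use ab cd S in \<open>auto simp: add_frac_eq\<close>)
qed

lemma subset_fractions_of:
  assumes "subring S ring_of_type_algebra"
  shows "S \<subseteq> fractions_of S"
proof
  fix x assume "x \<in> S"
  hence "x \<in> S \<and> 1 \<in> S \<and> x = x / 1" using subring_type_algebraD[OF assms] by simp
  thus "x \<in> fractions_of S" unfolding fractions_of_def by (metis (mono_tags, lifting) mem_Collect_eq one_neq_zero)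
qed

text \<open>
  A quantitative form of Dedekind's lemma: one multiplies, over the \<open>\<nu> \<noteq> \<mu>\<close>, the expressions
  \<open>(e\<^sub>\<nu>(y) - e\<^sub>\<kappa>(y)) / (e\<^sub>\<nu>(y) - e\<^sub>\<mu>(y))\<close>, which vanish at \<open>\<kappa> = \<nu>\<close> and are \<open>1\<close> at \<open>\<kappa> = \<mu>\<close>.
\<close>

lemma dedekind_interpolation:
  fixes e :: "'i \<Rightarrow> 'a::comm_monoid_mult \<Rightarrow> 'l::field"
  assumes "finite S" and L: "subfield L ring_of_type_algebra"
    and \<Gamma>: "1 \<in> \<Gamma>" "\<And>x y. x \<in> \<Gamma> \<Longrightarrow> y \<in> \<Gamma> \<Longrightarrow> x * y \<in> \<Gamma>"
    and e: "\<And>\<nu>. \<nu> \<in> insert \<mu> S \<Longrightarrow> e \<nu> 1 = 1"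
      "\<And>\<nu> x y. \<nu> \<in> insert \<mu> S \<Longrightarrow> x \<in> \<Gamma> \<Longrightarrow> y \<in> \<Gamma> \<Longrightarrow> e \<nu> (x * y) = e \<nu> x * e \<nu> y"
      "\<And>\<nu> x. \<nu> \<in> insert \<mu> S \<Longrightarrow> x \<in> \<Gamma> \<Longrightarrow> e \<nu> x \<in> L"
    and sep: "\<And>\<nu>. \<nu> \<in> S \<Longrightarrow> \<nu> \<noteq> \<mu> \<Longrightarrow> \<exists>y\<in>\<Gamma>. e \<nu> y \<noteq> e \<mu> y"
  shows "\<exists>(N::nat) a y. (\<forall>i<N. a i \<in> L \<and> y i \<in> \<Gamma>) \<and>
    (\<forall>\<nu>\<in>insert \<mu> S. (\<Sum>i<N. a i * e \<nu> (y i)) = (if \<nu> = \<mu> then 1 else 0))"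
proof -
  note L = subfield_type_algebraD[OF L]
  \<comment> \<open>Lists of pairs replace indexed families during the induction, because a step
    concatenates two of them; the indexed form is recovered at the end.\<close>
  have "\<exists>ps. set ps \<subseteq> L \<times> \<Gamma> \<and> (\<forall>\<nu>\<in>insert \<mu> S.
      (\<Sum>(a, y)\<leftarrow>ps. a * e \<nu> y) = (if \<nu> = \<mu> then 1 else 0))"
    using assms(1) e sep
  proof (induction S)
    case empty
    show ?case by (rule exI[of _ "[(1, 1)]"]) (use empty L \<Gamma> in auto)
  next
    case (insert \<nu> S)
    have "\<exists>ps. set ps \<subseteq> L \<times> \<Gamma> \<and> (\<forall>\<nu>\<in>insert \<mu> S.
      (\<Sum>(a, y)\<leftarrow>ps. a * e \<nu> y) = (if \<nu> = \<mu> then 1 else 0))"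
      by (rule insert.IH) (use insert.prems in auto)
    then obtain ps where ps: "set ps \<subseteq> L \<times> \<Gamma>"
      "\<And>\<kappa>. \<kappa> \<in> insert \<mu> S \<Longrightarrow> (\<Sum>(a, y)\<leftarrow>ps. a * e \<kappa> y) = (if \<kappa> = \<mu> then 1 else 0)"
      by blast
    show ?case
    proof (cases "\<nu> = \<mu>")
      case True
      thus ?thesis using ps by auto
    next
      case False
      then obtain y where y: "y \<in> \<Gamma>" "e \<nu> y \<noteq> e \<mu> y" using insert.prems(4) by blast
      define d where "d = inverse (e \<nu> y - e \<mu> y)"
      have dL: "d \<in> L" "e \<nu> y \<in> L"
        unfolding d_def diff_conv_add_uminus by (intro L insert.prems y; simp)+
      \<comment> \<open>The list encodes the old sum times (e_\<nu>(y) - e_\<kappa>(y)) d. The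
        constant e_\<nu>(y) goes into the coefficients; e_\<kappa>(y), which varies with \<kappa>,
        goes into the argument by multiplicativity.\<close>
      define qs where "qs = map (\<lambda>(a, x). (e \<nu> y * d * a, x)) ps @ map (\<lambda>(a, x). (- d * a, x * y)) ps"
      have "set qs \<subseteq> L \<times> \<Gamma>" using ps(1) dL y unfolding qs_def by (auto intro!: L \<Gamma>)
      moreover have "(\<Sum>(a, x)\<leftarrow>qs. a * e \<kappa> x) = (if \<kappa> = \<mu> then 1 else 0)"
        if \<kappa>: "\<kappa> \<in> insert \<mu> (insert \<nu> S)" for \<kappa>
      proof -
        let ?s = "\<Sum>(a, x)\<leftarrow>ps. a * e \<kappa> x"
        have "(\<Sum>(a, x)\<leftarrow>map (\<lambda>(a, x). (e \<nu> y * d * a, x)) ps. a * e \<kappa> x) = e \<nu> y * d * ?s"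
          by (simp add: sum_list_const_mult[symmetric] o_def case_prod_unfold mult.assoc)
        moreover have "(\<Sum>(a, x)\<leftarrow>map (\<lambda>(a, x). (- d * a, x * y)) ps. a * e \<kappa> x) = - d * e \<kappa> y * ?s"
          unfolding sum_list_const_mult[symmetric] map_map
          by (rule arg_cong[of _ _ sum_list], rule map_cong[OF refl])
            (use insert.prems(2)[OF \<kappa> _ y(1)] ps(1) in \<open>auto simp: algebra_simps\<close>)
        ultimately have *: "(\<Sum>(a, x)\<leftarrow>qs. a * e \<kappa> x) = (e \<nu> y - e \<kappa> y) * d * ?s"
          unfolding qs_def by (simp add: algebra_simps)
        show ?thesis
        proof (cases "\<kappa> = \<nu>")
          case True
          thus ?thesis using * False by simp
        next
          case False
          hence "\<kappa> \<in> insert \<mu> S" using \<kappa> by auto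
          from ps(2)[OF this] show ?thesis unfolding * d_def using y(2) by simp
        qed
      qed
      ultimately show ?thesis by blast
    qed
  qed
  then obtain ps where ps: "set ps \<subseteq> L \<times> \<Gamma>"
      "\<And>\<nu>. \<nu> \<in> insert \<mu> S \<Longrightarrow> (\<Sum>(a, y)\<leftarrow>ps. a * e \<nu> y) = (if \<nu> = \<mu> then 1 else 0)"
    by blast
  have "fst (ps ! i) \<in> L \<and> snd (ps ! i) \<in> \<Gamma>" if "i < length ps" for i
    using ps(1) nth_mem[OF that] by (metis SigmaE fst_conv snd_conv subsetD)
  moreover have "(\<Sum>i<length ps. fst (ps ! i) * e \<nu> (snd (ps ! i))) = (if \<nu> = \<mu> then 1 else 0)"
    if "\<nu> \<in> insert \<mu> S" for \<nu>
    using ps(2)[OF that] by (simp add: sum_list_sum_nth atLeast0LessThan case_prod_unfold)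
  ultimately show ?thesis
    by (intro exI[of _ "length ps"] exI[of _ "\<lambda>i. fst (ps ! i)"] exI[of _ "\<lambda>i. snd (ps ! i)"]) blast
qed

section \<open>Artin's theorem\<close>

text \<open>The action is on the whole ambient field, so that additivity and multiplicativity carry
  no membership conditions; only stability and faithfulness refer to L.\<close>

locale finite_field_action = group G for G :: "('g, 'z) monoid_scheme" (structure) +
  fixes gL :: "'g \<Rightarrow> 'l::field \<Rightarrow> 'l" and L :: "'l set"
  assumes finite_G: "finite (carrier G)"
    and L_subfield: "subfield L ring_of_type_algebra"
    and gL_add: "g \<in> carrier G \<Longrightarrow> gL g (a + b) = gL g a + gL g b"
    and gL_mult: "g \<in> carrier G \<Longrightarrow> gL g (a * b) = gL g a * gL g b"
    and gL_one [simp]: "gL \<one> a = a"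
    and gL_comp: "g \<in> carrier G \<Longrightarrow> h \<in> carrier G \<Longrightarrow> gL (g \<otimes> h) a = gL g (gL h a)"
    and gL_closed: "g \<in> carrier G \<Longrightarrow> a \<in> L \<Longrightarrow> gL g a \<in> L"
    and faithful: "g \<in> carrier G \<Longrightarrow> (\<And>a. a \<in> L \<Longrightarrow> gL g a = a) \<Longrightarrow> g = \<one>"
begin

lemmas L_closed = subfield_type_algebraD[OF L_subfield]

definition fixed_field :: "'l set" where
  "fixed_field = {a \<in> L. \<forall>g\<in>carrier G. gL g a = a}"

definition tr :: "'l \<Rightarrow> 'l" where
  "tr a = (\<Sum>g\<in>carrier G. gL g a)"

lemma gL_inv [simp]: "g \<in> carrier G \<Longrightarrow> gL (inv g) (gL g a) = a"
  "g \<in> carrier G \<Longrightarrow> gL g (gL (inv g) a) = a"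
  by (simp_all flip: gL_comp)

lemma gL_0 [simp]: "g \<in> carrier G \<Longrightarrow> gL g 0 = 0"
  using gL_add[of g 0 0] by (metis add_cancel_right_right add_0)

lemma gL_1 [simp]: "g \<in> carrier G \<Longrightarrow> gL g 1 = 1"
  using gL_mult[of g 1 "gL (inv g) 1"] by simp

lemma gL_minus: "g \<in> carrier G \<Longrightarrow> gL g (- a) = - gL g a"
  using gL_add[of g a "- a"] by (simp add: eq_neg_iff_add_eq_0 add.commute)

lemma gL_eq_0_iff [simp]: "g \<in> carrier G \<Longrightarrow> gL g a = 0 \<longleftrightarrow> a = 0"
  using gL_inv(1)[of g a] gL_0[of "inv g"] gL_0[of g] by (metis inv_closed)

lemma gL_inverse: "g \<in> carrier G \<Longrightarrow> gL g (inverse a) = inverse (gL g a)"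
  using gL_mult[of g a "inverse a"] by (cases "a = 0") (auto simp: inverse_unique)

lemma gL_sum: "g \<in> carrier G \<Longrightarrow> gL g (\<Sum>i\<in>I. f i) = (\<Sum>i\<in>I. gL g (f i))"
  by (induction I rule: infinite_finite_induct) (auto simp: gL_add)

lemma gL_prod: "g \<in> carrier G \<Longrightarrow> gL g (\<Prod>i\<in>I. f i) = (\<Prod>i\<in>I. gL g (f i))"
  by (induction I rule: infinite_finite_induct) (auto simp: gL_mult)

lemma bij_betw_mult_left: "h \<in> carrier G \<Longrightarrow> bij_betw ((\<otimes>) h) (carrier G) (carrier G)"
  by (rule bij_betw_byWitness[where f' = "(\<otimes>) (inv h)"]) (auto simp: m_assoc[symmetric])

lemma fixed_field_subfield: "subfield fixed_field ring_of_type_algebra"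
  by (rule subfield_type_algebraI)
    (auto simp: fixed_field_def gL_add gL_mult gL_minus gL_inverse L_closed)

lemma fixed_fieldD: "k \<in> fixed_field \<Longrightarrow> k \<in> L" "k \<in> fixed_field \<Longrightarrow> g \<in> carrier G \<Longrightarrow> gL g k = k"
  by (auto simp: fixed_field_def)

lemma tr_fixed: "a \<in> L \<Longrightarrow> tr a \<in> fixed_field"
proof -
  assume a: "a \<in> L"
  have "gL h (tr a) = tr a" if "h \<in> carrier G" for h
    unfolding tr_def using that sum.reindex_bij_betw[OF bij_betw_mult_left[OF that], of "\<lambda>g. gL g a"]
    by (simp add: gL_sum gL_comp)
  thus ?thesis
    using a unfolding fixed_field_def by (auto simp: tr_def intro!: sum_closed[of L] L_closed gL_closed)
qed

lemma gL_separates: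
  assumes "g \<in> carrier G" "h \<in> carrier G" "g \<noteq> h"
  shows "\<exists>y\<in>L. gL g y \<noteq> gL h y"
proof (rule ccontr)
  assume "\<not> ?thesis"
  hence "gL (inv h \<otimes> g) y = y" if "y \<in> L" for y using that assms by (simp add: gL_comp)
  hence "inv h \<otimes> g = \<one>" using assms faithful[of "inv h \<otimes> g"] by simp
  thus False using assms by (metis inv_closed inv_equality inv_inv)
qed

text \<open>Interpolate the elements of G, as characters of L, at the identity. Exchanging the sums
  turns the left side into the sum over g of (sum of a_i g(b_i)) g(c), where only the identity
  survives. The a_i thus span L over the fixed field, with coordinates given by traces.\<close>

lemma trace_expansion:
  "\<exists>(N::nat) a b. (\<forall>i<N. a i \<in> L \<and> b i \<in> L) \<and> (\<forall>c\<in>L. (\<Sum>i<N. a i * tr (b i * c)) = c)"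
proof -
  have ins: "insert \<one> (carrier G) = carrier G" by auto
  have "\<exists>(N::nat) a b. (\<forall>i<N. a i \<in> L \<and> b i \<in> L) \<and>
    (\<forall>g\<in>insert \<one> (carrier G). (\<Sum>i<N. a i * gL g (b i)) = (if g = \<one> then 1 else 0))"
    by (rule dedekind_interpolation)
      (use gL_separates[OF _ one_closed] in
        \<open>simp_all add: ins finite_G L_subfield L_closed gL_closed gL_mult\<close>)
  then obtain N :: nat and a b where ab: "\<forall>i<N. a i \<in> L \<and> b i \<in> L"
    "\<forall>g\<in>insert \<one> (carrier G). (\<Sum>i<N. a i * gL g (b i)) = (if g = \<one> then 1 else 0)"
    by (elim exE conjE)
  have "(\<Sum>i<N. a i * tr (b i * c)) = c" for c
  proof -
    have "(\<Sum>i<N. a i * tr (b i * c)) = (\<Sum>i<N. \<Sum>g\<in>carrier G. a i * gL g (b i) * gL g c)"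
      unfolding tr_def sum_distrib_left by (intro sum.cong) (auto simp: gL_mult mult.assoc)
    also have "\<dots> = (\<Sum>g\<in>carrier G. (\<Sum>i<N. a i * gL g (b i)) * gL g c)"
      by (subst sum.swap) (simp add: sum_distrib_right)
    also have "\<dots> = (\<Sum>g\<in>carrier G. if g = \<one> then gL g c else 0)"
      by (intro sum.cong) (use ab(2) in auto)
    finally show ?thesis using finite_G by simp
  qed
  with ab(1) show ?thesis by (intro exI[of _ N] exI[of _ a] exI[of _ b]) simp
qed

text \<open>If all tr(b_i) vanished, the expansion of c = 1 would be 0. A nonzero tr(b_i) is fixed
  by G, so it can be divided out under the trace.\<close>

lemma trace_one: obtains a where "a \<in> L" "tr a = 1"
proof -
  obtain N :: nat and a b where
    exp: "\<forall>i<N. a i \<in> L \<and> b i \<in> L" "\<forall>c\<in>L. (\<Sum>i<N. a i * tr (b i * c)) = c"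
    using trace_expansion by (elim exE conjE)
  have ab: "\<And>i. i < N \<Longrightarrow> a i \<in> L" "\<And>i. i < N \<Longrightarrow> b i \<in> L"
    "\<And>c. c \<in> L \<Longrightarrow> (\<Sum>i<N. a i * tr (b i * c)) = c"
    using exp by simp_all
  have "\<exists>i<N. tr (b i) \<noteq> 0"
  proof (rule ccontr)
    assume "\<not> ?thesis"
    hence "(\<Sum>i<N. a i * tr (b i * 1)) = 0" by (intro sum.neutral) auto
    thus False using ab(3)[OF L_closed(2)] by simp
  qed
  then obtain i where i: "i < N" "tr (b i) \<noteq> 0" by blast
  have K: "tr (b i) \<in> fixed_field" using i ab(2) tr_fixed by blast
  let ?a = "inverse (tr (b i)) * b i"
  have "tr ?a = inverse (tr (b i)) * tr (b i)"
    using fixed_fieldD[OF subfield_type_algebraD(6)[OF fixed_field_subfield K]]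
    by (simp add: tr_def[of ?a] gL_mult sum_distrib_left flip: tr_def[of "b i"]) (simp add: tr_def sum_distrib_left)
  hence "tr ?a = 1" using i by simp
  moreover have "?a \<in> L" using ab(2) i fixed_fieldD(1)[OF K] by (auto intro!: L_closed)
  ultimately show thesis using that by blast
qed

text \<open>Applying f to the trace expansion gives f(c) as the sum of f(a_i) tr(b_i c), because f
  fixes traces; hence f is an L-linear combination of elements of G. If f were none of them,
  interpolation would give an L-combination of evaluations that is 1 on f and 0 on all of G, a
  contradiction.\<close>

lemma automorphism_in_group:
  assumes f: "f \<in> field_auts L" and fK: "\<And>a. a \<in> fixed_field \<Longrightarrow> f a = a"
  shows "\<exists>g\<in>carrier G. \<forall>a\<in>L. f a = gL g a"
proof (rule ccontr)
  assume contr: "\<not> ?thesis"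
  have f_add: "f (x + y) = f x + f y" and f_mult: "f (x * y) = f x * f y"
    if "x \<in> L" "y \<in> L" for x y
    using f that unfolding field_auts_def by auto
  have f_closed: "f x \<in> L" if "x \<in> L" for x
    using f that Bij_imp_funcset[of f L] unfolding field_auts_def by auto
  have f0: "f 0 = 0" and f1: "f 1 = 1"
    by (rule fK, rule subfield_type_algebraD[OF fixed_field_subfield])+
  have f_sum: "f (\<Sum>i\<in>I. h i) = (\<Sum>i\<in>I. f (h i))" if "\<And>i. i \<in> I \<Longrightarrow> h i \<in> L" for I :: "nat set" and h
    using that
  proof (induction I rule: infinite_finite_induct)
    case (insert i I)
    moreover have "sum h I \<in> L" using insert.prems by (intro sum_closed) (auto intro: L_closed)
    ultimately show ?case by (auto simp: f_add)
  qed (auto simp: f0)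
  \<comment> \<open>The index \<open>None\<close> adjoins f to the family of group elements as one
    more character.\<close>
  define e where "e = case_option f gL"
  define S where "S = Some ` carrier G"
  have fin: "finite S" using finite_G by (simp add: S_def)
  have e: "e \<nu> 1 = 1" "\<And>x y. x \<in> L \<Longrightarrow> y \<in> L \<Longrightarrow> e \<nu> (x * y) = e \<nu> x * e \<nu> y"
    "\<And>x. x \<in> L \<Longrightarrow> e \<nu> x \<in> L" if "\<nu> \<in> insert None S" for \<nu>
  proof -
    consider "\<nu> = None" | g where "\<nu> = Some g" "g \<in> carrier G" using \<open>\<nu> \<in> insert None S\<close> unfolding S_def by blast
    note cases = this
    show "e \<nu> 1 = 1" by (cases rule: cases) (simp_all add: e_def f1)
    show "e \<nu> (x * y) = e \<nu> x * e \<nu> y" if "x \<in> L" "y \<in> L" for x y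
      by (cases rule: cases) (simp_all add: e_def f_mult that gL_mult)
    show "e \<nu> x \<in> L" if "x \<in> L" for x
      by (cases rule: cases) (simp_all add: e_def f_closed that gL_closed)
  qed
  have sep: "\<exists>y\<in>L. e \<nu> y \<noteq> e None y" if "\<nu> \<in> S" for \<nu>
  proof -
    from that obtain g where g: "g \<in> carrier G" "\<nu> = Some g" unfolding S_def by (rule imageE)
    hence "\<not> (\<forall>a\<in>L. f a = gL g a)" using contr by meson
    then obtain y where "y \<in> L" "f y \<noteq> gL g y" by meson
    thus ?thesis by (intro bexI[of _ y]) (simp_all add: e_def g)
  qed
  have "\<exists>(N::nat) d y. (\<forall>i<N. d i \<in> L \<and> y i \<in> L) \<and>
    (\<forall>\<nu>\<in>insert None S. (\<Sum>i<N. d i * e \<nu> (y i)) = (if \<nu> = None then 1 else 0))"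
  proof (rule dedekind_interpolation[of S L L None e])
    show "\<exists>y\<in>L. e \<nu> y \<noteq> e None y" if "\<nu> \<in> S" for \<nu> using that by (rule sep)
  qed (simp_all add: fin L_subfield L_closed e)
  then obtain N :: nat and d y where exp: "\<forall>i<N. d i \<in> L \<and> y i \<in> L"
    "\<forall>\<nu>\<in>insert None S. (\<Sum>i<N. d i * e \<nu> (y i)) = (if \<nu> = None then 1 else 0)"
    by (elim exE conjE)
  have dy: "\<And>i. i < N \<Longrightarrow> y i \<in> L"
    "\<And>\<nu>. \<nu> \<in> insert None S \<Longrightarrow> (\<Sum>i<N. d i * e \<nu> (y i)) = (if \<nu> = None then 1 else 0)"
    using exp by blast+
  have dy0: "(\<Sum>j<N. d j * gL g (y j)) = 0" if "g \<in> carrier G" for g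
    using dy(2)[of "Some g"] that by (auto simp: S_def e_def)
  have dy1: "(\<Sum>j<N. d j * f (y j)) = 1" using dy(2)[of None] by (auto simp: e_def)
  obtain M :: nat and a b where
    exp: "\<forall>i<M. a i \<in> L \<and> b i \<in> L" "\<forall>c\<in>L. (\<Sum>i<M. a i * tr (b i * c)) = c"
    using trace_expansion by (elim exE conjE)
  have ab: "\<And>i. i < M \<Longrightarrow> a i \<in> L" "\<And>i. i < M \<Longrightarrow> b i \<in> L"
    "\<And>c. c \<in> L \<Longrightarrow> (\<Sum>i<M. a i * tr (b i * c)) = c"
    using exp by simp_all
  have f_eq: "f c = (\<Sum>i<M. f (a i) * tr (b i * c))" if c: "c \<in> L" for c
  proof -
    have t: "tr (b i * c) \<in> L" "f (tr (b i * c)) = tr (b i * c)" if "i < M" for i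
    proof -
      have "b i * c \<in> L" using ab(2) c that by (intro L_closed)
      hence "tr (b i * c) \<in> fixed_field" by (rule tr_fixed)
      thus "tr (b i * c) \<in> L" "f (tr (b i * c)) = tr (b i * c)" by (auto intro: fK fixed_fieldD(1))
    qed
    have "f c = f (\<Sum>i<M. a i * tr (b i * c))" by (rule arg_cong[OF ab(3)[OF c, symmetric]])
    also have "\<dots> = (\<Sum>i<M. f (a i * tr (b i * c)))" using ab(1,2) t by (intro f_sum) (auto intro!: L_closed)
    also have "\<dots> = (\<Sum>i<M. f (a i) * tr (b i * c))" using ab(1,2) t by (intro sum.cong) (auto simp: f_mult)
    finally show ?thesis .
  qed
  have "1 = (\<Sum>j<N. d j * f (y j))" using dy1 by simp
  also have "\<dots> = (\<Sum>j<N. \<Sum>i<M. \<Sum>g\<in>carrier G. f (a i) * gL g (b i) * (d j * gL g (y j)))"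
  proof (rule sum.cong[OF refl])
    fix j assume "j \<in> {..<N}"
    hence "f (y j) = (\<Sum>i<M. f (a i) * tr (b i * y j))" using dy(1) by (intro f_eq) auto
    thus "d j * f (y j) = (\<Sum>i<M. \<Sum>g\<in>carrier G. f (a i) * gL g (b i) * (d j * gL g (y j)))"
      by (simp add: tr_def sum_distrib_left gL_mult mult_ac)
  qed
  also have "\<dots> = (\<Sum>i<M. \<Sum>g\<in>carrier G. f (a i) * gL g (b i) * (\<Sum>j<N. d j * gL g (y j)))"
    by (subst sum.swap, intro sum.cong refl, subst sum.swap, simp add: sum_distrib_left)
  also have "\<dots> = 0" using dy0 by simp
  finally show False by simp
qed

lemma gL_field_auts:
  assumes "g \<in> carrier G" shows "restrict (gL g) L \<in> field_auts L"
proof -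
  have "bij_betw (gL g) L L"
    by (rule bij_betw_byWitness[where f' = "gL (inv g)"]) (use assms in \<open>auto intro: gL_closed\<close>)
  thus ?thesis using assms by (auto simp: field_auts_def Bij_def L_closed gL_add gL_mult)
qed

theorem galois_iso: "(\<lambda>g. restrict (gL g) L) \<in> iso G (gal_group L fixed_field)"
proof -
  have "restrict (gL (g \<otimes> h)) L = compose L (restrict (gL g) L) (restrict (gL h) L)"
    if "g \<in> carrier G" "h \<in> carrier G" for g h
    using that by (auto simp: compose_def gL_comp gL_closed)
  hence hom: "(\<lambda>g. restrict (gL g) L) \<in> hom G (gal_group L fixed_field)"
    using gL_field_auts fixed_fieldD
    by (auto simp: hom_def gal_group_def BijGroup_def field_auts_def)
  have "bij_betw (\<lambda>g. restrict (gL g) L) (carrier G) (carrier (gal_group L fixed_field))"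
    unfolding bij_betw_def
  proof
    show "inj_on (\<lambda>g. restrict (gL g) L) (carrier G)"
      using gL_separates by (intro inj_onI) (metis restrict_apply')
    have "f \<in> (\<lambda>g. restrict (gL g) L) ` carrier G" if f: "f \<in> carrier (gal_group L fixed_field)" for f
    proof -
      have "f \<in> field_auts L" "\<And>a. a \<in> fixed_field \<Longrightarrow> f a = a" using f by (auto simp: gal_group_def)
      from automorphism_in_group[OF this] obtain g where g: "g \<in> carrier G" "\<forall>a\<in>L. f a = gL g a" by blast
      moreover have "f \<in> extensional L" using f by (auto simp: gal_group_def field_auts_def Bij_def)
      ultimately have "f = restrict (gL g) L" by (intro extensionalityI[of _ L]) auto
      thus ?thesis using g by blast
    qed
    thus "(\<lambda>g. restrict (gL g) L) ` carrier G = carrier (gal_group L fixed_field)"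
      using hom by (auto simp: hom_def)
  qed
  thus ?thesis using hom by (simp add: iso_def)
qed

text \<open>The a_i of \<open>trace_expansion\<close> are a finite spanning set, which gives finite
  dimension; that nothing outside the fixed field is fixed by the Galois group follows from
  \<open>galois_iso\<close>.\<close>

theorem finite_galois_fixed_field: "finite_galois fixed_field L"
proof -
  interpret F: field "ring_of_type_algebra :: 'l ring" by rule
  let ?R = "ring_of_type_algebra :: 'l ring"
  obtain N :: nat and a b where
    exp: "\<forall>i<N. a i \<in> L \<and> b i \<in> L" "\<forall>c\<in>L. (\<Sum>i<N. a i * tr (b i * c)) = c"
    using trace_expansion by (elim exE conjE)
  have ab: "\<And>i. i < N \<Longrightarrow> a i \<in> L" "\<And>i. i < N \<Longrightarrow> b i \<in> L"
    "\<And>c. c \<in> L \<Longrightarrow> (\<Sum>i<N. a i * tr (b i * c)) = c"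
    using exp by simp_all
  define us where "us = map a [0..<N]"
  have "F.combine (map (\<lambda>i. tr (b i * c)) is) (map a is) = (\<Sum>i\<leftarrow>is. a i * tr (b i * c))" for "is" c
    by (induction "is")
      (simp_all only: list.map sum_list.Nil sum_list.Cons F.combine.simps, simp_all add: ring_of_type_algebra_def mult.commute)
  hence comb: "F.combine (map (\<lambda>i. tr (b i * c)) [0..<N]) us = c" if "c \<in> L" for c
    unfolding us_def using ab(3)[OF that] by (simp add: interv_sum_list_conv_sum_set_nat atLeast0LessThan)
  have us: "set us \<subseteq> carrier ?R" "set us \<subseteq> L" using ab(1) by (auto simp: us_def ring_of_type_algebra_def)
  have "F.Span fixed_field us = L"
  proof
    have "F.combine ks us' \<in> L" if "set ks \<subseteq> fixed_field" "set us' \<subseteq> L" for ks us'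
      using that
    proof (induction ks us' rule: F.combine.induct)
      case (1 k ks u us)
      thus ?case
        by (simp only: F.combine.simps) (auto simp: ring_of_type_algebra_def fixed_fieldD intro!: L_closed)
    qed (simp_all only: F.combine.simps, simp_all add: ring_of_type_algebra_def L_closed)
    thus "F.Span fixed_field us \<subseteq> L"
      unfolding F.Span_eq_combine_set[OF fixed_field_subfield us(1)] using us(2) by auto
    show "L \<subseteq> F.Span fixed_field us"
    proof
      fix c assume c: "c \<in> L"
      define ks where "ks = map (\<lambda>i. tr (b i * c)) [0..<N]"
      have "set ks \<subseteq> fixed_field" 
        unfolding ks_def using ab(2) c L_closed(5) tr_fixed by auto
      moreover have "c = F.combine ks us" unfolding ks_def by (rule comb[OF c, symmetric])
      ultimately show "c \<in> F.Span fixed_field us"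
        unfolding F.Span_eq_combine_set[OF fixed_field_subfield us(1)]
        by (intro CollectI exI[of _ ks] conjI)
    qed
  qed
  hence "F.finite_dimension fixed_field L" using F.Span_finite_dimension[OF fixed_field_subfield us(1)] by simp
  moreover have "{a \<in> L. \<forall>f\<in>carrier (gal_group L fixed_field). f a = a} = fixed_field"
  proof -
    have "carrier (gal_group L fixed_field) = (\<lambda>g. restrict (gL g) L) ` carrier G"
      using galois_iso by (auto simp: iso_def bij_betw_def)
    thus ?thesis by (auto simp: fixed_field_def)
  qed
  ultimately show ?thesis
    unfolding finite_galois_def using fixed_field_subfield L_subfield fixed_fieldD by blast
qed

text \<open>A fraction \<open>a / b\<close> has the invariant denominator \<open>\<Prod>\<^sub>g g(b)\<close>.\<close>

lemma fractions_of_invariants: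
  assumes \<Lambda>: "subring \<Lambda> ring_of_type_algebra" and L: "L = fractions_of \<Lambda>"
    and stable: "\<And>g a. g \<in> carrier G \<Longrightarrow> a \<in> \<Lambda> \<Longrightarrow> gL g a \<in> \<Lambda>"
  shows "fractions_of {a \<in> \<Lambda>. \<forall>g\<in>carrier G. gL g a = a} = fixed_field"
proof
  note \<Lambda>_closed = subring_type_algebraD[OF \<Lambda>]
  have sub: "\<Lambda> \<subseteq> L" using subset_fractions_of[OF \<Lambda>] L by simp
  show "fractions_of {a \<in> \<Lambda>. \<forall>g\<in>carrier G. gL g a = a} \<subseteq> fixed_field"
    using sub by (auto simp: fractions_of_def fixed_field_def divide_inverse gL_mult gL_inverse intro!: L_closed)
  show "fixed_field \<subseteq> fractions_of {a \<in> \<Lambda>. \<forall>g\<in>carrier G. gL g a = a}"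
  proof
    fix c assume c: "c \<in> fixed_field"
    then obtain a b where ab: "a \<in> \<Lambda>" "b \<in> \<Lambda>" "b \<noteq> 0" "c = a / b"
      using fixed_fieldD(1)[OF c] unfolding L fractions_of_def by blast
    define n where "n = (\<Prod>g\<in>carrier G. gL g b)"
    have n\<Lambda>: "n \<in> \<Lambda>" unfolding n_def using ab stable by (intro prod_closed) (auto intro: \<Lambda>_closed)
    have n_inv: "gL h n = n" if "h \<in> carrier G" for h
      unfolding n_def using that prod.reindex_bij_betw[OF bij_betw_mult_left[OF that], of "\<lambda>g. gL g b"]
      by (simp add: gL_prod gL_comp)
    have n0: "n \<noteq> 0" unfolding n_def using ab finite_G by simp
    \<comment> \<open>The factor of the identity cancels the denominator of c, and the remaining
      conjugates of b lie in \<Lambda>.\<close>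
    have "n = b * (\<Prod>g\<in>carrier G - {\<one>}. gL g b)"
      unfolding n_def using prod.remove[OF finite_G one_closed, of "\<lambda>g. gL g b"] by simp
    hence "c * n = a * (\<Prod>g\<in>carrier G - {\<one>}. gL g b)" using ab by simp
    moreover have "\<dots> \<in> \<Lambda>"
      using ab stable by (intro \<Lambda>_closed prod_closed[of \<Lambda>]) auto
    ultimately have "c * n \<in> \<Lambda>" by simp
    moreover have "gL h (c * n) = c * n" if "h \<in> carrier G" for h
      using c n_inv that fixed_fieldD by (simp add: gL_mult)
    ultimately show "c \<in> fractions_of {a \<in> \<Lambda>. \<forall>g\<in>carrier G. gL g a = a}"
      unfolding fractions_of_def using n\<Lambda> n_inv n0
      by (intro CollectI exI[of _ "c * n"] exI[of _ n]) auto
  qed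
qed

end

section \<open>Skew group rings\<close>

lemma finsum_type_sum:
  assumes "abelian_monoid R" "ring.add R = (+)" "ring.zero R = (0 :: 'a::comm_monoid_add)"
    "f \<in> A \<rightarrow> carrier R"
  shows "finsum R f A = sum f A"
proof -
  interpret abelian_monoid R by fact
  show ?thesis
    using assms(4) by (induction A rule: infinite_finite_induct) (simp_all add: assms(2,3) Pi_iff)
qed

text \<open>With lists, closure of the set product under addition is concatenation.\<close>

lemma set_prod_sum_list:
  fixes R :: "('a::comm_monoid_add, 'z) ring_scheme"
  assumes R: "abelian_monoid R" "ring.add R = (+)" "ring.zero R = 0"
    and closed: "\<And>a b. a \<in> A \<Longrightarrow> b \<in> B \<Longrightarrow> a \<otimes>\<^bsub>R\<^esub> b \<in> carrier R"
  shows "set_prod R A B = {(\<Sum>(a, b)\<leftarrow>ps. a \<otimes>\<^bsub>R\<^esub> b) | ps. set ps \<subseteq> A \<times> B}"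
proof (intro equalityI subsetI)
  fix z assume "z \<in> set_prod R A B"
  then obtain N :: nat and a b where ab: "\<forall>i<N. a i \<in> A \<and> b i \<in> B"
    "z = (\<Oplus>\<^bsub>R\<^esub>i\<in>{..<N}. a i \<otimes>\<^bsub>R\<^esub> b i)" unfolding set_prod_def by blast
  have "z = (\<Sum>i<N. a i \<otimes>\<^bsub>R\<^esub> b i)"
    unfolding ab(2) by (rule finsum_type_sum[OF R]) (use ab(1) closed in auto)
  also have "\<dots> = (\<Sum>(a, b)\<leftarrow>map (\<lambda>i. (a i, b i)) [0..<N]. a \<otimes>\<^bsub>R\<^esub> b)"
    by (simp add: o_def interv_sum_list_conv_sum_set_nat atLeast0LessThan)
  finally show "z \<in> {(\<Sum>(a, b)\<leftarrow>ps. a \<otimes>\<^bsub>R\<^esub> b) | ps. set ps \<subseteq> A \<times> B}"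
    using ab(1) by (intro CollectI exI[of _ "map (\<lambda>i. (a i, b i)) [0..<N]"]) auto
next
  fix z assume "z \<in> {(\<Sum>(a, b)\<leftarrow>ps. a \<otimes>\<^bsub>R\<^esub> b) | ps. set ps \<subseteq> A \<times> B}"
  then obtain ps where ps: "set ps \<subseteq> A \<times> B" "z = (\<Sum>(a, b)\<leftarrow>ps. a \<otimes>\<^bsub>R\<^esub> b)" by blast
  have AB: "fst (ps ! i) \<in> A \<and> snd (ps ! i) \<in> B" if "i < length ps" for i
    using ps(1) nth_mem[OF that] by (metis SigmaE fst_conv snd_conv subsetD)
  have "z = (\<Sum>i<length ps. fst (ps ! i) \<otimes>\<^bsub>R\<^esub> snd (ps ! i))"
    unfolding ps(2) by (simp add: sum_list_sum_nth atLeast0LessThan case_prod_unfold)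
  also have "\<dots> = (\<Oplus>\<^bsub>R\<^esub>i\<in>{..<length ps}. fst (ps ! i) \<otimes>\<^bsub>R\<^esub> snd (ps ! i))"
    by (rule finsum_type_sum[OF R, symmetric]) (use AB closed in auto)
  finally show "z \<in> set_prod R A B"
    unfolding set_prod_def
    by (intro CollectI exI[of _ "length ps"] exI[of _ "\<lambda>i. fst (ps ! i)"] exI[of _ "\<lambda>i. snd (ps ! i)"]
        conjI allI impI AB[THEN conjunct1] AB[THEN conjunct2])
qed

locale automorphism_action =
  fixes act :: "'m::group_add \<Rightarrow> 'l::field \<Rightarrow> 'l"
  assumes act_add: "act \<mu> (a + b) = act \<mu> a + act \<mu> b"
    and act_mult: "act \<mu> (a * b) = act \<mu> a * act \<mu> b"
    and act_zero [simp]: "act 0 a = a"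
    and act_plus: "act (\<mu> + \<nu>) a = act \<mu> (act \<nu> a)"
begin

lemma act_0 [simp]: "act \<mu> 0 = 0"
  using act_add[of \<mu> 0 0] by (metis add_cancel_right_right add_0)

lemma act_uminus [simp]: "act (- \<mu>) (act \<mu> a) = a" "act \<mu> (act (- \<mu>) a) = a"
  by (simp_all flip: act_plus)

lemma act_1 [simp]: "act \<mu> 1 = 1"
  using act_mult[of \<mu> 1 "act (- \<mu>) 1"] by simp

lemma act_eq_0_iff [simp]: "act \<mu> a = 0 \<longleftrightarrow> a = 0"
  using act_uminus(1)[of \<mu> a] act_0[of "- \<mu>"] act_0[of \<mu>] by metis

lemma act_sum: "act \<mu> (\<Sum>i\<in>I. f i) = (\<Sum>i\<in>I. act \<mu> (f i))"
  by (induction I rule: infinite_finite_induct) (auto simp: act_add)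

text \<open>In a group, \<mu> and \<kappa> determine the \<nu> with \<mu> + \<nu> = \<kappa>, so the
  double sum collapses at each exponent. The order of the summands matters, as the group need not be
  commutative here.\<close>

lemma lookup_skew_mult:
  "Poly_Mapping.lookup (skew_mult act f g) \<kappa> =
     (\<Sum>\<mu>\<in>Poly_Mapping.keys f. Poly_Mapping.lookup f \<mu> * act \<mu> (Poly_Mapping.lookup g (- \<mu> + \<kappa>)))"
proof -
  have "(\<Sum>\<nu>\<in>Poly_Mapping.keys g. Poly_Mapping.lookup (Poly_Mapping.single (\<mu> + \<nu>)
      (Poly_Mapping.lookup f \<mu> * act \<mu> (Poly_Mapping.lookup g \<nu>))) \<kappa>) =
    Poly_Mapping.lookup f \<mu> * act \<mu> (Poly_Mapping.lookup g (- \<mu> + \<kappa>))" for \<mu>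
  proof -
    have "(\<Sum>\<nu>\<in>Poly_Mapping.keys g. Poly_Mapping.lookup (Poly_Mapping.single (\<mu> + \<nu>)
      (Poly_Mapping.lookup f \<mu> * act \<mu> (Poly_Mapping.lookup g \<nu>))) \<kappa>) =
      (\<Sum>\<nu>\<in>Poly_Mapping.keys g. if \<nu> = - \<mu> + \<kappa> then
        Poly_Mapping.lookup f \<mu> * act \<mu> (Poly_Mapping.lookup g (- \<mu> + \<kappa>)) else 0)"
      by (intro sum.cong refl) (auto simp: lookup_single when_def add.assoc[symmetric])
    thus ?thesis by (simp add: in_keys_iff)
  qed
  thus ?thesis by (simp add: skew_mult_def lookup_sum)
qed

lemma lookup_skew_mult_superset:
  assumes "finite A" "Poly_Mapping.keys f \<subseteq> A"
  shows "Poly_Mapping.lookup (skew_mult act f g) \<kappa> =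
     (\<Sum>\<mu>\<in>A. Poly_Mapping.lookup f \<mu> * act \<mu> (Poly_Mapping.lookup g (- \<mu> + \<kappa>)))"
  unfolding lookup_skew_mult using assms
  by (intro sum.mono_neutral_left) (auto simp: in_keys_iff)

lemma keys_skew_mult:
  "Poly_Mapping.keys (skew_mult act f g) \<subseteq>
     (\<lambda>(\<mu>, \<nu>). \<mu> + \<nu>) ` (Poly_Mapping.keys f \<times> Poly_Mapping.keys g)"
proof
  fix \<kappa> assume "\<kappa> \<in> Poly_Mapping.keys (skew_mult act f g)"
  hence "(\<Sum>\<mu>\<in>Poly_Mapping.keys f. Poly_Mapping.lookup f \<mu> * act \<mu> (Poly_Mapping.lookup g (- \<mu> + \<kappa>))) \<noteq> 0"
    by (simp add: in_keys_iff lookup_skew_mult)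
  then obtain \<mu> where "\<mu> \<in> Poly_Mapping.keys f"
    "Poly_Mapping.lookup f \<mu> * act \<mu> (Poly_Mapping.lookup g (- \<mu> + \<kappa>)) \<noteq> 0"
    by (meson sum.neutral)
  thus "\<kappa> \<in> (\<lambda>(\<mu>, \<nu>). \<mu> + \<nu>) ` (Poly_Mapping.keys f \<times> Poly_Mapping.keys g)"
    by (intro image_eqI[of _ _ "(\<mu>, - \<mu> + \<kappa>)"]) (auto simp: in_keys_iff add.assoc[symmetric])
qed

lemma skew_mult_add_right: "skew_mult act f (g + h) = skew_mult act f g + skew_mult act f h"
  by (rule poly_mapping_eqI)
    (simp add: lookup_skew_mult lookup_add act_add distrib_left sum.distrib)

lemma skew_mult_add_left: "skew_mult act (f + g) h = skew_mult act f h + skew_mult act g h"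
proof (rule poly_mapping_eqI)
  fix \<kappa>
  let ?A = "Poly_Mapping.keys f \<union> Poly_Mapping.keys g"
  have "finite ?A" "Poly_Mapping.keys f \<subseteq> ?A" "Poly_Mapping.keys g \<subseteq> ?A" "Poly_Mapping.keys (f + g) \<subseteq> ?A"
    using Poly_Mapping.keys_add[of f g] by auto
  note * = lookup_skew_mult_superset[OF this(1,2)] lookup_skew_mult_superset[OF this(1,3)]
    lookup_skew_mult_superset[OF this(1,4)]
  show "Poly_Mapping.lookup (skew_mult act (f + g) h) \<kappa> =
      Poly_Mapping.lookup (skew_mult act f h + skew_mult act g h) \<kappa>"
    by (simp add: * lookup_add distrib_right sum.distrib)
qed

text \<open>At \<kappa>, both sides are the sum over \<mu> and \<nu> of f_\<mu>, \<mu>(g_\<nu>) and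
  (\<mu> + \<nu>) applied to the coefficient of h at -\<nu> - \<mu> + \<kappa>; the left side
  reaches this form by the substitution \<rho> = \<mu> + \<nu>.\<close>

lemma skew_mult_assoc: "skew_mult act (skew_mult act f g) h = skew_mult act f (skew_mult act g h)"
proof (rule poly_mapping_eqI)
  fix \<kappa>
  let ?l = Poly_Mapping.lookup
  define A where "A = (\<lambda>(\<mu>, \<nu>). \<mu> + \<nu>) ` (Poly_Mapping.keys f \<times> Poly_Mapping.keys g)"
  have A: "finite A" unfolding A_def by simp
  have "?l (skew_mult act (skew_mult act f g) h) \<kappa> =
      (\<Sum>\<rho>\<in>A. \<Sum>\<mu>\<in>Poly_Mapping.keys f. ?l f \<mu> * act \<mu> (?l g (- \<mu> + \<rho>)) * act \<rho> (?l h (- \<rho> + \<kappa>)))"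
    using keys_skew_mult[of f g]
    by (subst lookup_skew_mult_superset[OF A]) (auto simp: A_def lookup_skew_mult sum_distrib_right)
  also have "\<dots> = (\<Sum>\<mu>\<in>Poly_Mapping.keys f. \<Sum>\<rho>\<in>A.
      ?l f \<mu> * act \<mu> (?l g (- \<mu> + \<rho>)) * act \<rho> (?l h (- \<rho> + \<kappa>)))"
    by (rule sum.swap)
  also have "\<dots> = (\<Sum>\<mu>\<in>Poly_Mapping.keys f. ?l f \<mu> * act \<mu> (?l (skew_mult act g h) (- \<mu> + \<kappa>)))"
  proof (rule sum.cong[OF refl])
    fix \<mu> assume \<mu>: "\<mu> \<in> Poly_Mapping.keys f"
    have "(\<Sum>\<rho>\<in>A. ?l f \<mu> * act \<mu> (?l g (- \<mu> + \<rho>)) * act \<rho> (?l h (- \<rho> + \<kappa>))) =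
        (\<Sum>\<rho>\<in>(+) \<mu> ` Poly_Mapping.keys g. ?l f \<mu> * act \<mu> (?l g (- \<mu> + \<rho>)) * act \<rho> (?l h (- \<rho> + \<kappa>)))"
    proof (rule sum.mono_neutral_right[OF A])
      show "(+) \<mu> ` Poly_Mapping.keys g \<subseteq> A" using \<mu> unfolding A_def by auto
      have "\<rho> \<in> (+) \<mu> ` Poly_Mapping.keys g" if "?l g (- \<mu> + \<rho>) \<noteq> 0" for \<rho>
        using that by (intro image_eqI[of _ _ "- \<mu> + \<rho>"]) (auto simp: in_keys_iff add.assoc[symmetric])
      thus "\<forall>\<rho>\<in>A - (+) \<mu> ` Poly_Mapping.keys g.
          ?l f \<mu> * act \<mu> (?l g (- \<mu> + \<rho>)) * act \<rho> (?l h (- \<rho> + \<kappa>)) = 0" by auto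
    qed
    also have "\<dots> = (\<Sum>\<nu>\<in>Poly_Mapping.keys g. ?l f \<mu> * act \<mu> (?l g \<nu>) * act (\<mu> + \<nu>) (?l h (- \<nu> + (- \<mu> + \<kappa>))))"
      by (subst sum.reindex) (auto simp: minus_add add.assoc[symmetric])
    also have "\<dots> = ?l f \<mu> * act \<mu> (?l (skew_mult act g h) (- \<mu> + \<kappa>))"
      by (simp add: lookup_skew_mult act_sum sum_distrib_left act_mult act_plus mult.assoc)
    finally show "(\<Sum>\<rho>\<in>A. ?l f \<mu> * act \<mu> (?l g (- \<mu> + \<rho>)) * act \<rho> (?l h (- \<rho> + \<kappa>))) =
        ?l f \<mu> * act \<mu> (?l (skew_mult act g h) (- \<mu> + \<kappa>))" .
  qed
  also have "\<dots> = ?l (skew_mult act f (skew_mult act g h)) \<kappa>" by (simp add: lookup_skew_mult)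
  finally show "?l (skew_mult act (skew_mult act f g) h) \<kappa> = ?l (skew_mult act f (skew_mult act g h)) \<kappa>" .
qed

lemma lookup_coef_mult [simp]:
  "Poly_Mapping.lookup (skew_mult act (coef k) f) \<kappa> = k * Poly_Mapping.lookup f \<kappa>"
  by (simp add: lookup_skew_mult)

lemma lookup_mult_coef [simp]:
  "Poly_Mapping.lookup (skew_mult act f (coef k)) \<kappa> = Poly_Mapping.lookup f \<kappa> * act \<kappa> k"
proof -
  have eq: "- \<mu> + \<kappa> = 0 \<longleftrightarrow> \<mu> = \<kappa>" for \<mu> by (metis add.right_neutral add_minus_cancel left_minus)
  have "Poly_Mapping.lookup (skew_mult act f (coef k)) \<kappa> =
      (\<Sum>\<mu>\<in>Poly_Mapping.keys f. if \<mu> = \<kappa> then Poly_Mapping.lookup f \<kappa> * act \<kappa> k else 0)"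
    unfolding lookup_skew_mult by (intro sum.cong refl) (simp add: lookup_single when_def eq)
  thus ?thesis by (simp add: in_keys_iff)
qed

lemma skew_mult_single:
  "skew_mult act (Poly_Mapping.single \<mu> a) (Poly_Mapping.single \<nu> b) = Poly_Mapping.single (\<mu> + \<nu>) (a * act \<mu> b)"
  by (cases "a = 0"; cases "b = 0") (auto simp: skew_mult_def)

lemma skew_mult_one [simp]: "skew_mult act 1 f = f" "skew_mult act f 1 = f"
  unfolding single_one[symmetric]
  by (rule poly_mapping_eqI, simp del: single_one)+

lemma skew_mult_closed:
  assumes L: "subfield L ring_of_type_algebra" and M: "\<And>\<mu> \<nu>. \<mu> \<in> M \<Longrightarrow> \<nu> \<in> M \<Longrightarrow> \<mu> + \<nu> \<in> M"
    and act: "\<And>\<mu> a. \<mu> \<in> M \<Longrightarrow> a \<in> L \<Longrightarrow> act \<mu> a \<in> L"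
    and f: "f \<in> carrier (skew_ring act L M)" and g: "g \<in> carrier (skew_ring act L M)"
  shows "skew_mult act f g \<in> carrier (skew_ring act L M)"
proof -
  note L = subfield_type_algebraD[OF L]
  have f: "Poly_Mapping.keys f \<subseteq> M" "Poly_Mapping.lookup f \<mu> \<in> L" for \<mu>
    using f by (auto simp: skew_ring_def)
  have g: "Poly_Mapping.keys g \<subseteq> M" "Poly_Mapping.lookup g \<mu> \<in> L" for \<mu>
    using g by (auto simp: skew_ring_def)
  have "(\<lambda>(\<mu>, \<nu>). \<mu> + \<nu>) ` (Poly_Mapping.keys f \<times> Poly_Mapping.keys g) \<subseteq> M"
  proof (rule image_subsetI, elim SigmaE)
    fix x \<mu> \<nu> assume "x = (\<mu>, \<nu>)" "\<mu> \<in> Poly_Mapping.keys f" "\<nu> \<in> Poly_Mapping.keys g"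
    thus "(case x of (\<mu>, \<nu>) \<Rightarrow> \<mu> + \<nu>) \<in> M" using f(1) g(1) by (simp add: M subset_iff)
  qed
  hence "Poly_Mapping.keys (skew_mult act f g) \<subseteq> M" using keys_skew_mult[of f g] by (rule order.trans[rotated])
  moreover have "Poly_Mapping.lookup (skew_mult act f g) \<kappa> \<in> L" for \<kappa>
    unfolding lookup_skew_mult
  proof (rule sum_closed)
    fix \<mu> assume "\<mu> \<in> Poly_Mapping.keys f"
    thus "Poly_Mapping.lookup f \<mu> * act \<mu> (Poly_Mapping.lookup g (- \<mu> + \<kappa>)) \<in> L"
      by (intro L(5) act f(2) g(2) subsetD[OF f(1)])
  qed (simp_all add: L(1,4))
  ultimately show ?thesis by (auto simp: skew_ring_def)
qed

text \<open>R is any record with these operations, so that the result serves both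
  \<open>skew_ring\<close> and the module records \<open>skew_algebra\<close>.\<close>

lemma ring_skew:
  fixes R :: "('m \<Rightarrow>\<^sub>0 'l, 'z) ring_scheme"
  assumes L: "subfield L ring_of_type_algebra" and M: "0 \<in> M" "\<And>\<mu> \<nu>. \<mu> \<in> M \<Longrightarrow> \<nu> \<in> M \<Longrightarrow> \<mu> + \<nu> \<in> M"
    and act: "\<And>\<mu> a. \<mu> \<in> M \<Longrightarrow> a \<in> L \<Longrightarrow> act \<mu> a \<in> L"
    and R: "carrier R = carrier (skew_ring act L M)" "monoid.mult R = skew_mult act"
      "monoid.one R = coef 1" "ring.zero R = 0" "ring.add R = (+)"
  shows "ring R"
proof -
  note Lc = subfield_type_algebraD[OF L]
  have carr: "f \<in> carrier R \<longleftrightarrow> Poly_Mapping.keys f \<subseteq> M \<and> (\<forall>\<kappa>. Poly_Mapping.lookup f \<kappa> \<in> L)" for f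
    by (auto simp: R skew_ring_def)
  have add: "f + g \<in> carrier R" if "f \<in> carrier R" "g \<in> carrier R" for f g
    using that Poly_Mapping.keys_add[of f g] by (auto simp: carr lookup_add intro!: Lc)
  have neg: "- f \<in> carrier R" if "f \<in> carrier R" for f
    using that by (auto simp: carr in_keys_iff intro!: Lc)
  show ?thesis
  proof (rule ringI)
    show "abelian_group R"
    proof (rule abelian_groupI)
      fix f assume "f \<in> carrier R"
      thus "\<exists>g\<in>carrier R. g \<oplus>\<^bsub>R\<^esub> f = \<zero>\<^bsub>R\<^esub>" using neg by (intro bexI[of _ "- f"]) (simp_all add: R)
    next
      fix f g assume "f \<in> carrier R" "g \<in> carrier R"
      thus "f \<oplus>\<^bsub>R\<^esub> g \<in> carrier R" using add by (simp add: R(5))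
    qed (simp_all add: R(4,5) carr Lc add_ac)
    show "monoid R"
    proof (rule monoidI)
      fix f g assume "f \<in> carrier R" "g \<in> carrier R"
      thus "f \<otimes>\<^bsub>R\<^esub> g \<in> carrier R" using skew_mult_closed[OF L M(2) act] by (simp add: R)
    next
      show "\<one>\<^bsub>R\<^esub> \<in> carrier R"
        unfolding R(3) carr using M(1) by (auto simp: lookup_single when_def Lc simp del: single_one)
    qed (simp_all add: R(2,3) skew_mult_assoc)
  qed (auto simp: R skew_mult_add_left skew_mult_add_right)
qed

end

section \<open>A criterion for Galois rings\<close>

text \<open>Separation is asked on \<Gamma>, since the interpolation nodes have to lie in \<Gamma>;
  separation on K follows because K contains \<Gamma>.\<close>

locale skew_galois =
  finite_field_action G gL L + automorphism_action act
  for G :: "('g, 'z) monoid_scheme" (structure) and gL :: "'g \<Rightarrow> 'l::field \<Rightarrow> 'l" and L :: "'l set"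
    and act :: "'m::group_add \<Rightarrow> 'l \<Rightarrow> 'l" +
  fixes gM :: "'g \<Rightarrow> 'm \<Rightarrow> 'm" and M :: "'m set" and \<Gamma> :: "'l set"
  assumes act_closed: "\<mu> \<in> M \<Longrightarrow> a \<in> L \<Longrightarrow> act \<mu> a \<in> L"
    and M_zero: "0 \<in> M"
    and M_add: "\<mu> \<in> M \<Longrightarrow> \<nu> \<in> M \<Longrightarrow> \<mu> + \<nu> \<in> M"
    and M_uminus: "\<mu> \<in> M \<Longrightarrow> - \<mu> \<in> M"
    and gM_closed: "g \<in> carrier G \<Longrightarrow> \<mu> \<in> M \<Longrightarrow> gM g \<mu> \<in> M"
    and gM_add: "g \<in> carrier G \<Longrightarrow> gM g (\<mu> + \<nu>) = gM g \<mu> + gM g \<nu>"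
    and gM_one [simp]: "gM \<one> \<mu> = \<mu>"
    and gM_comp: "g \<in> carrier G \<Longrightarrow> h \<in> carrier G \<Longrightarrow> gM (g \<otimes> h) \<mu> = gM g (gM h \<mu>)"
    and act_gL: "g \<in> carrier G \<Longrightarrow> act (gM g \<mu>) (gL g a) = gL g (act \<mu> a)"
    and \<Gamma>_subring: "subring \<Gamma> ring_of_type_algebra"
    and \<Gamma>_fractions: "fractions_of \<Gamma> = fixed_field"
    and separating: "\<mu> \<in> M \<Longrightarrow> \<nu> \<in> M \<Longrightarrow> (\<And>a. a \<in> \<Gamma> \<Longrightarrow> act \<mu> a = act \<nu> a) \<Longrightarrow> \<mu> = \<nu>"
begin

section \<open>Invariants as equivariant coefficient functions\<close>

abbreviation "invs \<equiv> skew_invariants G gL gM act L M"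

lemmas \<Gamma>_closed = subring_type_algebraD[OF \<Gamma>_subring]

lemma \<Gamma>_subset: "\<Gamma> \<subseteq> fixed_field"
  using subset_fractions_of[OF \<Gamma>_subring] \<Gamma>_fractions by simp

lemma \<Gamma>D: "\<gamma> \<in> \<Gamma> \<Longrightarrow> \<gamma> \<in> L" "\<gamma> \<in> \<Gamma> \<Longrightarrow> g \<in> carrier G \<Longrightarrow> gL g \<gamma> = \<gamma>"
  using \<Gamma>_subset by (auto simp: fixed_field_def)

lemma gM_inv [simp]: "g \<in> carrier G \<Longrightarrow> gM (inv g) (gM g \<mu>) = \<mu>"
  "g \<in> carrier G \<Longrightarrow> gM g (gM (inv g) \<mu>) = \<mu>"
  by (simp_all flip: gM_comp)

lemma gM_eq_iff: "g \<in> carrier G \<Longrightarrow> gM g \<mu> = \<kappa> \<longleftrightarrow> \<mu> = gM (inv g) \<kappa>"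
  by auto

lemma gM_zero [simp]: "g \<in> carrier G \<Longrightarrow> gM g 0 = 0"
  using gM_add[of g 0 0] by (metis add.right_neutral add_left_imp_eq)

lemma gM_uminus: "g \<in> carrier G \<Longrightarrow> gM g (- \<mu>) = - gM g \<mu>"
  by (rule eq_neg_iff_add_eq_0[THEN iffD2]) (simp flip: gM_add)

text \<open>This transports an interpolation at \<mu> to one at g(\<mu>): the value of \<kappa> on a
  g-fixed element is the g-translate of the value of g^-1 \<kappa>.\<close>

lemma act_invariant:
  assumes "g \<in> carrier G" "gL g \<gamma> = \<gamma>"
  shows "act \<kappa> \<gamma> = gL g (act (gM (inv g) \<kappa>) \<gamma>)"
  using act_gL[OF assms(1), of "gM (inv g) \<kappa>" \<gamma>] assms by simp

lemma lookup_skew_action: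
  assumes "g \<in> carrier G"
  shows "Poly_Mapping.lookup (skew_action gL gM g f) \<kappa> = gL g (Poly_Mapping.lookup f (gM (inv g) \<kappa>))"
proof -
  have "Poly_Mapping.lookup (skew_action gL gM g f) \<kappa> = (\<Sum>\<mu>\<in>Poly_Mapping.keys f.
      if \<mu> = gM (inv g) \<kappa> then gL g (Poly_Mapping.lookup f (gM (inv g) \<kappa>)) else 0)"
    unfolding skew_action_def lookup_sum
    by (intro sum.cong refl) (auto simp: lookup_single when_def gM_eq_iff assms)
  thus ?thesis using assms by (simp add: in_keys_iff)
qed

text \<open>The action moves the coefficient at \<kappa> to g(\<kappa>) and applies g to it.
  Invariance thus becomes equivariance of the coefficient function, the form in which invariants are
  handled from here on.\<close>

lemma invs_iff:
  "f \<in> invs \<longleftrightarrow> Poly_Mapping.keys f \<subseteq> M \<and> (\<forall>\<kappa>. Poly_Mapping.lookup f \<kappa> \<in> L) \<and>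
     (\<forall>g\<in>carrier G. \<forall>\<kappa>. Poly_Mapping.lookup f (gM g \<kappa>) = gL g (Poly_Mapping.lookup f \<kappa>))"
proof -
  have "skew_action gL gM g f = f \<longleftrightarrow>
      (\<forall>\<kappa>. Poly_Mapping.lookup f (gM g \<kappa>) = gL g (Poly_Mapping.lookup f \<kappa>))" if g: "g \<in> carrier G" for g
  proof
    assume "skew_action gL gM g f = f"
    thus "\<forall>\<kappa>. Poly_Mapping.lookup f (gM g \<kappa>) = gL g (Poly_Mapping.lookup f \<kappa>)"
      using lookup_skew_action[OF g, of f] g by (metis gM_inv(1))
  next
    assume *: "\<forall>\<kappa>. Poly_Mapping.lookup f (gM g \<kappa>) = gL g (Poly_Mapping.lookup f \<kappa>)"
    show "skew_action gL gM g f = f"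
      by (rule poly_mapping_eqI) (simp add: lookup_skew_action g flip: *[rule_format])
  qed
  thus ?thesis by (auto simp: skew_invariants_def skew_ring_def)
qed

lemma invsD:
  assumes "f \<in> invs"
  shows "Poly_Mapping.keys f \<subseteq> M" "Poly_Mapping.lookup f \<kappa> \<in> L"
    "g \<in> carrier G \<Longrightarrow> Poly_Mapping.lookup f (gM g \<kappa>) = gL g (Poly_Mapping.lookup f \<kappa>)"
  using assms by (auto simp: invs_iff)

lemma invs_subset: "invs \<subseteq> carrier (skew_ring act L M)"
  by (auto simp: skew_invariants_def)

lemma invs_add: "f \<in> invs \<Longrightarrow> h \<in> invs \<Longrightarrow> f + h \<in> invs"
  using Poly_Mapping.keys_add[of f h] unfolding invs_iff by (auto simp: lookup_add gL_add L_closed)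

lemma invs_uminus: "f \<in> invs \<Longrightarrow> - f \<in> invs"
  unfolding invs_iff by (auto simp: gL_minus L_closed)

lemma invs_coef: "k \<in> fixed_field \<Longrightarrow> coef k \<in> invs"
  unfolding invs_iff fixed_field_def
  by (auto simp: lookup_single when_def M_zero L_closed gM_eq_iff dest: sym)

lemma invs_one: "1 \<in> invs"
  using invs_coef[of 1] subfield_type_algebraD(2)[OF fixed_field_subfield] by simp

lemma invs_zero: "0 \<in> invs"
  unfolding invs_iff by (simp add: L_closed)

text \<open>The support of an invariant f is stable under G, so the convolution sum at g(\<kappa>)
  can be reindexed by g; compatibility of the two actions then pulls g out of every term.\<close>

lemma invs_mult:
  assumes "f \<in> invs" "h \<in> invs"
  shows "skew_mult act f h \<in> invs"
proof -
  let ?l = Poly_Mapping.lookup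
  have "skew_mult act f h \<in> carrier (skew_ring act L M)"
    by (rule skew_mult_closed[OF L_subfield M_add act_closed]) (use assms invs_subset in auto)
  moreover have "?l (skew_mult act f h) (gM g \<kappa>) = gL g (?l (skew_mult act f h) \<kappa>)"
    if g: "g \<in> carrier G" for g \<kappa>
  proof -
    have inj: "inj_on (gM g) (Poly_Mapping.keys f)" by (rule inj_onI) (metis g gM_inv(1))
    have img: "gM g ` Poly_Mapping.keys f = Poly_Mapping.keys f"
    proof
      show "gM g ` Poly_Mapping.keys f \<subseteq> Poly_Mapping.keys f"
        using invsD(3)[OF assms(1) g] g by (auto simp: in_keys_iff)
      show "Poly_Mapping.keys f \<subseteq> gM g ` Poly_Mapping.keys f"
      proof
        fix \<mu> assume "\<mu> \<in> Poly_Mapping.keys f"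
        thus "\<mu> \<in> gM g ` Poly_Mapping.keys f"
          using invsD(3)[OF assms(1), of "inv g" \<mu>] g
          by (intro image_eqI[of _ _ "gM (inv g) \<mu>"]) (auto simp: in_keys_iff)
      qed
    qed
    have "?l (skew_mult act f h) (gM g \<kappa>) =
        (\<Sum>\<mu>\<in>gM g ` Poly_Mapping.keys f. ?l f \<mu> * act \<mu> (?l h (- \<mu> + gM g \<kappa>)))"
      by (simp add: lookup_skew_mult img)
    also have "\<dots> = (\<Sum>\<mu>\<in>Poly_Mapping.keys f. gL g (?l f \<mu> * act \<mu> (?l h (- \<mu> + \<kappa>))))"
      using g by (simp add: sum.reindex[OF inj] gL_mult invsD(3)[OF assms(1)] invsD(3)[OF assms(2)]
        act_gL flip: gM_uminus gM_add)
    finally show ?thesis using g by (simp add: lookup_skew_mult gL_sum)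
  qed
  ultimately show ?thesis by (auto simp: invs_iff skew_ring_def)
qed

section \<open>Traces over a single exponent\<close>

definition trace_elt :: "'l \<Rightarrow> 'm \<Rightarrow> 'm \<Rightarrow>\<^sub>0 'l" where
  "trace_elt b \<mu> = (\<Sum>g\<in>carrier G. Poly_Mapping.single (gM g \<mu>) (gL g b))"

text \<open>The g that contribute at an exponent of the orbit of \<mu> form a coset of the
  stabilizer of \<mu>; their terms add up.\<close>

lemma lookup_trace_elt:
  "Poly_Mapping.lookup (trace_elt b \<mu>) \<kappa> = (\<Sum>g\<in>carrier G. if gM (inv g) \<kappa> = \<mu> then gL g b else 0)"
  unfolding trace_elt_def lookup_sum
  by (intro sum.cong refl) (auto simp: lookup_single when_def gM_eq_iff)

text \<open>Since g(f) = f, the trace of t f is tr(t) f = f; collecting t f by its exponents gives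
  the sum.\<close>

lemma trace_elt_expansion:
  assumes f: "f \<in> invs" and t: "tr t = 1"
  shows "f = (\<Sum>\<mu>\<in>Poly_Mapping.keys f. trace_elt (t * Poly_Mapping.lookup f \<mu>) \<mu>)"
proof (rule poly_mapping_eqI)
  fix \<kappa>
  let ?l = Poly_Mapping.lookup
  have "?l (\<Sum>\<mu>\<in>Poly_Mapping.keys f. trace_elt (t * ?l f \<mu>) \<mu>) \<kappa> = (\<Sum>g\<in>carrier G.
      \<Sum>\<mu>\<in>Poly_Mapping.keys f. if \<mu> = gM (inv g) \<kappa> then gL g (t * ?l f (gM (inv g) \<kappa>)) else 0)"
    unfolding lookup_sum lookup_trace_elt
    by (subst sum.swap) (intro sum.cong refl, auto)
  also have "\<dots> = (\<Sum>g\<in>carrier G. gL g (t * ?l f (gM (inv g) \<kappa>)))"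
    by (intro sum.cong refl) (simp add: in_keys_iff)
  also have "\<dots> = (\<Sum>g\<in>carrier G. gL g t * ?l f \<kappa>)"
    by (intro sum.cong refl) (simp add: gL_mult flip: invsD(3)[OF f])
  also have "\<dots> = ?l f \<kappa>" using t by (simp add: tr_def flip: sum_distrib_right)
  finally show "?l f \<kappa> = ?l (\<Sum>\<mu>\<in>Poly_Mapping.keys f. trace_elt (t * ?l f \<mu>) \<mu>) \<kappa>" ..
qed

lemma interpolation_left:
  assumes "finite S" "S \<subseteq> M" "\<mu> \<in> M"
  obtains N :: nat and a \<gamma> where "\<forall>i<N. a i \<in> L \<and> \<gamma> i \<in> \<Gamma>"
    "\<forall>\<nu>\<in>insert \<mu> S. (\<Sum>i<N. a i * act \<nu> (\<gamma> i)) = (if \<nu> = \<mu> then 1 else 0)"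
proof -
  have "\<exists>(N::nat) a y. (\<forall>i<N. a i \<in> L \<and> y i \<in> \<Gamma>) \<and>
    (\<forall>\<nu>\<in>insert \<mu> S. (\<Sum>i<N. a i * act \<nu> (y i)) = (if \<nu> = \<mu> then 1 else 0))"
  proof (rule dedekind_interpolation[of S L \<Gamma> \<mu> act])
    fix \<nu> assume \<nu>: "\<nu> \<in> S" "\<nu> \<noteq> \<mu>"
    show "\<exists>y\<in>\<Gamma>. act \<nu> y \<noteq> act \<mu> y"
    proof (rule ccontr)
      assume "\<not> ?thesis"
      hence "\<nu> = \<mu>" using \<nu> assms by (intro separating) auto
      thus False using \<nu> by simp
    qed
  next
    fix \<nu> x assume "\<nu> \<in> insert \<mu> S" "x \<in> \<Gamma>"
    thus "act \<nu> x \<in> L" using assms \<Gamma>D(1) by (intro act_closed) auto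
  qed (simp_all add: assms(1) L_subfield \<Gamma>_closed act_mult)
  thus thesis using that by (elim exE conjE)
qed

text \<open>A scalar multiplied from the right reaches the coefficient at \<nu> only through \<nu>.
  Interpolating with -\<nu> undoes this twist.\<close>

lemma interpolation_right:
  assumes "finite S" "S \<subseteq> M" "\<mu> \<in> M"
  obtains N :: nat and a \<gamma> where "\<forall>i<N. a i \<in> L \<and> \<gamma> i \<in> \<Gamma>"
    "\<forall>\<nu>\<in>insert \<mu> S. (\<Sum>i<N. a i * act (- \<nu>) (\<gamma> i)) = (if \<nu> = \<mu> then 1 else 0)"
proof -
  obtain N :: nat and a \<gamma> where *: "\<forall>i<N. a i \<in> L \<and> \<gamma> i \<in> \<Gamma>"
    "\<forall>\<nu>\<in>insert (- \<mu>) (uminus ` S). (\<Sum>i<N. a i * act \<nu> (\<gamma> i)) = (if \<nu> = - \<mu> then 1 else 0)"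
    by (rule interpolation_left[of "uminus ` S" "- \<mu>"]) (use assms M_uminus in auto)
  thus thesis using that[of N a \<gamma>] by simp
qed

text \<open>At \<kappa>, the right side is u_\<kappa> times the sum over g of g(a (sum of d_i (g^-1
  \<kappa>)(\<gamma>_i))). The inner sum selects the g with g^-1 \<kappa> = \<mu>, and for these
  u_\<kappa> = g(u_\<mu>) turns g(a) into g(b).\<close>

lemma trace_elt_left:
  assumes u: "u \<in> invs" and c: "Poly_Mapping.lookup u \<mu> \<noteq> 0" and b: "b \<in> L"
  obtains N :: nat and k \<gamma> where "\<forall>i<N. k i \<in> fixed_field \<and> \<gamma> i \<in> \<Gamma>"
    "trace_elt b \<mu> = (\<Sum>i<N. skew_mult act (coef (k i)) (skew_mult act u (coef (\<gamma> i))))"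
proof -
  let ?l = Poly_Mapping.lookup
  define a where "a = b / ?l u \<mu>"
  have a: "a \<in> L" unfolding a_def divide_inverse using b invsD(2)[OF u] by (intro L_closed)
  have "\<mu> \<in> Poly_Mapping.keys u" using c by (simp add: in_keys_iff)
  moreover obtain N :: nat and d \<gamma> where d: "\<forall>i<N. d i \<in> L \<and> \<gamma> i \<in> \<Gamma>"
    "\<forall>\<nu>\<in>insert \<mu> (Poly_Mapping.keys u). (\<Sum>i<N. d i * act \<nu> (\<gamma> i)) = (if \<nu> = \<mu> then 1 else 0)"
    by (rule interpolation_left[of "Poly_Mapping.keys u" \<mu>]) (use invsD(1)[OF u] calculation in auto)
  ultimately have delta: "(\<Sum>i<N. d i * act \<nu> (\<gamma> i)) = (if \<nu> = \<mu> then 1 else 0)"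
    if "?l u \<nu> \<noteq> 0" for \<nu> using that by (simp add: in_keys_iff)
  have "trace_elt b \<mu> = (\<Sum>i<N. skew_mult act (coef (tr (d i * a))) (skew_mult act u (coef (\<gamma> i))))"
  proof (rule poly_mapping_eqI)
    fix \<kappa>
    have "?l (\<Sum>i<N. skew_mult act (coef (tr (d i * a))) (skew_mult act u (coef (\<gamma> i)))) \<kappa> =
        (\<Sum>i<N. \<Sum>g\<in>carrier G. ?l u \<kappa> * gL g (a * (d i * act (gM (inv g) \<kappa>) (\<gamma> i))))"
    proof (unfold lookup_sum, rule sum.cong[OF refl])
      fix i assume "i \<in> {..<N}"
      hence \<gamma>: "\<gamma> i \<in> \<Gamma>" using d by simp
      have "?l (skew_mult act (coef (tr (d i * a))) (skew_mult act u (coef (\<gamma> i)))) \<kappa> =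
          (\<Sum>g\<in>carrier G. ?l u \<kappa> * (gL g (d i * a) * act \<kappa> (\<gamma> i)))"
        by (simp add: tr_def sum_distrib_left sum_distrib_right mult_ac)
      also have "\<dots> = (\<Sum>g\<in>carrier G. ?l u \<kappa> * gL g (a * (d i * act (gM (inv g) \<kappa>) (\<gamma> i))))"
      proof (rule sum.cong[OF refl])
        fix g assume g: "g \<in> carrier G"
        show "?l u \<kappa> * (gL g (d i * a) * act \<kappa> (\<gamma> i)) = ?l u \<kappa> * gL g (a * (d i * act (gM (inv g) \<kappa>) (\<gamma> i)))"
          using act_invariant[OF g \<Gamma>D(2)[OF \<gamma> g], of \<kappa>] g by (simp add: gL_mult mult_ac)
      qed
      finally show "?l (skew_mult act (coef (tr (d i * a))) (skew_mult act u (coef (\<gamma> i)))) \<kappa> =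
          (\<Sum>g\<in>carrier G. ?l u \<kappa> * gL g (a * (d i * act (gM (inv g) \<kappa>) (\<gamma> i))))" .
    qed
    also have "\<dots> = (\<Sum>g\<in>carrier G. ?l u \<kappa> * gL g (a * (\<Sum>i<N. d i * act (gM (inv g) \<kappa>) (\<gamma> i))))"
      by (subst sum.swap) (simp add: sum_distrib_left gL_sum)
    also have "\<dots> = (\<Sum>g\<in>carrier G. if gM (inv g) \<kappa> = \<mu> then gL g b else 0)"
    proof (rule sum.cong[OF refl])
      fix g assume g: "g \<in> carrier G"
      \<comment> \<open>The interpolation says nothing about g^-1 \<kappa> outside the support of u,
        but there equivariance makes u_\<kappa> vanish.\<close>
      have u\<kappa>: "?l u \<kappa> = gL g (?l u (gM (inv g) \<kappa>))" using invsD(3)[OF u g, of "gM (inv g) \<kappa>"] g by simp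
      show "?l u \<kappa> * gL g (a * (\<Sum>i<N. d i * act (gM (inv g) \<kappa>) (\<gamma> i))) =
          (if gM (inv g) \<kappa> = \<mu> then gL g b else 0)"
        unfolding u\<kappa> using delta[of "gM (inv g) \<kappa>"] g c
        by (cases "?l u (gM (inv g) \<kappa>) = 0") (auto simp: a_def simp flip: gL_mult)
    qed
    finally show "?l (trace_elt b \<mu>) \<kappa> =
        ?l (\<Sum>i<N. skew_mult act (coef (tr (d i * a))) (skew_mult act u (coef (\<gamma> i)))) \<kappa>"
      by (simp add: lookup_trace_elt)
  qed
  moreover have "\<forall>i<N. tr (d i * a) \<in> fixed_field \<and> \<gamma> i \<in> \<Gamma>" using d(1) a by (simp add: tr_fixed L_closed)
  ultimately show thesis by (intro that[of N "\<lambda>i. tr (d i * a)" \<gamma>])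
qed

text \<open>The mirror image of \<open>trace_elt_left\<close>: the elements of K now stand on the
  right, so \<kappa> acts on their traces and the \<gamma>_i have to enter through
  -\<kappa>.\<close>

lemma trace_elt_right:
  assumes u: "u \<in> invs" and c: "Poly_Mapping.lookup u \<mu> \<noteq> 0" and b: "b \<in> L"
  obtains N :: nat and k \<gamma> where "\<forall>i<N. k i \<in> fixed_field \<and> \<gamma> i \<in> \<Gamma>"
    "trace_elt b \<mu> = (\<Sum>i<N. skew_mult act (skew_mult act (coef (\<gamma> i)) u) (coef (k i)))"
proof -
  let ?l = Poly_Mapping.lookup
  \<comment> \<open>The inverse shift compensates for the \<mu> that acts on a when it stands to the
    right of u.\<close>
  define a where "a = act (- \<mu>) (b / ?l u \<mu>)"
  have \<mu>: "\<mu> \<in> Poly_Mapping.keys u" "\<mu> \<in> M" using c invsD(1)[OF u] by (auto simp: in_keys_iff)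
  have a: "a \<in> L" unfolding a_def divide_inverse
    using b invsD(2)[OF u] \<mu> by (intro L_closed act_closed M_uminus)
  obtain N :: nat and d \<gamma> where d: "\<forall>i<N. d i \<in> L \<and> \<gamma> i \<in> \<Gamma>"
    "\<forall>\<nu>\<in>insert \<mu> (Poly_Mapping.keys u). (\<Sum>i<N. d i * act (- \<nu>) (\<gamma> i)) = (if \<nu> = \<mu> then 1 else 0)"
    by (rule interpolation_right[of "Poly_Mapping.keys u" \<mu>]) (use invsD(1)[OF u] \<mu> in auto)
  hence delta: "(\<Sum>i<N. d i * act (- \<nu>) (\<gamma> i)) = (if \<nu> = \<mu> then 1 else 0)"
    if "?l u \<nu> \<noteq> 0" for \<nu> using that by (simp add: in_keys_iff)
  have "trace_elt b \<mu> = (\<Sum>i<N. skew_mult act (skew_mult act (coef (\<gamma> i)) u) (coef (tr (d i * a))))"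
  proof (rule poly_mapping_eqI)
    fix \<kappa>
    have "?l (\<Sum>i<N. skew_mult act (skew_mult act (coef (\<gamma> i)) u) (coef (tr (d i * a)))) \<kappa> =
        (\<Sum>i<N. \<Sum>g\<in>carrier G. ?l u \<kappa> * act \<kappa> (gL g (a * (d i * act (- gM (inv g) \<kappa>) (\<gamma> i)))))"
    proof (unfold lookup_sum, rule sum.cong[OF refl])
      fix i assume "i \<in> {..<N}"
      hence \<gamma>: "\<gamma> i \<in> \<Gamma>" using d by simp
      have "?l (skew_mult act (skew_mult act (coef (\<gamma> i)) u) (coef (tr (d i * a)))) \<kappa> =
          (\<Sum>g\<in>carrier G. ?l u \<kappa> * (act \<kappa> (gL g (d i * a)) * \<gamma> i))"
        by (simp add: tr_def act_sum sum_distrib_left sum_distrib_right mult_ac)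
      also have "\<dots> = (\<Sum>g\<in>carrier G. ?l u \<kappa> * act \<kappa> (gL g (a * (d i * act (- gM (inv g) \<kappa>) (\<gamma> i)))))"
      proof (rule sum.cong[OF refl])
        fix g assume g: "g \<in> carrier G"
        \<comment> \<open>Since \<gamma>_i is fixed by g, the inner part is (-\<kappa>)(\<gamma>_i),
          on which \<kappa> cancels.\<close>
        have "act \<kappa> (gL g (act (- gM (inv g) \<kappa>) (\<gamma> i))) = \<gamma> i"
          using act_invariant[OF g \<Gamma>D(2)[OF \<gamma> g], of "- \<kappa>"] g act_uminus(2)[of \<kappa> "\<gamma> i"]
          by (simp add: gM_uminus)
        hence "act \<kappa> (gL g (a * (d i * act (- gM (inv g) \<kappa>) (\<gamma> i)))) = act \<kappa> (gL g (d i * a)) * \<gamma> i"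
          using g by (simp add: gL_mult act_mult mult_ac)
        thus "?l u \<kappa> * (act \<kappa> (gL g (d i * a)) * \<gamma> i) =
            ?l u \<kappa> * act \<kappa> (gL g (a * (d i * act (- gM (inv g) \<kappa>) (\<gamma> i))))" by simp
      qed
      finally show "?l (skew_mult act (skew_mult act (coef (\<gamma> i)) u) (coef (tr (d i * a)))) \<kappa> =
          (\<Sum>g\<in>carrier G. ?l u \<kappa> * act \<kappa> (gL g (a * (d i * act (- gM (inv g) \<kappa>) (\<gamma> i)))))" .
    qed
    also have "\<dots> = (\<Sum>g\<in>carrier G. ?l u \<kappa> * act \<kappa> (gL g (a * (\<Sum>i<N. d i * act (- gM (inv g) \<kappa>) (\<gamma> i)))))"
      by (subst sum.swap) (simp add: sum_distrib_left gL_sum act_sum)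
    also have "\<dots> = (\<Sum>g\<in>carrier G. if gM (inv g) \<kappa> = \<mu> then gL g b else 0)"
    proof (rule sum.cong[OF refl])
      fix g assume g: "g \<in> carrier G"
      have u\<kappa>: "?l u \<kappa> = gL g (?l u (gM (inv g) \<kappa>))" using invsD(3)[OF u g, of "gM (inv g) \<kappa>"] g by simp
      have act\<kappa>: "act \<kappa> (gL g x) = gL g (act (gM (inv g) \<kappa>) x)" for x
        using act_gL[OF g, of "gM (inv g) \<kappa>" x] g by simp
      show "?l u \<kappa> * act \<kappa> (gL g (a * (\<Sum>i<N. d i * act (- gM (inv g) \<kappa>) (\<gamma> i)))) =
          (if gM (inv g) \<kappa> = \<mu> then gL g b else 0)"
        unfolding u\<kappa> act\<kappa> using delta[of "gM (inv g) \<kappa>"] g c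
        by (cases "?l u (gM (inv g) \<kappa>) = 0") (auto simp: a_def simp flip: gL_mult)
    qed
    finally show "?l (trace_elt b \<mu>) \<kappa> =
        ?l (\<Sum>i<N. skew_mult act (skew_mult act (coef (\<gamma> i)) u) (coef (tr (d i * a)))) \<kappa>"
      by (simp add: lookup_trace_elt)
  qed
  moreover have "\<forall>i<N. tr (d i * a) \<in> fixed_field \<and> \<gamma> i \<in> \<Gamma>" using d(1) a by (simp add: tr_fixed L_closed)
  ultimately show thesis by (intro that[of N "\<lambda>i. tr (d i * a)" \<gamma>])
qed

text \<open>The coefficient of \<open>u \<gamma> w\<close> at \<open>\<mu> + \<rho>\<close> cannot vanish for all \<open>\<gamma> \<in> \<Gamma>\<close>, by interpolation.\<close>

lemma support_add:
  assumes u: "u \<in> invs" "Poly_Mapping.lookup u \<mu> \<noteq> 0"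
    and w: "Poly_Mapping.lookup w \<rho> \<noteq> 0"
  shows "\<exists>\<gamma>\<in>\<Gamma>. Poly_Mapping.lookup (skew_mult act u (skew_mult act (coef \<gamma>) w)) (\<mu> + \<rho>) \<noteq> 0"
proof (rule ccontr)
  let ?l = Poly_Mapping.lookup
  assume "\<not> ?thesis"
  hence zero: "(\<Sum>\<nu>\<in>Poly_Mapping.keys u. ?l u \<nu> * act \<nu> (\<gamma> * ?l w (- \<nu> + (\<mu> + \<rho>)))) = 0" if "\<gamma> \<in> \<Gamma>" for \<gamma>
    using that by (simp add: lookup_skew_mult[of u])
  have \<mu>: "\<mu> \<in> Poly_Mapping.keys u" using u by (simp add: in_keys_iff)
  obtain N :: nat and d \<gamma> where d: "\<forall>i<N. d i \<in> L \<and> \<gamma> i \<in> \<Gamma>"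
    "\<forall>\<nu>\<in>insert \<mu> (Poly_Mapping.keys u). (\<Sum>i<N. d i * act \<nu> (\<gamma> i)) = (if \<nu> = \<mu> then 1 else 0)"
    by (rule interpolation_left[of "Poly_Mapping.keys u" \<mu>]) (use invsD(1)[OF u(1)] \<mu> in auto)
  have "0 = (\<Sum>i<N. d i * (\<Sum>\<nu>\<in>Poly_Mapping.keys u. ?l u \<nu> * act \<nu> (\<gamma> i * ?l w (- \<nu> + (\<mu> + \<rho>)))))"
    using zero d(1) by simp
  also have "\<dots> = (\<Sum>\<nu>\<in>Poly_Mapping.keys u. (\<Sum>i<N. d i * act \<nu> (\<gamma> i)) * (?l u \<nu> * act \<nu> (?l w (- \<nu> + (\<mu> + \<rho>)))))"
    unfolding sum_distrib_left sum_distrib_right by (subst sum.swap) (simp add: act_mult mult_ac)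
  \<comment> \<open>The surviving term is u_\<mu> \<mu>(w_\<rho>), as -\<mu> + (\<mu> + \<rho>) =
    \<rho>; neither factor is zero.\<close>
  also have "\<dots> = (\<Sum>\<nu>\<in>Poly_Mapping.keys u. if \<nu> = \<mu> then ?l u \<mu> * act \<mu> (?l w (- \<mu> + (\<mu> + \<rho>))) else 0)"
    using d(2) by (intro sum.cong refl) simp
  also have "\<dots> \<noteq> 0" using u w \<mu> by simp
  finally show False by simp
qed

lemma galois_setting: "galois_setting \<Gamma> fixed_field L G gL M act gM"
proof -
  have "restrict (act \<mu>) L \<in> field_auts L" if "\<mu> \<in> M" for \<mu>
  proof -
    have "bij_betw (act \<mu>) L L"
      by (rule bij_betw_byWitness[where f' = "act (- \<mu>)"]) (use that in \<open>auto intro!: act_closed M_uminus\<close>)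
    thus ?thesis by (simp add: field_auts_def Bij_def L_closed act_add act_mult)
  qed
  moreover have "\<mu> = \<nu>" if "\<mu> \<in> M" "\<nu> \<in> M" "\<forall>a\<in>fixed_field. act \<mu> a = act \<nu> a" for \<mu> \<nu>
    using that \<Gamma>_subset by (intro separating) auto
  ultimately show ?thesis
    unfolding galois_setting_def
    by (simp add: \<Gamma>_subring \<Gamma>_fractions finite_galois_fixed_field is_group galois_iso
      M_zero M_add act_plus gM_closed act_gL)
qed

section \<open>The set products of U with K on either side\<close>

context
  fixes U :: "('m \<Rightarrow>\<^sub>0 'l) set" and R :: "('m \<Rightarrow>\<^sub>0 'l, 'y) ring_scheme"
  assumes U: "U \<subseteq> invs" and U_\<Gamma>: "coef ` \<Gamma> \<subseteq> U"
    and U_mult: "\<And>u v. u \<in> U \<Longrightarrow> v \<in> U \<Longrightarrow> skew_mult act u v \<in> U"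
    and U_support: "\<And>\<mu>. \<mu> \<in> M \<Longrightarrow> \<exists>u\<in>U. Poly_Mapping.lookup u \<mu> \<noteq> 0"
    and R: "carrier R = carrier (skew_ring act L M)" "monoid.mult R = skew_mult act"
      "monoid.one R = coef 1" "ring.zero R = 0" "ring.add R = (+)"
begin

text \<open>R stays a parameter so that the products are available both in \<open>skew_ring\<close>
  and in the module record \<open>LM_algebra\<close>.\<close>

lemma set_prod_invs:
  assumes "A \<subseteq> invs" "B \<subseteq> invs"
  shows "set_prod R A B = {(\<Sum>(a, b)\<leftarrow>ps. skew_mult act a b) | ps. set ps \<subseteq> A \<times> B}"
    and "set_prod R A B \<subseteq> invs"
proof -
  interpret ring R using L_subfield M_zero M_add act_closed R by (rule ring_skew)
  show *: "set_prod R A B = {(\<Sum>(a, b)\<leftarrow>ps. skew_mult act a b) | ps. set ps \<subseteq> A \<times> B}"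
    unfolding R(2)[symmetric]
  proof (rule set_prod_sum_list)
    fix a b assume "a \<in> A" "b \<in> B"
    hence "skew_mult act a b \<in> invs" using assms by (intro invs_mult) auto
    thus "a \<otimes>\<^bsub>R\<^esub> b \<in> carrier R" unfolding R(1,2) using invs_subset by (rule subsetD[rotated])
  qed (fact abelian_monoid_axioms R)+
  have "(\<Sum>(a, b)\<leftarrow>ps. skew_mult act a b) \<in> invs" if "set ps \<subseteq> A \<times> B" for ps
    using that assms by (induction ps) (auto simp: invs_zero intro!: invs_add invs_mult)
  thus "set_prod R A B \<subseteq> invs" unfolding * by blast
qed

text \<open>Set products are closed under addition, and every invariant is a sum of traces by
  \<open>trace_elt_expansion\<close>; hence it suffices to produce the traces.\<close>

lemma set_prod_all:
  assumes AB: "A \<subseteq> invs" "B \<subseteq> invs"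
    and trace: "\<And>b \<mu>. b \<in> L \<Longrightarrow> \<mu> \<in> M \<Longrightarrow> \<exists>(N::nat) x y. (\<forall>i<N. x i \<in> A \<and> y i \<in> B) \<and>
      trace_elt b \<mu> = (\<Sum>i<N. skew_mult act (x i) (y i))"
  shows "set_prod R A B = invs"
proof
  show "set_prod R A B \<subseteq> invs" by (rule set_prod_invs(2)[OF AB])
  have tr: "trace_elt b \<mu> \<in> set_prod R A B" if "b \<in> L" "\<mu> \<in> M" for b \<mu>
  proof -
    obtain N :: nat and x y where xy: "\<forall>i<N. x i \<in> A \<and> y i \<in> B"
      "trace_elt b \<mu> = (\<Sum>i<N. skew_mult act (x i) (y i))" using trace[OF \<open>b \<in> L\<close> \<open>\<mu> \<in> M\<close>] by (elim exE conjE)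
    have "trace_elt b \<mu> = (\<Sum>(a, b)\<leftarrow>map (\<lambda>i. (x i, y i)) [0..<N]. skew_mult act a b)"
      unfolding xy(2) by (simp add: o_def interv_sum_list_conv_sum_set_nat atLeast0LessThan)
    moreover have "set (map (\<lambda>i. (x i, y i)) [0..<N]) \<subseteq> A \<times> B" using xy(1) by auto
    ultimately show ?thesis unfolding set_prod_invs(1)[OF AB] by (intro CollectI exI conjI)
  qed
  have zero: "0 \<in> set_prod R A B"
    unfolding set_prod_invs(1)[OF AB] by (intro CollectI exI[of _ "[]"]) simp
  have add: "f + h \<in> set_prod R A B" if "f \<in> set_prod R A B" "h \<in> set_prod R A B" for f h
  proof -
    from that obtain ps qs where *: "set ps \<subseteq> A \<times> B" "f = (\<Sum>(a, b)\<leftarrow>ps. skew_mult act a b)"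
      "set qs \<subseteq> A \<times> B" "h = (\<Sum>(a, b)\<leftarrow>qs. skew_mult act a b)" unfolding set_prod_invs(1)[OF AB] by blast
    thus ?thesis unfolding set_prod_invs(1)[OF AB] by (intro CollectI exI[of _ "ps @ qs"]) simp
  qed
  obtain t where t: "t \<in> L" "tr t = 1" by (rule trace_one)
  show "invs \<subseteq> set_prod R A B"
  proof
    fix f assume f: "f \<in> invs"
    have "(\<Sum>\<mu>\<in>Poly_Mapping.keys f. trace_elt (t * Poly_Mapping.lookup f \<mu>) \<mu>) \<in> set_prod R A B"
      using invsD(1,2)[OF f] t(1) by (intro sum_closed zero add tr) (auto intro: L_closed)
    thus "f \<in> set_prod R A B" using trace_elt_expansion[OF f t(2)] by simp
  qed
qed

lemma set_prod_left: "set_prod R (coef ` fixed_field) U = invs"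
proof (rule set_prod_all)
  show "coef ` fixed_field \<subseteq> invs" using invs_coef by blast
  show "U \<subseteq> invs" by (rule U)
  fix b \<mu> assume b: "b \<in> L" "\<mu> \<in> M"
  then obtain u where u: "u \<in> U" "Poly_Mapping.lookup u \<mu> \<noteq> 0" using U_support by blast
  obtain N :: nat and k \<gamma> where "\<forall>i<N. k i \<in> fixed_field \<and> \<gamma> i \<in> \<Gamma>"
    "trace_elt b \<mu> = (\<Sum>i<N. skew_mult act (coef (k i)) (skew_mult act u (coef (\<gamma> i))))"
    using u U b by (blast intro: trace_elt_left)
  thus "\<exists>(N::nat) x y. (\<forall>i<N. x i \<in> coef ` fixed_field \<and> y i \<in> U) \<and>
      trace_elt b \<mu> = (\<Sum>i<N. skew_mult act (x i) (y i))"
    using u U_\<Gamma>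
    by (intro exI[of _ N] exI[of _ "\<lambda>i. coef (k i)"] exI[of _ "\<lambda>i. skew_mult act u (coef (\<gamma> i))"])
      (auto intro!: U_mult)
qed

lemma set_prod_right: "set_prod R U (coef ` fixed_field) = invs"
proof (rule set_prod_all)
  show "coef ` fixed_field \<subseteq> invs" using invs_coef by blast
  show "U \<subseteq> invs" by (rule U)
  fix b \<mu> assume b: "b \<in> L" "\<mu> \<in> M"
  then obtain u where u: "u \<in> U" "Poly_Mapping.lookup u \<mu> \<noteq> 0" using U_support by blast
  obtain N :: nat and k \<gamma> where "\<forall>i<N. k i \<in> fixed_field \<and> \<gamma> i \<in> \<Gamma>"
    "trace_elt b \<mu> = (\<Sum>i<N. skew_mult act (skew_mult act (coef (\<gamma> i)) u) (coef (k i)))"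
    using u U b by (blast intro: trace_elt_right)
  thus "\<exists>(N::nat) x y. (\<forall>i<N. x i \<in> U \<and> y i \<in> coef ` fixed_field) \<and>
      trace_elt b \<mu> = (\<Sum>i<N. skew_mult act (x i) (y i))"
    using u U_\<Gamma>
    by (intro exI[of _ N] exI[of _ "\<lambda>i. skew_mult act (coef (\<gamma> i)) u"] exI[of _ "\<lambda>i. coef (k i)"])
      (auto intro!: U_mult)
qed

end

theorem galois_ring_criterion:
  assumes "U \<subseteq> invs" "coef ` \<Gamma> \<subseteq> U" "subring U (skew_ring act L M)"
    and support: "\<And>\<mu>. \<mu> \<in> M \<Longrightarrow> \<exists>u\<in>U. Poly_Mapping.lookup u \<mu> \<noteq> 0"
  shows "galois_ring \<Gamma> fixed_field L G gL M act gM U"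
proof -
  have mult: "skew_mult act u v \<in> U" if "u \<in> U" "v \<in> U" for u v
    using subringE(6)[OF assms(3) that] by (simp add: skew_ring_def)
  note * = assms(1,2) mult support
  have R: "carrier (skew_ring act L M) = carrier (skew_ring act L M)" "monoid.mult (skew_ring act L M) = skew_mult act"
    "monoid.one (skew_ring act L M) = coef 1" "ring.zero (skew_ring act L M) = 0" "ring.add (skew_ring act L M) = (+)"
    by (simp_all add: skew_ring_def)
  show ?thesis
    unfolding galois_ring_def
    using assms galois_setting set_prod_left[OF * R] set_prod_right[OF * R] by simp
qed

end

section \<open>Monomial substitutions\<close>

lemma poly_mapping_sum_singles:
  "(\<Sum>a\<in>Poly_Mapping.keys f. Poly_Mapping.single a (Poly_Mapping.lookup f a)) = f"
  by (rule poly_mapping_eqI) (simp add: lookup_sum lookup_single when_def in_keys_iff)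

text \<open>A finitely supported function is a sum of singles. Identities between substitutions are
  thereby reduced to monomials.\<close>

lemma poly_mapping_additive_eqI:
  fixes f :: "'a \<Rightarrow>\<^sub>0 'b::comm_monoid_add" and F H :: "('a \<Rightarrow>\<^sub>0 'b) \<Rightarrow> 'c::comm_monoid_add"
  assumes "F 0 = 0" "H 0 = 0" "\<And>f g. F (f + g) = F f + F g" "\<And>f g. H (f + g) = H f + H g"
    "\<And>a b. F (Poly_Mapping.single a b) = H (Poly_Mapping.single a b)"
  shows "F f = H f"
proof -
  have F: "F (sum p A) = (\<Sum>x\<in>A. F (p x))" for p :: "'a \<Rightarrow> 'a \<Rightarrow>\<^sub>0 'b" and A
    by (induction A rule: infinite_finite_induct) (simp_all add: assms)
  have H: "H (sum p A) = (\<Sum>x\<in>A. H (p x))" for p :: "'a \<Rightarrow> 'a \<Rightarrow>\<^sub>0 'b" and A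
    by (induction A rule: infinite_finite_induct) (simp_all add: assms)
  have "F (\<Sum>a\<in>Poly_Mapping.keys f. Poly_Mapping.single a (Poly_Mapping.lookup f a)) =
      H (\<Sum>a\<in>Poly_Mapping.keys f. Poly_Mapping.single a (Poly_Mapping.lookup f a))"
    unfolding F H by (simp add: assms(5))
  thus ?thesis by (simp add: poly_mapping_sum_singles)
qed

lemma expo_map_superset:
  assumes "finite A" "Poly_Mapping.keys a \<subseteq> A"
  shows "expo_map \<pi> a = (\<Sum>v\<in>A. Poly_Mapping.single (\<pi> v) (Poly_Mapping.lookup a v))"
  unfolding expo_map_def using assms
  by (intro sum.mono_neutral_left) (auto simp: in_keys_iff)

lemma expo_map_add: "expo_map \<pi> (a + b) = expo_map \<pi> a + expo_map \<pi> b"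
proof -
  let ?A = "Poly_Mapping.keys a \<union> Poly_Mapping.keys b"
  have A: "finite ?A" "Poly_Mapping.keys a \<subseteq> ?A" "Poly_Mapping.keys b \<subseteq> ?A" "Poly_Mapping.keys (a + b) \<subseteq> ?A"
    using Poly_Mapping.keys_add[of a b] by simp_all
  show ?thesis
    unfolding expo_map_superset[OF A(1,2)] expo_map_superset[OF A(1,3)] expo_map_superset[OF A(1,4)]
    by (simp add: lookup_add single_add sum.distrib)
qed

lemma expo_map_0 [simp]: "expo_map \<pi> 0 = 0"
  by (simp add: expo_map_def)

lemma expo_map_single [simp]: "expo_map \<pi> (Poly_Mapping.single v k) = Poly_Mapping.single (\<pi> v) k"
  by (cases "k = 0") (simp_all add: expo_map_def)

lemma expo_map_comp: "expo_map \<pi> (expo_map \<pi>' a) = expo_map (\<pi> \<circ> \<pi>') a"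
  by (rule poly_mapping_additive_eqI[where F = "\<lambda>a. expo_map \<pi> (expo_map \<pi>' a)"])
    (simp_all add: expo_map_add)

lemma expo_map_id [simp]: "expo_map id a = a"
  by (simp add: expo_map_def poly_mapping_sum_singles)

lemma keys_expo_map: "Poly_Mapping.keys (expo_map \<pi> a) \<subseteq> \<pi> ` Poly_Mapping.keys a"
proof
  fix v assume "v \<in> Poly_Mapping.keys (expo_map \<pi> a)"
  hence "(\<Sum>u\<in>Poly_Mapping.keys a. Poly_Mapping.lookup (Poly_Mapping.single (\<pi> u) (Poly_Mapping.lookup a u)) v) \<noteq> 0"
    by (simp add: in_keys_iff expo_map_def lookup_sum)
  then obtain u where "u \<in> Poly_Mapping.keys a"
    "Poly_Mapping.lookup (Poly_Mapping.single (\<pi> u) (Poly_Mapping.lookup a u)) v \<noteq> 0" by (meson sum.neutral)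
  thus "v \<in> \<pi> ` Poly_Mapping.keys a" by (auto simp: lookup_single when_def split: if_splits)
qed

lemma lookup_expo_map:
  assumes "inj \<pi>" shows "Poly_Mapping.lookup (expo_map \<pi> a) (\<pi> v) = Poly_Mapping.lookup a v"
  using assms by (simp add: expo_map_def lookup_sum lookup_single when_def inj_eq in_keys_iff)

text \<open>The value of the Laurent monomial with exponent a at the point c: the scalar that
  \<open>laurent_subst\<close> attaches to this monomial, and a character of the exponent group if
  no c_v is zero.\<close>

definition monomial_char :: "(nat \<times> nat \<Rightarrow> 'f::field) \<Rightarrow> expo \<Rightarrow> 'f" where
  "monomial_char c a = (\<Prod>v\<in>Poly_Mapping.keys a. c v powi Poly_Mapping.lookup a v)"

lemma monomial_char_superset:
  assumes "finite A" "Poly_Mapping.keys a \<subseteq> A"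
  shows "monomial_char c a = (\<Prod>v\<in>A. c v powi Poly_Mapping.lookup a v)"
  unfolding monomial_char_def using assms
  by (intro prod.mono_neutral_left) (auto simp: in_keys_iff)

lemma monomial_char_add:
  assumes "\<And>v. c v \<noteq> 0"
  shows "monomial_char c (a + b) = monomial_char c a * monomial_char c b"
proof -
  let ?A = "Poly_Mapping.keys a \<union> Poly_Mapping.keys b"
  have A: "finite ?A" "Poly_Mapping.keys a \<subseteq> ?A" "Poly_Mapping.keys b \<subseteq> ?A" "Poly_Mapping.keys (a + b) \<subseteq> ?A"
    using Poly_Mapping.keys_add[of a b] by simp_all
  show ?thesis
    unfolding monomial_char_superset[OF A(1,2)] monomial_char_superset[OF A(1,3)]
      monomial_char_superset[OF A(1,4)]
    using assms by (simp add: lookup_add power_int_add prod.distrib)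
qed

lemma monomial_char_0 [simp]: "monomial_char c 0 = 1"
  by (simp add: monomial_char_def)

lemma monomial_char_single [simp]: "monomial_char c (Poly_Mapping.single v k) = c v powi k"
  by (cases "k = 0") (simp_all add: monomial_char_def)

lemma monomial_char_sum:
  assumes "\<And>v. c v \<noteq> 0"
  shows "monomial_char c (\<Sum>i\<in>I. f i) = (\<Prod>i\<in>I. monomial_char c (f i))"
  by (induction I rule: infinite_finite_induct) (simp_all add: monomial_char_add assms)

lemma monomial_char_expo_map:
  assumes "\<And>v. c v \<noteq> 0"
  shows "monomial_char c (expo_map \<pi> a) = monomial_char (\<lambda>v. c (\<pi> v)) a"
  by (simp add: expo_map_def monomial_char_sum assms) (simp add: monomial_char_def)

lemma monomial_char_mult:
  "monomial_char c a * monomial_char d a = monomial_char (\<lambda>v. c v * d v) a"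
  by (simp add: monomial_char_def power_int_mult_distrib prod.distrib)

lemma laurent_subst_superset:
  assumes "finite A" "Poly_Mapping.keys f \<subseteq> A"
  shows "laurent_subst \<pi> c f =
    (\<Sum>a\<in>A. Poly_Mapping.single (expo_map \<pi> a) (Poly_Mapping.lookup f a * monomial_char c a))"
  unfolding laurent_subst_def monomial_char_def using assms
  by (intro sum.mono_neutral_left) (auto simp: in_keys_iff)

lemma laurent_subst_add: "laurent_subst \<pi> c (f + g) = laurent_subst \<pi> c f + laurent_subst \<pi> c g"
proof -
  let ?A = "Poly_Mapping.keys f \<union> Poly_Mapping.keys g"
  have A: "finite ?A" "Poly_Mapping.keys f \<subseteq> ?A" "Poly_Mapping.keys g \<subseteq> ?A" "Poly_Mapping.keys (f + g) \<subseteq> ?A"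
    using Poly_Mapping.keys_add[of f g] by simp_all
  show ?thesis
    unfolding laurent_subst_superset[OF A(1,2)] laurent_subst_superset[OF A(1,3)]
      laurent_subst_superset[OF A(1,4)]
    by (simp add: lookup_add distrib_right single_add sum.distrib)
qed

lemma laurent_subst_0 [simp]: "laurent_subst \<pi> c 0 = 0"
  by (simp add: laurent_subst_def)

lemma laurent_subst_single [simp]:
  "laurent_subst \<pi> c (Poly_Mapping.single a x) = Poly_Mapping.single (expo_map \<pi> a) (x * monomial_char c a)"
  by (cases "x = 0") (simp_all add: laurent_subst_def monomial_char_def)

lemma laurent_subst_sum: "laurent_subst \<pi> c (\<Sum>i\<in>I. f i) = (\<Sum>i\<in>I. laurent_subst \<pi> c (f i))"
  by (induction I rule: infinite_finite_induct) (simp_all add: laurent_subst_add)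

text \<open>Both sides are additive in f and in g, which leaves a product of two monomials. Nonzero
  c_v make the scalar multiplicative also for exponents of mixed sign.\<close>

lemma laurent_subst_mult:
  assumes "\<And>v. c v \<noteq> 0"
  shows "laurent_subst \<pi> c (f * g) = laurent_subst \<pi> c f * laurent_subst \<pi> c g"
proof (rule poly_mapping_additive_eqI[where F = "\<lambda>f. laurent_subst \<pi> c (f * g)" and f = f])
  fix a x
  show "laurent_subst \<pi> c (Poly_Mapping.single a x * g) =
      laurent_subst \<pi> c (Poly_Mapping.single a x) * laurent_subst \<pi> c g"
  proof (rule poly_mapping_additive_eqI[where F = "\<lambda>g. laurent_subst \<pi> c (Poly_Mapping.single a x * g)" and f = g])
    fix b y
    show "laurent_subst \<pi> c (Poly_Mapping.single a x * Poly_Mapping.single b y) =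
      laurent_subst \<pi> c (Poly_Mapping.single a x) * laurent_subst \<pi> c (Poly_Mapping.single b y)"
      by (simp add: mult_single expo_map_add monomial_char_add assms mult_ac)
  qed (simp_all add: laurent_subst_add distrib_left)
qed (simp_all add: laurent_subst_add distrib_right)

lemma laurent_subst_comp:
  assumes "\<And>v. c v \<noteq> 0"
  shows "laurent_subst \<pi> c (laurent_subst \<pi>' c' f) = laurent_subst (\<pi> \<circ> \<pi>') (\<lambda>v. c' v * c (\<pi>' v)) f"
  by (rule poly_mapping_additive_eqI[where F = "\<lambda>f. laurent_subst \<pi> c (laurent_subst \<pi>' c' f)"])
    (simp_all add: laurent_subst_add expo_map_comp comp_def monomial_char_expo_map assms
      monomial_char_mult[symmetric] mult.assoc)

lemma laurent_subst_id [simp]: "laurent_subst id (\<lambda>v. 1) f = f"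
  by (simp add: laurent_subst_def poly_mapping_sum_singles)

lemma keys_laurent_subst: "Poly_Mapping.keys (laurent_subst \<pi> c f) \<subseteq> expo_map \<pi> ` Poly_Mapping.keys f"
proof
  fix b assume "b \<in> Poly_Mapping.keys (laurent_subst \<pi> c f)"
  hence "(\<Sum>a\<in>Poly_Mapping.keys f. Poly_Mapping.lookup (Poly_Mapping.single (expo_map \<pi> a)
      (Poly_Mapping.lookup f a * monomial_char c a)) b) \<noteq> 0"
    by (simp add: in_keys_iff laurent_subst_def monomial_char_def lookup_sum)
  then obtain a where "a \<in> Poly_Mapping.keys f" "Poly_Mapping.lookup (Poly_Mapping.single (expo_map \<pi> a)
      (Poly_Mapping.lookup f a * monomial_char c a)) b \<noteq> 0" by (meson sum.neutral)
  thus "b \<in> expo_map \<pi> ` Poly_Mapping.keys f" by (auto simp: lookup_single when_def split: if_splits)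
qed

lemma laurent_subst_eq_0_iff:
  assumes "bij \<pi>" "\<And>v. c v \<noteq> 0"
  shows "laurent_subst \<pi> c f = 0 \<longleftrightarrow> f = 0"
proof
  assume "laurent_subst \<pi> c f = 0"
  \<comment> \<open>This is the inverse substitution: x_v comes from the variable with index
    \<pi>^-1(v), whose scalar has to be divided out.\<close>
  hence "laurent_subst (inv' \<pi>) (\<lambda>v. inverse (c (inv' \<pi> v))) (laurent_subst \<pi> c f) = 0" by simp
  moreover have "laurent_subst (inv' \<pi>) (\<lambda>v. inverse (c (inv' \<pi> v))) (laurent_subst \<pi> c f) = f"
    using assms by (subst laurent_subst_comp) (simp_all add: bij_is_inj inv_o_cancel)
  ultimately show "f = 0" by simp
qed simp

text \<open>The common form of \<open>G_act\<close> and \<open>shift_act\<close>. Their composition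
  laws and their compatibility all become instances of \<open>frac_subst_comp\<close>.\<close>

definition frac_subst ::
    "(nat \<times> nat \<Rightarrow> nat \<times> nat) \<Rightarrow> (nat \<times> nat \<Rightarrow> 'f::field) \<Rightarrow> 'f ratfun \<Rightarrow> 'f ratfun" where
  "frac_subst \<pi> c = map_fract (laurent_subst \<pi> c)"

lemma frac_subst_Fract:
  assumes "bij \<pi>" "\<And>v. c v \<noteq> 0" "b \<noteq> 0"
  shows "frac_subst \<pi> c (Fract a b) = Fract (laurent_subst \<pi> c a) (laurent_subst \<pi> c b)"
  unfolding frac_subst_def
  by (rule map_fract_Fract) (simp_all add: assms laurent_subst_mult laurent_subst_eq_0_iff)

lemma frac_subst_to_fract:
  assumes "bij \<pi>" "\<And>v. c v \<noteq> 0"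
  shows "frac_subst \<pi> c (to_fract f) = to_fract (laurent_subst \<pi> c f)"
proof -
  have "laurent_subst \<pi> c 1 = 1"
    using laurent_subst_single[of \<pi> c 0 1] by simp
  thus ?thesis by (simp add: to_fract_def frac_subst_Fract assms)
qed

lemma frac_subst_add:
  assumes "bij \<pi>" "\<And>v. c v \<noteq> 0"
  shows "frac_subst \<pi> c (x + y) = frac_subst \<pi> c x + frac_subst \<pi> c y"
  by (cases x; cases y)
    (simp add: assms frac_subst_Fract laurent_subst_add laurent_subst_mult laurent_subst_eq_0_iff)

lemma frac_subst_mult:
  assumes "bij \<pi>" "\<And>v. c v \<noteq> 0"
  shows "frac_subst \<pi> c (x * y) = frac_subst \<pi> c x * frac_subst \<pi> c y"
  by (cases x; cases y) (simp add: assms frac_subst_Fract laurent_subst_mult)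

lemma frac_subst_comp:
  assumes "bij \<pi>" "\<And>v. c v \<noteq> 0" "bij \<pi>'" "\<And>v. c' v \<noteq> 0"
  shows "frac_subst \<pi> c (frac_subst \<pi>' c' x) = frac_subst (\<pi> \<circ> \<pi>') (\<lambda>v. c' v * c (\<pi>' v)) x"
  by (cases x) (simp add: assms frac_subst_Fract laurent_subst_eq_0_iff laurent_subst_comp bij_comp)

lemma frac_subst_id [simp]: "frac_subst id (\<lambda>v. 1) x = x"
  by (cases x) (simp add: frac_subst_Fract)

lemma frac_subst_const:
  assumes "bij \<pi>" "\<And>v. c v \<noteq> 0"
  shows "frac_subst \<pi> c (const a) = const a"
  by (simp add: const_def frac_subst_to_fract assms)

lemma const_mult: "const (a * b) = const a * const b"
  by (simp add: const_def mult_single flip: to_fract_mult)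

lemma const_add: "const (a + b) = const a + const b"
  by (simp add: const_def single_add)

lemma const_eq_iff [simp]: "const a = const b \<longleftrightarrow> a = b"
  by (simp add: const_def inj_eq)

lemma const_0 [simp]: "const 0 = 0" and const_1 [simp]: "const 1 = 1"
  by (simp_all add: const_def)

lemma const_eq_0_iff [simp]: "const a = 0 \<longleftrightarrow> a = 0"
  using const_eq_iff[of a 0] by simp

lemma const_power: "const (a ^ k) = const a ^ k"
  by (induction k) (simp_all add: const_mult)

lemma const_prod: "const (\<Prod>i\<in>I. f i) = (\<Prod>i\<in>I. const (f i))"
  by (induction I rule: infinite_finite_induct) (simp_all add: const_mult)

lemma x_var_nonzero [simp]: "x_var k i \<noteq> 0"
  by (simp add: x_var_def) (metis lookup_single_eq lookup_zero zero_neq_one)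

lemma x_var_power: "x_var k i ^ j = to_fract (Poly_Mapping.single (Poly_Mapping.single (k, i) (int j)) 1)"
  by (induction j)
    (simp_all add: x_var_def mult_single single_add[symmetric] add.commute flip: to_fract_mult)

lemma x_var_power_eq_iff: "j > 0 \<Longrightarrow> x_var k i ^ j = (x_var l i' ^ j :: 'f::field ratfun) \<longleftrightarrow> (k, i) = (l, i')"
  unfolding x_var_power to_fract_eq_iff
  by (metis (no_types, opaque_lifting) keys_single of_nat_0_less_iff order_less_irrefl singleton_inject zero_neq_one)

lemma frac_subst_x_var:
  assumes "bij \<pi>" "\<And>v. c v \<noteq> 0" "\<pi> (k, i) = (l, j)"
  shows "frac_subst \<pi> c (x_var k i) = const (c (k, i)) * x_var l j"
  by (simp add: x_var_def const_def frac_subst_to_fract assms mult_single flip: to_fract_mult)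

lemma lattice_on_closed: "0 \<in> lattice_on I" "a \<in> lattice_on I \<Longrightarrow> b \<in> lattice_on I \<Longrightarrow> a + b \<in> lattice_on I"
  "a \<in> lattice_on I \<Longrightarrow> - a \<in> lattice_on I"
  using Poly_Mapping.keys_add[of a b] by (auto simp: lattice_on_def)

section \<open>The Laurent polynomial ring and its field of fractions inside the ambient
  field\<close>

lemma Lambda_subring: "subring (Lambda n r :: 'f::field ratfun set) ring_of_type_algebra"
proof (rule subring_type_algebraI)
  let ?S = "{f :: 'f laurent. Poly_Mapping.keys f \<subseteq> lattice_on (vars n r)}"
  have I: "f \<in> ?S \<Longrightarrow> z = to_fract f \<Longrightarrow> z \<in> Lambda n r" for f :: "'f laurent" and z unfolding Lambda_def by blast
  show "(1 :: 'f ratfun) \<in> Lambda n r" by (rule I[of 1]) (simp_all add: lattice_on_closed)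
  fix x assume "(x :: 'f ratfun) \<in> Lambda n r"
  then obtain f where f: "f \<in> ?S" "x = to_fract f" unfolding Lambda_def by blast
  show "- x \<in> Lambda n r" by (rule I[of "- f"]) (use f in simp_all)
  fix y assume "(y :: 'f ratfun) \<in> Lambda n r"
  then obtain g where g: "g \<in> ?S" "y = to_fract g" unfolding Lambda_def by blast
  show "x + y \<in> Lambda n r"
    by (rule I[of "f + g"]) (use f g Poly_Mapping.keys_add[of f g] in auto)
  have "Poly_Mapping.keys (f * g) \<subseteq> lattice_on (vars n r)"
    using keys_mult[of f g] f(1) g(1) by (auto dest!: subsetD intro!: lattice_on_closed)
  thus "x * y \<in> Lambda n r" by (intro I[of "f * g"]) (use f g in simp_all)
qed

lemma frac_subst_Lambda:
  assumes "bij \<pi>" "\<And>v. c v \<noteq> 0" "\<pi> ` vars n r \<subseteq> vars n r" "x \<in> Lambda n r"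
  shows "frac_subst \<pi> c x \<in> Lambda n r"
proof -
  obtain f where f: "Poly_Mapping.keys f \<subseteq> lattice_on (vars n r)" "x = to_fract f"
    using assms(4) unfolding Lambda_def by blast
  have "expo_map \<pi> a \<in> lattice_on (vars n r)" if "a \<in> lattice_on (vars n r)" for a
    using that keys_expo_map[of \<pi> a] assms(3) unfolding lattice_on_def by blast
  hence "Poly_Mapping.keys (laurent_subst \<pi> c f) \<subseteq> lattice_on (vars n r)"
    using keys_laurent_subst[of \<pi> c f] f(1) by blast
  thus ?thesis unfolding f(2) frac_subst_to_fract[OF assms(1,2)] Lambda_def by blast
qed

lemma frac_subst_L_field:
  assumes "bij \<pi>" "\<And>v. c v \<noteq> 0" "\<pi> ` vars n r \<subseteq> vars n r" "x \<in> L_field n r"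
  shows "frac_subst \<pi> c x \<in> L_field n r"
proof -
  obtain a b where ab: "a \<in> Lambda n r" "b \<in> Lambda n r" "b \<noteq> 0" "x = a / b"
    using assms(4) unfolding L_field_def fractions_of_def by blast
  have mult: "frac_subst \<pi> c (y * z) = frac_subst \<pi> c y * frac_subst \<pi> c z" for y z
    by (rule frac_subst_mult[OF assms(1,2)])
  have "frac_subst \<pi> c b \<noteq> 0"
  proof -
    obtain f where "b = to_fract f" using ab(2) unfolding Lambda_def by blast
    thus ?thesis using ab(3) assms by (simp add: frac_subst_to_fract laurent_subst_eq_0_iff)
  qed
  moreover have "x * b = a" using ab(3,4) by simp
  hence "frac_subst \<pi> c a = frac_subst \<pi> c x * frac_subst \<pi> c b" using mult[of x b] by simp
  ultimately have "frac_subst \<pi> c x = frac_subst \<pi> c a / frac_subst \<pi> c b \<and> frac_subst \<pi> c b \<noteq> 0"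
    by (simp add: eq_divide_eq)
  moreover have "frac_subst \<pi> c a \<in> Lambda n r" "frac_subst \<pi> c b \<in> Lambda n r"
    using ab(1,2) by (simp_all add: frac_subst_Lambda assms(1-3))
  ultimately show ?thesis
    unfolding L_field_def fractions_of_def by (intro CollectI exI[of _ "frac_subst \<pi> c a"] exI[of _ "frac_subst \<pi> c b"]) simp
qed

lemma L_field_subfield: "subfield (L_field n r) ring_of_type_algebra"
  unfolding L_field_def by (rule fractions_of_subfield[OF Lambda_subring])

lemma Lambda_subset_L_field: "Lambda n r \<subseteq> L_field n r"
  unfolding L_field_def by (rule subset_fractions_of[OF Lambda_subring])

lemma const_in_Lambda: "const a \<in> Lambda n r"
  by (auto simp: const_def Lambda_def lattice_on_closed intro!: imageI)

lemma x_var_in_Lambda: "(k, i) \<in> vars n r \<Longrightarrow> x_var k i \<in> Lambda n r"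
  by (auto simp: x_var_def Lambda_def lattice_on_def intro!: imageI)

section \<open>The Galois setting of the quantum OGZ algebra\<close>

lemma A_set_iff:
  "\<alpha> \<in> A_set m p r \<longleftrightarrow> \<alpha> \<in> extensional {1..r} \<and> (\<forall>i\<in>{1..r}. \<alpha> i ^ m = 1) \<and> (\<Prod>i\<in>{1..r}. \<alpha> i) ^ (m div p) = 1"
  by (auto simp: A_set_def roots_of_unity_def PiE_iff)

text \<open>Permuting the entries does not change their product, so the condition on the product is
  inherited by a twisted product.\<close>

lemma A_set_mult:
  assumes "\<alpha> \<in> A_set m p r" "\<beta> \<in> A_set m p r" "\<tau> permutes {1..r}"
  shows "(\<lambda>i\<in>{1..r}. \<alpha> (\<tau> i) * \<beta> i) \<in> A_set m p r"
proof -
  have "(\<Prod>i\<in>{1..r}. \<alpha> (\<tau> i)) = (\<Prod>i\<in>{1..r}. \<alpha> i)"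
    using prod.permute[OF assms(3), of \<alpha>] by (simp add: comp_def)
  thus ?thesis
    using assms permutes_in_image[OF assms(3)] by (simp add: A_set_iff prod.distrib power_mult_distrib)
qed

lemma A_set_inverse:
  assumes "\<alpha> \<in> A_set m p r" "\<tau> permutes {1..r}"
  shows "(\<lambda>i\<in>{1..r}. inverse (\<alpha> (\<tau> i))) \<in> A_set m p r"
proof -
  have "(\<Prod>i\<in>{1..r}. inverse (\<alpha> (\<tau> i))) = inverse (\<Prod>i\<in>{1..r}. \<alpha> i)"
    using prod.permute[OF assms(2), of "\<lambda>i. inverse (\<alpha> i)"] by (simp add: comp_def prod_inversef[symmetric])
  thus ?thesis
    using assms permutes_in_image[OF assms(2)] by (simp add: A_set_iff power_inverse)
qed

lemma A_set_nonzero: "\<alpha> \<in> A_set m p r \<Longrightarrow> m \<ge> 1 \<Longrightarrow> i \<in> {1..r} \<Longrightarrow> \<alpha> i \<noteq> 0"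
  by (metis A_set_iff not_one_le_zero power_0_left zero_neq_one)

lemma group_G_single:
  assumes "m \<ge> 1" shows "group (G_single m p r :: ((nat \<Rightarrow> nat) \<times> (nat \<Rightarrow> 'f::field)) monoid)"
proof (rule groupI)
  fix x y :: "(nat \<Rightarrow> nat) \<times> (nat \<Rightarrow> 'f)"
  assume "x \<in> carrier (G_single m p r)" "y \<in> carrier (G_single m p r)"
  thus "x \<otimes>\<^bsub>G_single m p r\<^esub> y \<in> carrier (G_single m p r)"
    by (auto simp: G_single_def sym_group_def permutes_compose A_set_mult simp del: One_nat_def)
next
  show "\<one>\<^bsub>G_single m p r\<^esub> \<in> carrier (G_single m p r :: ((nat \<Rightarrow> nat) \<times> (nat \<Rightarrow> 'f)) monoid)"
    by (auto simp: G_single_def sym_group_def permutes_id A_set_iff)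
next
  fix x y z :: "(nat \<Rightarrow> nat) \<times> (nat \<Rightarrow> 'f)"
  assume "x \<in> carrier (G_single m p r)" "y \<in> carrier (G_single m p r)" "z \<in> carrier (G_single m p r)"
  thus "x \<otimes>\<^bsub>G_single m p r\<^esub> y \<otimes>\<^bsub>G_single m p r\<^esub> z = x \<otimes>\<^bsub>G_single m p r\<^esub> (y \<otimes>\<^bsub>G_single m p r\<^esub> z)"
    by (auto simp: G_single_def sym_group_def permutes_in_image mult.assoc comp_assoc
        intro!: restrict_ext simp del: One_nat_def atLeastAtMost_iff)
next
  fix x :: "(nat \<Rightarrow> nat) \<times> (nat \<Rightarrow> 'f)" assume "x \<in> carrier (G_single m p r)"
  thus "\<one>\<^bsub>G_single m p r\<^esub> \<otimes>\<^bsub>G_single m p r\<^esub> x = x"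
    by (auto simp: G_single_def sym_group_def permutes_in_image A_set_iff extensional_def fun_eq_iff
        simp del: One_nat_def atLeastAtMost_iff)
next
  fix x :: "(nat \<Rightarrow> nat) \<times> (nat \<Rightarrow> 'f)" assume x: "x \<in> carrier (G_single m p r)"
  obtain \<sigma> \<alpha> where [simp]: "x = (\<sigma>, \<alpha>)" by (cases x)
  have \<sigma>: "\<sigma> permutes {1..r}" and \<alpha>: "\<alpha> \<in> A_set m p r" using x by (auto simp: G_single_def sym_group_def)
  \<comment> \<open>The second component \<beta> is forced by \<beta>(\<sigma>(i)) \<alpha>(i) =
    1.\<close>
  let ?y = "(inv' \<sigma>, \<lambda>i\<in>{1..r}. inverse (\<alpha> (inv' \<sigma> i)))"
  have "?y \<in> carrier (G_single m p r)"
    using A_set_inverse[OF \<alpha> permutes_inv[OF \<sigma>]] permutes_inv[OF \<sigma>] by (simp add: G_single_def sym_group_def)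
  moreover have "?y \<otimes>\<^bsub>G_single m p r\<^esub> x = \<one>\<^bsub>G_single m p r\<^esub>"
    using A_set_nonzero[OF \<alpha> assms] \<sigma>
    by (auto simp: G_single_def permutes_inv_o permutes_in_image permutes_inverses intro!: restrict_ext
        simp del: One_nat_def atLeastAtMost_iff)
  ultimately show "\<exists>y\<in>carrier (G_single m p r). y \<otimes>\<^bsub>G_single m p r\<^esub> x = \<one>\<^bsub>G_single m p r\<^esub>" by blast
qed

lemma finite_roots_of_unity:
  assumes "m \<ge> 1" shows "finite (roots_of_unity m :: 'f::field set)"
proof -
  let ?P = "Polynomial.monom 1 m - 1 :: 'f poly"
  have "coeff ?P m = 1" using assms by simp
  hence "?P \<noteq> 0" by (metis coeff_0 zero_neq_one)
  hence "finite {z. poly ?P z = 0}" by (rule poly_roots_finite)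
  thus ?thesis by (simp add: roots_of_unity_def poly_monom)
qed

lemma finite_G_single:
  assumes "m \<ge> 1" shows "finite (carrier (G_single m p r))"
proof -
  have "A_set m p r \<subseteq> {1..r} \<rightarrow>\<^sub>E (roots_of_unity m :: 'a set)" by (auto simp: A_set_def)
  hence "finite (A_set m p r :: (nat \<Rightarrow> 'a) set)"
    using finite_PiE[of "{1..r}" "\<lambda>_. roots_of_unity m"] finite_roots_of_unity[OF assms] finite_subset by blast
  thus ?thesis by (simp add: G_single_def sym_group_def finite_permutations)
qed

lemma const_x_var_eq_iff: "const a * x_var k i = x_var l j \<longleftrightarrow> a = 1 \<and> (k, i) = (l, j)"
proof
  assume "const a * x_var k i = x_var l j"
  hence *: "Poly_Mapping.single (Poly_Mapping.single (k, i) (1::int)) a =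
      Poly_Mapping.single (Poly_Mapping.single (l, j) 1) 1"
    by (simp add: const_def x_var_def mult_single flip: to_fract_mult)
  have "Poly_Mapping.lookup (Poly_Mapping.single (Poly_Mapping.single (k, i) (1::int)) a)
      (Poly_Mapping.single (l, j) 1) = 1" unfolding * by simp
  thus "a = 1 \<and> (k, i) = (l, j)"
    by (auto simp: lookup_single when_def frag_of_eq split: if_splits)
qed simp

locale ogz_parameters =
  fixes n m p :: nat and r :: "nat \<Rightarrow> nat" and q :: "'f::field_char_0"
  assumes m: "m \<ge> 1" and q: "q \<noteq> 0" and q_power: "\<forall>j\<ge>1. q ^ j \<noteq> 1"
begin

abbreviation G :: "(nat \<Rightarrow> (nat \<Rightarrow> nat) \<times> (nat \<Rightarrow> 'f)) monoid" where
  "G \<equiv> G_group n r m p"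

lemma carrier_G:
  "g \<in> carrier G \<longleftrightarrow> g \<in> extensional {1..n} \<and>
    (\<forall>k\<in>{1..n}. fst (g k) permutes {1..r k} \<and> snd (g k) \<in> A_set m p (r k))"
  by (auto simp: G_group_def G_single_def sym_group_def PiE_iff mem_Times_iff)

lemma group_G: "group G"
  unfolding G_group_def by (rule product_group) (rule group_G_single[OF m])

lemma finite_carrier_G: "finite (carrier G)"
  unfolding G_group_def carrier_product_group by (intro finite_PiE finite_G_single[OF m]) simp

lemma G_perm_in_vars:
  assumes "g \<in> carrier G" "(k, i) \<in> vars n r"
  shows "G_perm n r g (k, i) = (k, fst (g k) i)" "(k, fst (g k) i) \<in> vars n r"
  using assms permutes_in_image[of "fst (g k)" "{1..r k}" i] by (auto simp: G_perm_def vars_def carrier_G)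

lemma bij_G_perm:
  assumes g: "g \<in> carrier G" shows "bij (G_perm n r g)"
proof -
  let ?h = "\<lambda>v. if v \<in> vars n r then (fst v, inv' (fst (g (fst v))) (snd v)) else v"
  have "?h (k, i) \<in> vars n r" "fst (g k) (inv' (fst (g k)) i) = i" "inv' (fst (g k)) (fst (g k) i) = i"
    if "(k, i) \<in> vars n r" for k i
  proof -
    have p: "fst (g k) permutes {1..r k}" using g that by (auto simp: carrier_G vars_def)
    show "fst (g k) (inv' (fst (g k)) i) = i" "inv' (fst (g k)) (fst (g k) i) = i"
      using permutes_inverses[OF p] by simp_all
    show "?h (k, i) \<in> vars n r" using that permutes_in_image[OF permutes_inv[OF p], of i] by (simp add: vars_def)
  qed
  note * = this
  have "?h (G_perm n r g v) = v" "G_perm n r g (?h v) = v" for v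
    using *[of "fst v" "snd v"] G_perm_in_vars[OF g, of "fst v" "snd v"] by (auto simp: G_perm_def)
  thus ?thesis by (intro o_bij[of ?h]) (auto simp: fun_eq_iff simp del: split_paired_All)
qed

lemma G_coef_nonzero: "g \<in> carrier G \<Longrightarrow> G_coef n r g v \<noteq> 0"
  using A_set_nonzero[OF _ m, of "snd (g (fst v))" p "r (fst v)" "snd v"]
  by (auto simp: G_coef_def carrier_G vars_def split: prod.splits)

lemma G_perm_image: "g \<in> carrier G \<Longrightarrow> G_perm n r g ` vars n r \<subseteq> vars n r"
  using G_perm_in_vars by auto

lemma G_act_frac: "G_act n r g = frac_subst (G_perm n r g) (G_coef n r g)"
  by (simp add: G_act_def frac_subst_def)

lemma shift_act_frac: "shift_act q \<mu> = frac_subst id (\<lambda>v. q powi (- Poly_Mapping.lookup \<mu> v))"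
  by (simp add: shift_act_def frac_subst_def)

lemma mult_G:
  "k \<in> {1..n} \<Longrightarrow> (g \<otimes>\<^bsub>G\<^esub> h) k =
    (fst (g k) \<circ> fst (h k), \<lambda>i\<in>{1..r k}. snd (g k) (fst (h k) i) * snd (h k) i)"
  by (simp add: G_group_def G_single_def case_prod_unfold)

lemma G_perm_mult:
  assumes "g \<in> carrier G" "h \<in> carrier G"
  shows "G_perm n r (g \<otimes>\<^bsub>G\<^esub> h) = G_perm n r g \<circ> G_perm n r h"
proof
  fix v
  show "G_perm n r (g \<otimes>\<^bsub>G\<^esub> h) v = (G_perm n r g \<circ> G_perm n r h) v"
    using G_perm_in_vars[OF assms(2), of "fst v" "snd v"]
    by (cases "v \<in> vars n r") (auto simp: G_perm_def mult_G vars_def)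
qed

text \<open>The scalars form a cocycle: h acts first and replaces the variable, so g contributes its
  scalar at the permuted index. This is the rule of \<open>frac_subst_comp\<close>.\<close>

lemma G_coef_mult:
  assumes "g \<in> carrier G" "h \<in> carrier G"
  shows "G_coef n r (g \<otimes>\<^bsub>G\<^esub> h) v = G_coef n r h v * G_coef n r g (G_perm n r h v)"
  using G_perm_in_vars[OF assms(2), of "fst v" "snd v"]
  by (cases "v \<in> vars n r") (auto simp: G_perm_def G_coef_def mult_G vars_def)

lemma G_one: "G_perm n r \<one>\<^bsub>G\<^esub> = id" "G_coef n r \<one>\<^bsub>G\<^esub> = (\<lambda>v. 1)"
  by (auto simp: fun_eq_iff G_perm_def G_coef_def G_group_def G_single_def vars_def)

section \<open>Separation of the shifts by invariant power sums\<close>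

lemma q_powi_eq_iff: "q powi z = q powi w \<longleftrightarrow> z = w"
proof
  have aux: "\<not> z < w" if "q powi z = q powi w" for z w
  proof
    assume "z < w"
    hence "q powi (w - z) = q ^ nat (w - z)" by (simp add: power_int_def)
    moreover have "q powi (w - z) = 1" using that q by (simp add: power_int_diff)
    ultimately show False using q_power \<open>z < w\<close> by simp
  qed
  assume "q powi z = q powi w"
  thus "z = w" using aux[of z w] aux[of w z] by (metis linorder_neqE)
qed simp

text \<open>Taking m-th powers absorbs the roots of unity and summing absorbs the permutations, so
  this is an invariant in which every variable of row k still has a monomial of its own.\<close>

definition power_sum :: "nat \<Rightarrow> 'f laurent" where
  "power_sum k = (\<Sum>i\<in>{1..r k}. Poly_Mapping.single (Poly_Mapping.single (k, i) (int m)) 1)"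

lemma power_sum_in_Gamma:
  assumes k: "k \<in> {1..n}" shows "to_fract (power_sum k) \<in> Gamma n r m p"
proof -
  have "Poly_Mapping.keys (power_sum k) \<subseteq> lattice_on (vars n r)"
    unfolding power_sum_def using k
    by (intro order.trans[OF keys_sum] UN_least) (auto simp: lattice_on_def vars_def)
  hence "to_fract (power_sum k) \<in> Lambda n r" by (auto simp: Lambda_def)
  moreover have "G_act n r g (to_fract (power_sum k)) = to_fract (power_sum k)" if g: "g \<in> carrier G" for g
  proof -
    have p: "fst (g k) permutes {1..r k}" using g k by (auto simp: carrier_G)
    have "laurent_subst (G_perm n r g) (G_coef n r g) (power_sum k) =
        (\<Sum>i\<in>{1..r k}. Poly_Mapping.single (Poly_Mapping.single (k, fst (g k) i) (int m)) 1)"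
      unfolding power_sum_def laurent_subst_sum
    proof (rule sum.cong[OF refl])
      fix i assume i: "i \<in> {1..r k}"
      have v: "(k, i) \<in> vars n r" using i k by (simp add: vars_def)
      have "snd (g k) i ^ m = 1" using g k i by (auto simp: carrier_G A_set_iff)
      hence "G_coef n r g (k, i) ^ m = 1" using v by (simp add: G_coef_def)
      thus "laurent_subst (G_perm n r g) (G_coef n r g)
          (Poly_Mapping.single (Poly_Mapping.single (k, i) (int m)) 1) =
          Poly_Mapping.single (Poly_Mapping.single (k, fst (g k) i) (int m)) 1"
        by (simp add: G_perm_in_vars[OF g v])
    qed
    also have "\<dots> = power_sum k"
      unfolding power_sum_def by (subst (2) sum.permute[OF p]) (simp add: comp_def)
    finally show ?thesis
      using bij_G_perm[OF g] G_coef_nonzero[OF g] by (simp add: G_act_frac frac_subst_to_fract)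
  qed
  ultimately show ?thesis by (simp add: Gamma_def)
qed

lemma lookup_shift_power_sum:
  assumes "i \<in> {1..r k}"
  shows "Poly_Mapping.lookup (laurent_subst id (\<lambda>v. q powi (- Poly_Mapping.lookup \<mu> v)) (power_sum k))
      (Poly_Mapping.single (k, i) (int m)) = q powi (- Poly_Mapping.lookup \<mu> (k, i) * int m)"
proof -
  \<comment> \<open>As m > 0, different j give different monomials, so no other term contributes to
    this coefficient.\<close>
  have eq: "Poly_Mapping.single (k, j) (int m) = Poly_Mapping.single (k, i) (int m) \<longleftrightarrow> j = i" for j
    using m by (metis (no_types, opaque_lifting) keys_single less_one not_le of_nat_0_less_iff order_less_irrefl prod.inject singleton_inject zero_less_one_class.zero_less_one of_nat_0_eq_iff)
  have "q powi (- Poly_Mapping.lookup \<mu> (k, i) * int m) = (q powi (- Poly_Mapping.lookup \<mu> (k, i))) ^ m"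
    by (simp only: power_int_mult power_int_of_nat)
  thus ?thesis
    using assms by (simp add: power_sum_def laurent_subst_sum lookup_sum lookup_single when_def eq)
qed

text \<open>Comparing coefficients in the shifted power sum of row k recovers q^(-m \<mu>(k,i)),
  hence \<mu>(k,i). Entries outside the first n - 1 rows vanish for both exponents.\<close>

lemma shift_separating:
  assumes \<mu>: "\<mu> \<in> M_group n r" "\<nu> \<in> M_group n r"
    and eq: "\<And>a. a \<in> Gamma n r m p \<Longrightarrow> shift_act q \<mu> a = shift_act q \<nu> a"
  shows "\<mu> = \<nu>"
proof (rule poly_mapping_eqI)
  fix v :: "nat \<times> nat"
  obtain k i where [simp]: "v = (k, i)" by (cases v)
  show "Poly_Mapping.lookup \<mu> v = Poly_Mapping.lookup \<nu> v"
  proof (cases "v \<in> vars (n - 1) r")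
    case False
    thus ?thesis using \<mu> by (metis (no_types, lifting) in_keys_iff lattice_on_def mem_Collect_eq subsetD)
  next
    case True
    hence k: "k \<in> {1..n}" "i \<in> {1..r k}" by (auto simp: vars_def)
    have "shift_act q \<mu> (to_fract (power_sum k)) = shift_act q \<nu> (to_fract (power_sum k))"
      by (rule eq[OF power_sum_in_Gamma[OF k(1)]])
    hence "laurent_subst id (\<lambda>v. q powi (- Poly_Mapping.lookup \<mu> v)) (power_sum k) =
        laurent_subst id (\<lambda>v. q powi (- Poly_Mapping.lookup \<nu> v)) (power_sum k)"
      using q by (simp add: shift_act_frac frac_subst_to_fract)
    hence "q powi (- Poly_Mapping.lookup \<mu> (k, i) * int m) = q powi (- Poly_Mapping.lookup \<nu> (k, i) * int m)"
      using lookup_shift_power_sum[OF k(2)] by metis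
    thus ?thesis using m by (simp add: q_powi_eq_iff)
  qed
qed

lemma Gamma_subring: "subring (Gamma n r m p :: 'f ratfun set) ring_of_type_algebra"
proof (rule subring_type_algebraI)
  note L = subring_type_algebraD[OF Lambda_subring]
  have add: "G_act n r g (x + y) = G_act n r g x + G_act n r g y"
    and mult: "G_act n r g (x * y) = G_act n r g x * G_act n r g y"
    and one: "G_act n r g 1 = 1" if "g \<in> carrier G" for g x y
    using bij_G_perm[OF that] G_coef_nonzero[OF that] frac_subst_const[of "G_perm n r g" "G_coef n r g" 1]
    by (simp_all add: G_act_frac frac_subst_add frac_subst_mult)
  show "(1 :: 'f ratfun) \<in> Gamma n r m p" by (simp add: Gamma_def L one)
  fix x :: "'f ratfun" assume x: "x \<in> Gamma n r m p"
  show "- x \<in> Gamma n r m p"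
  proof -
    have "G_act n r g (- x) = - x" if g: "g \<in> carrier G" for g
    proof -
      \<comment> \<open>Negation is treated as multiplication by the constant -1, which every
        substitution fixes.\<close>
      have "const (-1) = (-1 :: 'f ratfun)" using const_add[of "-1" 1] by (simp add: eq_neg_iff_add_eq_0)
      hence "G_act n r g (-1) = -1"
        using frac_subst_const[of "G_perm n r g" "G_coef n r g" "-1"] bij_G_perm[OF g] G_coef_nonzero[OF g]
        by (simp add: G_act_frac)
      thus ?thesis using mult[OF g, of "-1" x] x g by (simp add: Gamma_def)
    qed
    thus ?thesis using x by (simp add: Gamma_def L)
  qed
  fix y :: "'f ratfun" assume y: "y \<in> Gamma n r m p"
  show "x + y \<in> Gamma n r m p" "x * y \<in> Gamma n r m p"
    using x y by (simp_all add: Gamma_def L add mult)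
qed

text \<open>The image of a variable shows both the permuted index and the root of unity. The
  permutations fix all other indices and the remaining data are extensional, so g is
  determined.\<close>

lemma G_faithful:
  assumes g: "g \<in> carrier G" and fix_L: "\<And>a. a \<in> L_field n r \<Longrightarrow> G_act n r g a = a"
  shows "g = \<one>\<^bsub>G\<^esub>"
proof -
  have fixed: "fst (g k) i = i \<and> snd (g k) i = 1" if "k \<in> {1..n}" "i \<in> {1..r k}" for k i
  proof -
    have v: "(k, i) \<in> vars n r" using that by (simp add: vars_def)
    have "const (G_coef n r g (k, i)) * x_var k (fst (g k) i) = G_act n r g (x_var k i)"
      using frac_subst_x_var[OF bij_G_perm[OF g] G_coef_nonzero[OF g] G_perm_in_vars(1)[OF g v]]
      by (simp add: G_act_frac)
    also have "\<dots> = x_var k i"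
      using x_var_in_Lambda[OF v] Lambda_subset_L_field by (intro fix_L) blast
    finally show ?thesis using v by (simp add: const_x_var_eq_iff G_coef_def)
  qed
  have "g k = (id, \<lambda>i\<in>{1..r k}. 1)" if k: "k \<in> {1..n}" for k
  proof -
    have "fst (g k) = id"
    proof
      fix i show "fst (g k) i = id i"
        using fixed[OF k, of i] g k permutes_not_in[of "fst (g k)" "{1..r k}" i] by (auto simp: carrier_G)
    qed
    moreover have "snd (g k) = (\<lambda>i\<in>{1..r k}. 1)"
      by (rule extensionalityI[of _ "{1..r k}"]) (use fixed[OF k] g k in \<open>auto simp: carrier_G A_set_iff\<close>)
    ultimately show ?thesis by (simp add: prod_eq_iff)
  qed
  moreover have "\<one>\<^bsub>G\<^esub> k = (id, \<lambda>i\<in>{1..r k}. 1)" if "k \<in> {1..n}" for k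
    using that by (simp add: G_group_def G_single_def)
  moreover have "g \<in> extensional {1..n}" "\<one>\<^bsub>G\<^esub> \<in> extensional {1..n}"
    using g group.is_monoid[OF group_G, THEN monoid.one_closed] unfolding carrier_G by blast+
  ultimately show ?thesis by (intro extensionalityI[of _ "{1..n}"]) simp_all
qed

sublocale finite_field_action G "G_act n r" "L_field n r"
proof (intro_locales)
  show "Group.monoid G" using group_G by (simp add: group.is_monoid)
  show "group_axioms G" using group_G by (simp add: group_def)
  show "finite_field_action_axioms G (G_act n r) (L_field n r)"
  proof (rule finite_field_action_axioms.intro)
    fix g h a b assume g: "g \<in> carrier G"
    note gg = bij_G_perm[OF g] G_coef_nonzero[OF g]
    show "G_act n r g (a + b) = G_act n r g a + G_act n r g b"
      "G_act n r g (a * b) = G_act n r g a * G_act n r g b"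
      by (simp_all add: G_act_frac frac_subst_add frac_subst_mult gg)
    show "a \<in> L_field n r \<Longrightarrow> G_act n r g a \<in> L_field n r"
      by (simp add: G_act_frac frac_subst_L_field gg G_perm_image g)
    assume h: "h \<in> carrier G"
    show "G_act n r (g \<otimes>\<^bsub>G\<^esub> h) a = G_act n r g (G_act n r h a)"
      using gg bij_G_perm[OF h] G_coef_nonzero[OF h]
      by (simp add: G_act_frac frac_subst_comp G_perm_mult[OF g h]) (simp add: G_coef_mult[OF g h, abs_def])
  next
    fix g assume "g \<in> carrier G" "\<And>a. a \<in> L_field n r \<Longrightarrow> G_act n r g a = a"
    thus "g = \<one>\<^bsub>G\<^esub>" by (rule G_faithful)
  qed (simp_all add: finite_carrier_G L_field_subfield G_act_frac G_one)
qed

text \<open>G sends monomials to scalar multiples of monomials and so preserves \<Lambda>; invariant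
  fractions of \<Lambda> are then fractions of invariants.\<close>

lemma fixed_field_eq: "fixed_field = K_field n r m p"
  unfolding K_field_def Gamma_def
  by (rule fractions_of_invariants[symmetric])
    (simp_all add: Lambda_subring L_field_def G_act_frac frac_subst_Lambda bij_G_perm G_coef_nonzero G_perm_image)

sublocale automorphism_action "shift_act q"
proof
  fix \<mu> \<nu> :: expo and a b
  show "shift_act q \<mu> (a + b) = shift_act q \<mu> a + shift_act q \<mu> b"
    "shift_act q \<mu> (a * b) = shift_act q \<mu> a * shift_act q \<mu> b"
    "shift_act q 0 a = a"
    by (simp_all add: shift_act_frac frac_subst_add frac_subst_mult q)
  show "shift_act q (\<mu> + \<nu>) a = shift_act q \<mu> (shift_act q \<nu> a)"
    using q by (simp add: shift_act_frac frac_subst_comp q lookup_add power_int_add[symmetric] minus_diff_commute)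
qed

sublocale skew_galois G "G_act n r" "L_field n r" "shift_act q" "G_act_expo n r" "M_group n r" "Gamma n r m p"
proof (intro_locales, rule skew_galois_axioms.intro)
  fix \<mu> \<nu> :: expo and a
  show "a \<in> L_field n r \<Longrightarrow> shift_act q \<mu> a \<in> L_field n r"
    by (simp add: shift_act_frac frac_subst_L_field q)
  show "0 \<in> M_group n r" "\<mu> \<in> M_group n r \<Longrightarrow> \<nu> \<in> M_group n r \<Longrightarrow> \<mu> + \<nu> \<in> M_group n r"
    "\<mu> \<in> M_group n r \<Longrightarrow> - \<mu> \<in> M_group n r" by (rule lattice_on_closed; assumption?)+
  fix g assume g: "g \<in> carrier G"
  note gg = bij_G_perm[OF g] G_coef_nonzero[OF g]
  \<comment> \<open>Permutations stay within a row, so the first n - 1 rows are preserved.\<close>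
  have "G_perm n r g ` vars (n - 1) r \<subseteq> vars (n - 1) r"
    using G_perm_in_vars[OF g] by (auto simp: vars_def)
  thus "\<mu> \<in> M_group n r \<Longrightarrow> G_act_expo n r g \<mu> \<in> M_group n r"
    using keys_expo_map[of "G_perm n r g" \<mu>]
    by (simp add: lattice_on_def G_act_expo_def) (meson image_mono order.trans)
  show "G_act_expo n r g (\<mu> + \<nu>) = G_act_expo n r g \<mu> + G_act_expo n r g \<nu>"
    by (simp add: G_act_expo_def expo_map_add)
  \<comment> \<open>Both sides substitute the same multiple of the permuted variable for x_v: the
    transported exponent has at \<pi>(v) the entry that \<mu> has at v.\<close>
  show "shift_act q (G_act_expo n r g \<mu>) (G_act n r g a) = G_act n r g (shift_act q \<mu> a)"
    using gg by (simp add: shift_act_frac G_act_frac frac_subst_comp q G_act_expo_def lookup_expo_map bij_is_inj mult.commute)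
  fix h assume h: "h \<in> carrier G"
  show "G_act_expo n r (g \<otimes>\<^bsub>G\<^esub> h) \<mu> = G_act_expo n r g (G_act_expo n r h \<mu>)"
    by (simp add: G_act_expo_def expo_map_comp G_perm_mult[OF g h])
next
  show "fractions_of (Gamma n r m p) = fixed_field" by (simp add: fixed_field_eq K_field_def)
  show "G_act_expo n r \<one>\<^bsub>G\<^esub> \<mu> = \<mu>" for \<mu> by (simp add: G_act_expo_def G_one)
qed (simp_all add: Gamma_subring shift_separating)

end

section \<open>The generators\<close>

context ogz_parameters
begin

text \<open>The bracket without its monomial factor. It depends on z only through z^m, so the roots
  of unity in G do not affect it.\<close>

definition ratio :: "'f ratfun \<Rightarrow> 'f ratfun" where
  "ratio z = (z ^ m - 1) / (const q powi (- int (m div p)) * (const q ^ m - 1))"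

lemma bracket_eq: "bracket m p q z = inverse (z ^ (m div p)) * ratio z"
  by (simp add: bracket_def ratio_def power_int_minus)

text \<open>
  The powers of \<open>x\<^sub>k\<^sub>i\<close> in the definition combine with the brackets to a monomial that does not
  depend on \<open>i\<close> and is invariant under \<open>G\<close>.
\<close>

lemma A_coef_eq:
  assumes k: "k \<ge> 1" and i: "i \<in> {1..r k}" and k': "k' = nat (int k + s)"
  shows "A_coef r m p q s k i =
    - of_int s * (\<Prod>j\<in>{1..r k}. x_var k j) ^ (m div p) *
      inverse ((\<Prod>j\<in>{1..sig r k'}. x_var k' j) ^ (m div p)) *
      (\<Prod>j\<in>{1..sig r k'}. ratio (x_var k' j * inverse (x_var k i))) *
      inverse (\<Prod>j\<in>{1..r k} - {i}. ratio (x_var k j * inverse (x_var k i)))"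
proof -
  let ?e = "m div p" and ?x = "x_var k i :: 'f ratfun" and ?R' = "sig r k'"
  have inv: "(\<Prod>j\<in>J. inverse (f j ^ ?e)) = inverse ((\<Prod>j\<in>J. f j) ^ ?e)" for J :: "nat set" and f :: "nat \<Rightarrow> 'f ratfun"
    by (induction J rule: infinite_finite_induct) (simp_all add: power_mult_distrib)
  have b: "(\<Prod>j\<in>J. bracket m p q (x_var l j * inverse ?x)) =
      inverse ((\<Prod>j\<in>J. x_var l j) ^ ?e) * (?x ^ ?e) ^ card J *
      (\<Prod>j\<in>J. ratio (x_var l j * inverse ?x))" for J l
    by (simp add: bracket_eq prod.distrib power_mult_distrib power_inverse inv)
  define R where "R = r k - 1"
  have R: "card ({1..r k} - {i}) = R" "r k = Suc R" using i by (simp_all add: R_def)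
  \<comment> \<open>With e = m/p, R' = \<open>sig r k'\<close> and R = r_k - 1, the brackets
    contribute the powers e R' (numerator) and -e R (denominator) of \<open>x_ki\<close>. Together
    with e (R + 1) - e R' from the prefactor this leaves \<open>x_ki^e\<close>, the factor missing
    from the product over j \<noteq> i.\<close>
  have "- (int ?e * (int ?R' - int (sig r k))) = int (?e * Suc R) - int (?e * ?R')"
    using k R(2) by (simp add: sig_def algebra_simps)
  hence pw: "?x powi (- (int ?e * (int ?R' - int (sig r k)))) = (?x ^ ?e) ^ R * ?x ^ ?e * inverse ((?x ^ ?e) ^ ?R')"
    by (simp only: power_int_diff[OF disjI1[OF x_var_nonzero]] power_int_of_nat)
      (simp add: power_mult[symmetric] power_add[symmetric] divide_inverse add.commute)
  have all: "(\<Prod>j\<in>{1..r k}. x_var k j) ^ ?e = ?x ^ ?e * (\<Prod>j\<in>{1..r k} - {i}. x_var k j) ^ ?e"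
    using i by (subst prod.remove[of _ i]) (simp_all add: power_mult_distrib)
  have nz: "(?x ^ ?e) ^ N \<noteq> 0" for N by simp
  have "(\<Prod>j\<in>{1..r k} - {i}. x_var k j :: 'f ratfun) ^ ?e \<noteq> 0" by simp
  moreover have "sig r k = r k" using k by (simp add: sig_def)
  ultimately show ?thesis
    unfolding A_coef_def Let_def k'[symmetric] pw b all R(1)
    by (simp add: b R(1) field_simps del: One_nat_def)
qed

lemma G_act_power: "g \<in> carrier G \<Longrightarrow> G_act n r g (x ^ N) = G_act n r g x ^ N"
  by (induction N) (simp_all add: gL_mult)

lemma G_act_const: "g \<in> carrier G \<Longrightarrow> G_act n r g (const a) = const a"
  by (simp add: G_act_frac frac_subst_const bij_G_perm G_coef_nonzero)

lemma G_act_x_var: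
  assumes g: "g \<in> carrier G" and v: "(k, i) \<in> vars n r"
  shows "G_act n r g (x_var k i) = const (snd (g k) i) * x_var k (fst (g k) i)"
  using frac_subst_x_var[of "G_perm n r g" "G_coef n r g" k i k "fst (g k) i"]
    bij_G_perm[OF g] G_coef_nonzero[OF g] G_perm_in_vars(1)[OF g v] v
  by (simp add: G_act_frac) (simp add: G_coef_def)

lemma G_act_x_var_power:
  assumes g: "g \<in> carrier G" and v: "(k, i) \<in> vars n r"
  shows "G_act n r g (x_var k i) ^ m = x_var k (fst (g k) i) ^ m"
proof -
  have "snd (g k) i ^ m = 1" using g v by (auto simp: carrier_G A_set_iff vars_def)
  hence "const (snd (g k) i) ^ m = 1" by (simp flip: const_power)
  thus ?thesis by (simp add: G_act_x_var[OF assms] power_mult_distrib)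
qed

lemma G_act_ratio:
  assumes g: "g \<in> carrier G" and "(k, i) \<in> vars n r" "(l, j) \<in> vars n r"
  shows "G_act n r g (ratio (x_var l j * inverse (x_var k i))) =
    ratio (x_var l (fst (g l) j) * inverse (x_var k (fst (g k) i)))"
proof -
  define D :: "'f ratfun" where "D = const q powi (- int (m div p)) * (const q ^ m - 1)"
  have ratio: "ratio z = (z ^ m - 1) * inverse D" for z by (simp add: ratio_def D_def divide_inverse)
  have "G_act n r g D = D"
    using gL_add[OF g, of _ "- 1"]
    by (simp add: D_def power_int_minus gL_mult g gL_inverse G_act_power G_act_const gL_minus)
  moreover have "G_act n r g ((x_var l j * inverse (x_var k i)) ^ m - 1) =
      (x_var l (fst (g l) j) * inverse (x_var k (fst (g k) i))) ^ m - 1"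
    using gL_add[OF g, of _ "- 1"] G_act_x_var_power[OF assms(1,2)] G_act_x_var_power[OF assms(1,3)]
    by (simp add: gL_mult g gL_inverse G_act_power gL_minus power_mult_distrib power_inverse)
  ultimately show ?thesis by (simp add: ratio gL_mult g gL_inverse)
qed

text \<open>The permutation only reorders the factors, and the scalar that remains is 1 by the
  defining condition of \<open>A_set\<close> on the power m/p of the product.\<close>

lemma G_act_x_prod:
  assumes g: "g \<in> carrier G" and k: "k \<in> {1..n}"
  shows "G_act n r g ((\<Prod>j\<in>{1..r k}. x_var k j) ^ (m div p)) = (\<Prod>j\<in>{1..r k}. x_var k j) ^ (m div p)"
proof -
  have p: "fst (g k) permutes {1..r k}" and \<alpha>: "(\<Prod>j\<in>{1..r k}. snd (g k) j) ^ (m div p) = 1"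
    using g k by (auto simp: carrier_G A_set_iff)
  have "G_act n r g (\<Prod>j\<in>{1..r k}. x_var k j) =
      (\<Prod>j\<in>{1..r k}. const (snd (g k) j) * x_var k (fst (g k) j))"
    unfolding gL_prod[OF g] by (intro prod.cong refl G_act_x_var g) (use k in \<open>simp add: vars_def\<close>)
  also have "\<dots> = const (\<Prod>j\<in>{1..r k}. snd (g k) j) * (\<Prod>j\<in>{1..r k}. x_var k j)"
    using prod.permute[OF p, of "x_var k :: nat \<Rightarrow> 'f ratfun"] by (simp add: prod.distrib const_prod comp_def)
  finally show ?thesis using \<alpha> by (simp add: G_act_power g power_mult_distrib flip: const_power)
qed

text \<open>The value k' = 0 occurs for k = 1 and s = -1, where \<open>sig\<close> makes the
  products over row k' empty.\<close>

lemma neighbour: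
  assumes "k \<in> {1..n - 1}" "s \<in> {1, -1}" "k' = nat (int k + s)"
  shows "k' \<noteq> k" "k' = 0 \<or> k' \<in> {1..n}" "k \<in> {1..n}"
  using assms by auto

text \<open>In the form of \<open>A_coef_eq\<close> the monomials and the sign are fixed. In the
  numerator, g permutes row k' while i goes to \<sigma>(i); in the denominator, \<sigma> carries the
  complement of i to the complement of \<sigma>(i).\<close>

lemma G_act_A_coef:
  assumes g: "g \<in> carrier G" and k: "k \<in> {1..n - 1}" and i: "i \<in> {1..r k}" and s: "s \<in> {1, -1}"
  shows "G_act n r g (A_coef r m p q s k i) = A_coef r m p q s k (fst (g k) i)"
proof -
  define k' where "k' = nat (int k + s)"
  note nb = neighbour[OF k s k'_def]
  have p: "fst (g k) permutes {1..r k}" using g nb(3) by (auto simp: carrier_G)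
  have \<sigma>i: "fst (g k) i \<in> {1..r k}" using permutes_in_image[OF p] i by blast
  have v: "(k, j) \<in> vars n r" if "j \<in> {1..r k}" for j using that nb(3) by (simp add: vars_def)
  have "G_act n r g (of_int s) = of_int s" using s g gL_minus[OF g, of 1] by auto
  hence sgn: "G_act n r g (- of_int s) = - of_int s" by (simp add: gL_minus g)
  have Y: "G_act n r g ((\<Prod>j\<in>{1..sig r k'}. x_var k' j) ^ (m div p)) = (\<Prod>j\<in>{1..sig r k'}. x_var k' j) ^ (m div p)"
    using nb(2) G_act_x_prod[OF g, of k'] by (auto simp: sig_def G_act_power g)
  have num: "G_act n r g (\<Prod>j\<in>{1..sig r k'}. ratio (x_var k' j * inverse (x_var k i))) =
      (\<Prod>j\<in>{1..sig r k'}. ratio (x_var k' j * inverse (x_var k (fst (g k) i))))"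
  proof (cases "k' = 0")
    case False
    hence k': "k' \<in> {1..n}" "sig r k' = r k'" using nb(2) by (auto simp: sig_def)
    have p': "fst (g k') permutes {1..r k'}" using g k' by (auto simp: carrier_G)
    have "G_act n r g (\<Prod>j\<in>{1..r k'}. ratio (x_var k' j * inverse (x_var k i))) =
        (\<Prod>j\<in>{1..r k'}. ratio (x_var k' (fst (g k') j) * inverse (x_var k (fst (g k) i))))"
      unfolding gL_prod[OF g]
      by (intro prod.cong refl G_act_ratio g v i) (use k' in \<open>simp add: vars_def\<close>)
    thus ?thesis
      unfolding k'(2) using prod.permute[OF p', of "\<lambda>j. ratio (x_var k' j * inverse (x_var k (fst (g k) i)))"]
      by (simp add: comp_def)
  qed (simp add: sig_def g)
  have den: "G_act n r g (\<Prod>j\<in>{1..r k} - {i}. ratio (x_var k j * inverse (x_var k i))) =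
      (\<Prod>j\<in>{1..r k} - {fst (g k) i}. ratio (x_var k j * inverse (x_var k (fst (g k) i))))"
  proof -
    have "bij_betw (fst (g k)) ({1..r k} - {i}) ({1..r k} - {fst (g k) i})"
      using bij_betw_DiffI[OF permutes_imp_bij[OF p], of "{i}" "{fst (g k) i}"] i \<sigma>i by (simp add: bij_betw_def)
    note prod.reindex_bij_betw[OF this, of "\<lambda>j. ratio (x_var k j * inverse (x_var k (fst (g k) i)))", symmetric]
    moreover have "G_act n r g (\<Prod>j\<in>{1..r k} - {i}. ratio (x_var k j * inverse (x_var k i))) =
        (\<Prod>j\<in>{1..r k} - {i}. ratio (x_var k (fst (g k) j) * inverse (x_var k (fst (g k) i))))"
      unfolding gL_prod[OF g] by (intro prod.cong refl G_act_ratio g v i) auto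
    ultimately show ?thesis by simp
  qed
  have k1: "k \<ge> 1" using k by simp
  show ?thesis
    unfolding A_coef_eq[OF k1 i k'_def] A_coef_eq[OF k1 \<sigma>i k'_def]
      gL_mult[OF g] gL_inverse[OF g] num den Y sgn G_act_x_prod[OF g nb(3)] ..
qed

text \<open>Distinct variables have distinct m-th powers, so the numerator survives; q^m \<noteq> 1
  keeps the denominator from being 0, which would make the quotient 0.\<close>

lemma ratio_nonzero:
  assumes "(k, i) \<noteq> (l, j)"
  shows "ratio (x_var l j * inverse (x_var k i)) \<noteq> 0"
proof -
  have "(x_var l j * inverse (x_var k i) :: 'f ratfun) ^ m \<noteq> 1"
    using x_var_power_eq_iff[of m l j k i, where 'f = 'f] m assms
    by (auto simp: power_divide divide_inverse[symmetric])
  moreover have "const q ^ m \<noteq> (1 :: 'f ratfun)"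
    using q_power m const_eq_iff[of "q ^ m" 1] by (simp add: const_power)
  ultimately show ?thesis using q by (simp add: ratio_def)
qed

text \<open>Row k' differs from row k, and i is left out in row k, so every ratio compares two
  distinct variables.\<close>

lemma A_coef_nonzero:
  assumes "k \<in> {1..n - 1}" "i \<in> {1..r k}" and s: "s \<in> {1, -1}"
  shows "A_coef r m p q s k i \<noteq> 0"
proof -
  have "nat (int k + s) \<noteq> k" using neighbour(1)[OF assms(1,3) refl] .
  hence "(\<Prod>j\<in>J. ratio (x_var (nat (int k + s)) j * inverse (x_var k i))) \<noteq> 0"
    and "(\<Prod>j\<in>J - {i}. ratio (x_var k j * inverse (x_var k i))) \<noteq> 0" if "finite J" for J
    using that by (auto simp: ratio_nonzero)
  thus ?thesis using assms by (subst A_coef_eq[OF _ assms(2) refl]) auto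
qed

lemma L_power: "(a :: 'f ratfun) \<in> L_field n r \<Longrightarrow> a ^ N \<in> L_field n r"
  by (induction N) (simp_all add: L_closed)

lemma const_L: "const (a :: 'f) \<in> L_field n r"
  using const_in_Lambda Lambda_subset_L_field by blast

lemma x_var_L: "(k, i) \<in> vars n r \<Longrightarrow> (x_var k i :: 'f ratfun) \<in> L_field n r"
  using x_var_in_Lambda Lambda_subset_L_field by blast

lemma ratio_L: "z \<in> L_field n r \<Longrightarrow> ratio z \<in> L_field n r"
  unfolding ratio_def divide_inverse power_int_minus power_int_of_nat diff_conv_add_uminus
  by (intro L_closed L_power const_L)

lemma A_coef_L:
  assumes k: "k \<in> {1..n - 1}" and i: "i \<in> {1..r k}" and s: "s \<in> {1, -1}"
  shows "A_coef r m p q s k i \<in> L_field n r"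
proof -
  define k' where "k' = nat (int k + s)"
  note nb = neighbour[OF k s k'_def]
  have k1: "k \<ge> 1" using k by simp
  have v: "(x_var k j :: 'f ratfun) \<in> L_field n r" if "j \<in> {1..r k}" for j
    using that nb(3) by (intro x_var_L) (simp add: vars_def)
  have v': "(x_var k' j :: 'f ratfun) \<in> L_field n r" if "j \<in> {1..sig r k'}" for j
    using that nb(2) by (intro x_var_L) (auto simp: vars_def sig_def split: if_splits)
  have sgn: "(- of_int s :: 'f ratfun) \<in> L_field n r" using s L_closed by auto
  have P: "prod f J \<in> L_field n r" if "\<And>j. j \<in> J \<Longrightarrow> f j \<in> L_field n r" for f :: "nat \<Rightarrow> 'f ratfun" and J
    using that by (intro prod_closed) (simp_all add: L_closed)
  show ?thesis
    unfolding A_coef_eq[OF k1 i k'_def]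
    by (intro L_closed(5,6) L_power P ratio_L v v' sgn i; simp)
qed

text \<open>Finitely supported functions carry their coefficients on the left; moving
  \<open>A_coef\<close> across the group element applies the shift to it.\<close>

lemma X_gen_eq:
  "X_gen r m p q s k = (\<Sum>i\<in>{1..r k}. Poly_Mapping.single (Poly_Mapping.single (k, i) s)
     (shift_act q (Poly_Mapping.single (k, i) s) (A_coef r m p q s k i)))"
  by (simp add: X_gen_def skew_mult_single)

lemma lookup_X_gen:
  "Poly_Mapping.lookup (X_gen r m p q s k) \<kappa> = (\<Sum>i\<in>{1..r k}. if Poly_Mapping.single (k, i) s = \<kappa>
     then shift_act q (Poly_Mapping.single (k, i) s) (A_coef r m p q s k i) else 0)"
  unfolding X_gen_eq lookup_sum by (intro sum.cong refl) (simp add: lookup_single when_def)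

lemma single_eq_single_iff: "s \<noteq> 0 \<Longrightarrow> Poly_Mapping.single v s = Poly_Mapping.single w s \<longleftrightarrow> v = w"
  by (metis keys_single singleton_inject)

text \<open>The summands have pairwise different exponents, so they cannot cancel and each
  coefficient is the shift of a nonzero element.\<close>

lemma X_gen_support:
  assumes k: "k \<in> {1..n - 1}" and i: "i \<in> {1..r k}" and s: "s \<in> {1, -1}"
  shows "Poly_Mapping.lookup (X_gen r m p q s k) (Poly_Mapping.single (k, i) s) \<noteq> 0"
proof -
  have "s \<noteq> 0" using s by auto
  hence "Poly_Mapping.lookup (X_gen r m p q s k) (Poly_Mapping.single (k, i) s) =
      shift_act q (Poly_Mapping.single (k, i) s) (A_coef r m p q s k i)"
    using i by (simp add: lookup_X_gen single_eq_single_iff)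
  thus ?thesis using A_coef_nonzero[OF assms] by simp
qed

lemma X_gen_invs:
  assumes k: "k \<in> {1..n - 1}" and s: "s \<in> {1, -1}"
  shows "X_gen r m p q s k \<in> invs"
  unfolding invs_iff
proof (intro conjI ballI allI)
  have M: "Poly_Mapping.single (k, i) s \<in> M_group n r" if "i \<in> {1..r k}" for i
    using that k by (auto simp: lattice_on_def vars_def)
  show "Poly_Mapping.keys (X_gen r m p q s k) \<subseteq> M_group n r"
    unfolding X_gen_eq by (intro order.trans[OF keys_sum] UN_least) (use M in auto)
  fix \<kappa>
  show "Poly_Mapping.lookup (X_gen r m p q s k) \<kappa> \<in> L_field n r"
    unfolding lookup_X_gen
  proof (rule sum_closed)
    fix i assume i: "i \<in> {1..r k}"
    show "(if Poly_Mapping.single (k, i) s = \<kappa> then shift_act q (Poly_Mapping.single (k, i) s)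
        (A_coef r m p q s k i) else 0) \<in> L_field n r"
    proof (cases "Poly_Mapping.single (k, i) s = \<kappa>")
      case True
      show ?thesis unfolding if_P[OF True] by (rule act_closed[OF M[OF i] A_coef_L[OF k i s]])
    next
      case False
      show ?thesis unfolding if_not_P[OF False] by (rule L_closed(1))
    qed
  qed (simp_all add: L_closed)
  fix g assume g: "g \<in> carrier G"
  have p: "fst (g k) permutes {1..r k}" using g neighbour(3)[OF k s refl] by (auto simp: carrier_G)
  have gM: "Poly_Mapping.single (k, fst (g k) i) s = G_act_expo n r g (Poly_Mapping.single (k, i) s)"
    if "i \<in> {1..r k}" for i
  proof -
    have "(k, i) \<in> vars n r" using that k by (auto simp: vars_def)
    thus ?thesis by (simp add: G_act_expo_def G_perm_in_vars(1)[OF g])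
  qed
  have inj: "G_act_expo n r g \<mu> = G_act_expo n r g \<nu> \<longleftrightarrow> \<mu> = \<nu>" for \<mu> \<nu>
    using gM_inv(1)[OF g] by metis
  \<comment> \<open>Reindexing by the permutation of row k pairs the summand of \<sigma>(i) with the
    g-translate of the summand of i.\<close>
  have "Poly_Mapping.lookup (X_gen r m p q s k) (G_act_expo n r g \<kappa>) =
      (\<Sum>i\<in>{1..r k}. if Poly_Mapping.single (k, fst (g k) i) s = G_act_expo n r g \<kappa>
        then shift_act q (Poly_Mapping.single (k, fst (g k) i) s) (A_coef r m p q s k (fst (g k) i)) else 0)"
    unfolding lookup_X_gen by (subst sum.permute[OF p]) (simp add: comp_def)
  also have "\<dots> = (\<Sum>i\<in>{1..r k}. G_act n r g (if Poly_Mapping.single (k, i) s = \<kappa>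
        then shift_act q (Poly_Mapping.single (k, i) s) (A_coef r m p q s k i) else 0))"
    by (intro sum.cong refl) (simp only: gM G_act_A_coef[OF g k _ s, symmetric] act_gL[OF g] inj gL_0[OF g] if_distrib[of "G_act n r g"])
  also have "\<dots> = G_act n r g (Poly_Mapping.lookup (X_gen r m p q s k) \<kappa>)"
    unfolding lookup_X_gen gL_sum[OF g] ..
  finally show "Poly_Mapping.lookup (X_gen r m p q s k) (G_act_expo n r g \<kappa>) =
      G_act n r g (Poly_Mapping.lookup (X_gen r m p q s k) \<kappa>)" .
qed

text \<open>The monoid \<open>\<M>\<close> is generated by the supports of the \<open>X\<^sub>k\<^sup>\<plusminus>\<close>.\<close>

lemma support_covers_M:
  assumes U: "U \<subseteq> invs" and U_\<Gamma>: "coef ` Gamma n r m p \<subseteq> U"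
    and U_mult: "\<And>u v. u \<in> U \<Longrightarrow> v \<in> U \<Longrightarrow> skew_mult (shift_act q) u v \<in> U"
    and U_X: "\<And>k s. k \<in> {1..n - 1} \<Longrightarrow> s \<in> {1, -1} \<Longrightarrow> X_gen r m p q s k \<in> U"
    and \<mu>: "\<mu> \<in> M_group n r"
  shows "\<exists>u\<in>U. Poly_Mapping.lookup u \<mu> \<noteq> 0"
proof -
  let ?P = "\<lambda>\<mu>. \<exists>u\<in>U. Poly_Mapping.lookup u \<mu> \<noteq> 0"
  \<comment> \<open>The witness is u \<gamma> X with \<gamma> from \<open>support_add\<close>;
    without \<gamma>, other pairs of exponents could cancel this coefficient.\<close>
  have step: "?P (\<nu> + Poly_Mapping.single v s)" if \<nu>: "?P \<nu>" and "v \<in> vars (n - 1) r" "s \<in> {1, -1}" for \<nu> v s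
  proof -
    obtain k i where v: "v = (k, i)" by (cases v)
    hence k: "k \<in> {1..n - 1}" "i \<in> {1..r k}" using \<open>v \<in> vars (n - 1) r\<close> by (auto simp: vars_def)
    obtain u where u: "u \<in> U" "Poly_Mapping.lookup u \<nu> \<noteq> 0" using \<nu> by blast
    obtain \<gamma> where "\<gamma> \<in> Gamma n r m p" "Poly_Mapping.lookup (skew_mult (shift_act q) u
        (skew_mult (shift_act q) (coef \<gamma>) (X_gen r m p q s k))) (\<nu> + Poly_Mapping.single v s) \<noteq> 0"
      using support_add[OF subsetD[OF U u(1)] u(2) X_gen_support[OF k \<open>s \<in> {1, -1}\<close>]] v by blast
    thus ?thesis using u(1) U_\<Gamma> U_X[OF k(1) \<open>s \<in> {1, -1}\<close>] by (blast intro: U_mult)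
  qed
  \<comment> \<open>Both signs s are available, so the induction on integers can descend as well as
    ascend.\<close>
  have multiple: "?P (\<nu> + Poly_Mapping.single v z)" if "?P \<nu>" "v \<in> vars (n - 1) r" for \<nu> v z
  proof (induction z rule: int_induct[where k = 0])
    case base
    thus ?case using that(1) by simp
  next
    case (step1 z)
    thus ?case using step[OF step1(2) that(2), of 1] by (simp add: single_add add.assoc)
  next
    case (step2 z)
    thus ?case using step[OF step2(2) that(2), of "-1"]
      by (simp add: single_diff single_uminus add_diff_eq)
  qed
  have zero: "?P 0"
    using U_\<Gamma> \<Gamma>_closed(2) by (intro bexI[of _ "coef 1"]) auto
  have "?P (\<Sum>v\<in>S. Poly_Mapping.single v (Poly_Mapping.lookup \<mu> v))" if "finite S" "S \<subseteq> vars (n - 1) r" for S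
    using that
  proof (induction S)
    case (insert v S)
    thus ?case using multiple[of "\<Sum>v\<in>S. Poly_Mapping.single v (Poly_Mapping.lookup \<mu> v)" v]
      by (simp add: add.commute)
  qed (simp add: zero)
  from this[of "Poly_Mapping.keys \<mu>"] show ?thesis
    using \<mu> by (simp add: poly_mapping_sum_singles lattice_on_def)
qed

end

section \<open>The quantum OGZ algebra as an algebra of left multiplications\<close>

lemma skew_algebra_simps:
  "carrier (skew_algebra n r q I) = carrier (skew_ring (shift_act q) (L_field n r) (lattice_on I))"
  "monoid.mult (skew_algebra n r q I) = skew_mult (shift_act q)"
  "monoid.one (skew_algebra n r q I) = coef 1"
  "ring.zero (skew_algebra n r q I) = 0"
  "ring.add (skew_algebra n r q I) = (+)"
  "module.smult (skew_algebra n r q I) c f = skew_mult (shift_act q) (coef (const c)) f"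
  by (simp_all add: skew_algebra_def skew_ring_def Let_def)

section \<open>Generated subalgebras and left multiplications\<close>

lemma generated_subalgebraD:
  assumes "x \<in> generated_subalgebra A S" "subalgebra_of A B" "S \<subseteq> B"
  shows "x \<in> B"
  using assms by (auto simp: generated_subalgebra_def)

lemma generated_subalgebra_incl: "S \<subseteq> generated_subalgebra A S"
  by (auto simp: generated_subalgebra_def)

text \<open>Each closure property holds in every subalgebra containing S and passes to their
  intersection; \<open>I\<close> packages this argument.\<close>

lemma generated_subalgebra_closed:
  shows "\<one>\<^bsub>A\<^esub> \<in> generated_subalgebra A S"
    and "x \<in> generated_subalgebra A S \<Longrightarrow> \<ominus>\<^bsub>A\<^esub> x \<in> generated_subalgebra A S"
    and "x \<in> generated_subalgebra A S \<Longrightarrow> y \<in> generated_subalgebra A S \<Longrightarrow>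
      x \<oplus>\<^bsub>A\<^esub> y \<in> generated_subalgebra A S"
    and "x \<in> generated_subalgebra A S \<Longrightarrow> y \<in> generated_subalgebra A S \<Longrightarrow>
      x \<otimes>\<^bsub>A\<^esub> y \<in> generated_subalgebra A S"
proof -
  have I: "z \<in> generated_subalgebra A S" if "\<And>B. subring B A \<Longrightarrow> generated_subalgebra A S \<subseteq> B \<Longrightarrow> z \<in> B" for z
  proof -
    have "z \<in> B" if "subalgebra_of A B" "S \<subseteq> B" for B
      using that \<open>\<And>B. subring B A \<Longrightarrow> generated_subalgebra A S \<subseteq> B \<Longrightarrow> z \<in> B\<close>[of B]
      by (auto simp: subalgebra_of_def generated_subalgebra_def)
    thus ?thesis by (simp add: generated_subalgebra_def)
  qed
  show "\<one>\<^bsub>A\<^esub> \<in> generated_subalgebra A S" by (rule I) (rule subringE(3))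
  assume x: "x \<in> generated_subalgebra A S"
  show "\<ominus>\<^bsub>A\<^esub> x \<in> generated_subalgebra A S"
    by (rule I) (rule subringE(5)[OF _ subsetD[OF _ x]])
  assume y: "y \<in> generated_subalgebra A S"
  show "x \<oplus>\<^bsub>A\<^esub> y \<in> generated_subalgebra A S"
    by (rule I) (rule subringE(7)[OF _ subsetD[OF _ x] subsetD[OF _ y]])
  show "x \<otimes>\<^bsub>A\<^esub> y \<in> generated_subalgebra A S"
    by (rule I) (rule subringE(6)[OF _ subsetD[OF _ x] subsetD[OF _ y]])
qed

context ogz_parameters
begin

abbreviation "V \<equiv> V_algebra n r q"
abbreviation "E \<equiv> End_algebra V"

text \<open>The rule \<open>act_closed\<close> speaks only of exponents in \<M>, whereas the space V
  has exponents on all n rows.\<close>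

lemma shift_act_L:
  assumes "a \<in> L_field n r" shows "shift_act q \<mu> a \<in> L_field n r"
  using q assms by (simp add: shift_act_frac frac_subst_L_field)

lemma ring_skew_algebra: "ring (skew_algebra n r q I)"
  by (rule ring_skew[OF L_subfield _ _ shift_act_L, where M = "lattice_on I"])
    (simp_all add: skew_algebra_simps lattice_on_closed)

lemma V_closed:
  "coef 1 \<in> carrier V" "0 \<in> carrier V"
  "a \<in> carrier V \<Longrightarrow> b \<in> carrier V \<Longrightarrow> a + b \<in> carrier V"
  "a \<in> carrier V \<Longrightarrow> b \<in> carrier V \<Longrightarrow> skew_mult (shift_act q) a b \<in> carrier V"
  "a \<in> carrier V \<Longrightarrow> - a \<in> carrier V"
proof -
  interpret V: ring V by (rule ring_skew_algebra)
  show "coef 1 \<in> carrier V" using V.one_closed unfolding skew_algebra_simps(3) .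
  show "0 \<in> carrier V" using V.zero_closed unfolding skew_algebra_simps(4) .
  show "a + b \<in> carrier V" if "a \<in> carrier V" "b \<in> carrier V"
    using V.a_closed[OF that] unfolding skew_algebra_simps(5) .
  show "skew_mult (shift_act q) a b \<in> carrier V" if "a \<in> carrier V" "b \<in> carrier V"
    using V.m_closed[OF that] unfolding skew_algebra_simps(2) .
  show "- a \<in> carrier V" if "a \<in> carrier V"
    using that L_closed(3) by (auto simp: skew_algebra_simps(1) skew_ring_def image_subset_iff)
qed

lemma invs_subset_V: "invs \<subseteq> carrier V"
proof
  fix a assume a: "a \<in> invs"
  have "M_group n r \<subseteq> lattice_on (vars n r)" by (auto simp: lattice_on_def vars_def)
  hence "Poly_Mapping.keys a \<subseteq> lattice_on (vars n r)" using invsD(1)[OF a] by (rule order.trans[rotated])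
  thus "a \<in> carrier V"
    unfolding skew_algebra_simps(1) by (simp add: skew_ring_def image_subset_iff invsD(2)[OF a])
qed

text \<open>Shifts fix the constants. As scalars act by left multiplication with constants, this is
  what makes left multiplications linear over the base field.\<close>

lemma const_central: "skew_mult (shift_act q) a (coef (const c)) = skew_mult (shift_act q) (coef (const c)) a"
proof (rule poly_mapping_eqI)
  fix \<kappa>
  have "shift_act q \<kappa> (const c) = const c" using q by (simp add: shift_act_frac frac_subst_const)
  thus "Poly_Mapping.lookup (skew_mult (shift_act q) a (coef (const c))) \<kappa> =
      Poly_Mapping.lookup (skew_mult (shift_act q) (coef (const c)) a) \<kappa>" by simp
qed

lemma const_fixed: "const c \<in> fixed_field"
  by (simp add: fixed_field_def G_act_const const_L)

lemma left_mult_V: "left_mult V a = (\<lambda>v\<in>carrier V. skew_mult (shift_act q) a v)"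
  by (simp add: left_mult_def skew_algebra_simps)

lemma left_mult_End:
  assumes "a \<in> carrier V" shows "left_mult V a \<in> carrier E"
proof -
  have "skew_mult (shift_act q) a (skew_mult (shift_act q) (coef (const c)) v) =
      skew_mult (shift_act q) (coef (const c)) (skew_mult (shift_act q) a v)" for c v
    by (metis const_central skew_mult_assoc)
  moreover have "coef (const c) \<in> carrier V" for c
    using invs_coef[OF const_fixed] invs_subset_V by blast
  ultimately show ?thesis
    using assms by (simp add: End_algebra_def left_mult_V skew_algebra_simps(5,6) skew_mult_add_right V_closed PiE_iff Pi_iff)
qed

lemma left_mult_ops:
  assumes "a \<in> carrier V" "b \<in> carrier V"
  shows "left_mult V a \<otimes>\<^bsub>E\<^esub> left_mult V b = left_mult V (skew_mult (shift_act q) a b)"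
    and "left_mult V a \<oplus>\<^bsub>E\<^esub> left_mult V b = left_mult V (a + b)"
    and "c \<odot>\<^bsub>E\<^esub> left_mult V a = left_mult V (skew_mult (shift_act q) (coef (const c)) a)"
  using assms
  by (auto simp: End_algebra_def left_mult_V compose_def V_closed skew_mult_assoc skew_mult_add_left
    skew_algebra_simps(5,6) intro!: restrict_ext)

lemma End_one_zero: "\<one>\<^bsub>E\<^esub> = left_mult V (coef 1)" "\<zero>\<^bsub>E\<^esub> = left_mult V 0"
proof -
  show "\<one>\<^bsub>E\<^esub> = left_mult V (coef 1)" by (simp add: End_algebra_def left_mult_V)
  have "skew_mult (shift_act q) 0 v = 0" for v by (simp add: skew_mult_def)
  thus "\<zero>\<^bsub>E\<^esub> = left_mult V 0" by (simp add: End_algebra_def left_mult_V skew_algebra_simps(4))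
qed

text \<open>Negatives in a record are a definite description, so uniqueness has to be shown: two
  candidates agree at every v, where addition is that of the type and can be cancelled.\<close>

lemma End_uminus:
  assumes a: "a \<in> carrier V" shows "\<ominus>\<^bsub>E\<^esub> left_mult V a = left_mult V (- a)"
proof -
  have inv: "left_mult V a \<oplus>\<^bsub>E\<^esub> left_mult V (- a) = \<zero>\<^bsub>E\<^esub>"
    "left_mult V (- a) \<oplus>\<^bsub>E\<^esub> left_mult V a = \<zero>\<^bsub>E\<^esub>"
    using a V_closed(5)[OF a] by (simp_all add: left_mult_ops End_one_zero)
  have uniq: "y = left_mult V (- a)" if y: "y \<in> carrier E" "left_mult V a \<oplus>\<^bsub>E\<^esub> y = \<zero>\<^bsub>E\<^esub>" for y
  proof (rule extensionalityI[of _ "carrier V"])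
    show "y \<in> extensional (carrier V)" using y(1) by (simp add: End_algebra_def PiE_iff)
    show "left_mult V (- a) \<in> extensional (carrier V)" by (simp add: left_mult_V)
    fix v assume v: "v \<in> carrier V"
    have add: "(f \<oplus>\<^bsub>E\<^esub> h) v = f v + h v" for f h using v by (simp add: End_algebra_def skew_algebra_simps(5))
    have "left_mult V a v + y v = left_mult V a v + left_mult V (- a) v"
      unfolding add[symmetric] y(2) inv(1) ..
    thus "y v = left_mult V (- a) v" by (rule add_left_imp_eq)
  qed
  show ?thesis
    unfolding a_inv_def m_inv_def
  proof (rule the_equality, goal_cases)
    case 1
    show ?case using inv left_mult_End[OF V_closed(5)[OF a]] by simp
  next
    case (2 y)
    thus ?case by (intro uniq) simp_all
  qed
qed

text \<open>By minimality of the generated subalgebra, every element of \<open>OGZ\<close> is then a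
  left multiplication by an invariant, on which evaluation at 1 loses nothing.\<close>

lemma subalgebra_left_mult_invs: "subalgebra_of E (left_mult V ` invs)"
proof -
  have V: "a \<in> carrier V" if "a \<in> invs" for a using that invs_subset_V by blast
  let ?T = "left_mult V ` invs"
  have sub: "?T \<subseteq> carrier E" using left_mult_End V by blast
  have one: "\<one>\<^bsub>E\<^esub> \<in> ?T" using End_one_zero(1) invs_one by (auto intro: imageI)
  have zero: "\<zero>\<^bsub>E\<^esub> \<in> ?T" using End_one_zero(2) invs_zero by auto
  have ops: "x \<otimes>\<^bsub>E\<^esub> y \<in> ?T" "x \<oplus>\<^bsub>E\<^esub> y \<in> ?T" "c \<odot>\<^bsub>E\<^esub> x \<in> ?T" "\<ominus>\<^bsub>E\<^esub> x \<in> ?T"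
    if xy: "x \<in> ?T" "y \<in> ?T" for x y c
  proof -
    obtain a b where ab: "a \<in> invs" "b \<in> invs" "x = left_mult V a" "y = left_mult V b" using xy by blast
    note ops = left_mult_ops[OF V[OF ab(1)] V[OF ab(2)]] End_uminus[OF V[OF ab(1)]]
    show "x \<otimes>\<^bsub>E\<^esub> y \<in> ?T" "x \<oplus>\<^bsub>E\<^esub> y \<in> ?T" "c \<odot>\<^bsub>E\<^esub> x \<in> ?T" "\<ominus>\<^bsub>E\<^esub> x \<in> ?T"
      unfolding ab(3,4) ops
      by (intro imageI invs_mult invs_add invs_uminus invs_coef const_fixed ab(1,2))+
  qed
  have "subgroup ?T (add_monoid E)"
    by (rule subgroup.intro) (use sub zero ops in \<open>auto simp: a_inv_def\<close>)
  moreover have "submonoid ?T E"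
    by (rule submonoid.intro) (use sub one ops in auto)
  ultimately show ?thesis using ops by (auto simp: subalgebra_of_def subring_def)
qed

text \<open>The preimage of \<open>OGZ\<close> under left multiplication, so that closure properties
  transfer directly from the generated subalgebra; \<open>ogz_embedding_image\<close> identifies it
  with the image of the embedding.\<close>

definition ogz_image :: "'f skew set" where
  "ogz_image = {a \<in> invs. left_mult V a \<in> OGZ n r m p q}"

lemma OGZ_eq: "OGZ n r m p q = left_mult V ` ogz_image"
proof -
  have gens: "left_mult V ` (coef ` Gamma n r m p \<union>
      {X_gen r m p q s k | s k. s \<in> {1, -1} \<and> k \<in> {1..n - 1}}) \<subseteq> left_mult V ` invs"
  proof (intro image_mono Un_least)
    show "coef ` Gamma n r m p \<subseteq> invs" by (intro image_subsetI invs_coef subsetD[OF \<Gamma>_subset])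
    show "{X_gen r m p q s k | s k. s \<in> {1, -1} \<and> k \<in> {1..n - 1}} \<subseteq> invs"
      by (intro subsetI, elim CollectE exE conjE, simp only: X_gen_invs)
  qed
  have "x \<in> left_mult V ` invs" if "x \<in> OGZ n r m p q" for x
    using that unfolding OGZ_def by (rule generated_subalgebraD[OF _ subalgebra_left_mult_invs gens])
  thus ?thesis unfolding ogz_image_def by auto
qed

lemma OGZ_generators:
  "\<gamma> \<in> Gamma n r m p \<Longrightarrow> left_mult V (coef \<gamma>) \<in> OGZ n r m p q"
  "k \<in> {1..n - 1} \<Longrightarrow> s \<in> {1, -1} \<Longrightarrow> left_mult V (X_gen r m p q s k) \<in> OGZ n r m p q"
proof -
  assume "\<gamma> \<in> Gamma n r m p"
  thus "left_mult V (coef \<gamma>) \<in> OGZ n r m p q"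
    unfolding OGZ_def by (intro subsetD[OF generated_subalgebra_incl] imageI UnI1)
next
  assume "k \<in> {1..n - 1}" "s \<in> {1, -1}"
  thus "left_mult V (X_gen r m p q s k) \<in> OGZ n r m p q"
    unfolding OGZ_def by (intro subsetD[OF generated_subalgebra_incl] imageI UnI2 CollectI
        exI[of _ s] exI[of _ k] conjI refl)
qed

lemma ogz_image_V: "a \<in> ogz_image \<Longrightarrow> a \<in> carrier V"
  using invs_subset_V by (auto simp: ogz_image_def)

lemma ogz_image_closed:
  "coef 1 \<in> ogz_image"
  "a \<in> ogz_image \<Longrightarrow> - a \<in> ogz_image"
  "a \<in> ogz_image \<Longrightarrow> b \<in> ogz_image \<Longrightarrow> a + b \<in> ogz_image"
  "a \<in> ogz_image \<Longrightarrow> b \<in> ogz_image \<Longrightarrow> skew_mult (shift_act q) a b \<in> ogz_image"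
proof -
  have I: "a \<in> ogz_image \<longleftrightarrow> a \<in> invs \<and> left_mult V a \<in> OGZ n r m p q" for a
    by (simp add: ogz_image_def)
  show "coef 1 \<in> ogz_image"
    unfolding I End_one_zero(1)[symmetric] OGZ_def using invs_one
    by (simp add: generated_subalgebra_closed(1))
  assume a: "a \<in> ogz_image"
  note aV = ogz_image_V[OF a]
  have aO: "a \<in> invs" "left_mult V a \<in> OGZ n r m p q" using a I by auto
  show "- a \<in> ogz_image"
    unfolding I End_uminus[OF aV, symmetric]
    using aO unfolding OGZ_def by (intro conjI invs_uminus generated_subalgebra_closed(2))
  assume b: "b \<in> ogz_image"
  note bV = ogz_image_V[OF b]
  have bO: "b \<in> invs" "left_mult V b \<in> OGZ n r m p q" using b I by auto
  show "a + b \<in> ogz_image"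
    unfolding I left_mult_ops(2)[OF aV bV, symmetric]
    using aO bO unfolding OGZ_def by (intro conjI invs_add generated_subalgebra_closed(3))
  show "skew_mult (shift_act q) a b \<in> ogz_image"
    unfolding I left_mult_ops(1)[OF aV bV, symmetric]
    using aO bO unfolding OGZ_def by (intro conjI invs_mult generated_subalgebra_closed(4))
qed

lemma subring_ogz_image: "subring ogz_image (skew_ring (shift_act q) (L_field n r) (M_group n r))"
proof -
  let ?R = "skew_ring (shift_act q) (L_field n r) (M_group n r)"
  interpret R: ring ?R
    by (rule ring_skew[OF L_subfield M_zero M_add act_closed]) (simp_all add: skew_ring_def)
  have sub: "ogz_image \<subseteq> carrier ?R" using invs_subset by (auto simp: ogz_image_def)
  have neg: "\<ominus>\<^bsub>?R\<^esub> a = - a" if "a \<in> ogz_image" for a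
  proof (rule R.minus_equality)
    show "a \<in> carrier ?R" "- a \<in> carrier ?R" using that ogz_image_closed(2) sub by blast+
  qed (simp add: skew_ring_def)
  show ?thesis
    by (rule R.subringI[OF sub]) (use ogz_image_closed neg in \<open>simp_all add: skew_ring_def\<close>)
qed

lemma coef_Gamma_ogz_image: "coef ` Gamma n r m p \<subseteq> ogz_image"
  using OGZ_generators(1) invs_coef \<Gamma>_subset by (auto simp: ogz_image_def)

lemma X_gen_ogz_image: "k \<in> {1..n - 1} \<Longrightarrow> s \<in> {1, -1} \<Longrightarrow> X_gen r m p q s k \<in> ogz_image"
  using OGZ_generators(2) X_gen_invs by (simp add: ogz_image_def)

lemma ogz_image_invs: "ogz_image \<subseteq> invs"
  by (auto simp: ogz_image_def)

lemma ogz_image_support: "\<mu> \<in> M_group n r \<Longrightarrow> \<exists>u\<in>ogz_image. Poly_Mapping.lookup u \<mu> \<noteq> 0"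
  by (rule support_covers_M[OF ogz_image_invs coef_Gamma_ogz_image ogz_image_closed(4) X_gen_ogz_image])

section \<open>The embedding and its image\<close>

definition ogz_embedding :: "('f skew \<Rightarrow> 'f skew) \<Rightarrow> 'f skew" where
  "ogz_embedding f = f (coef 1)"

lemma ogz_embedding_left_mult: "a \<in> carrier V \<Longrightarrow> ogz_embedding (left_mult V a) = a"
  using V_closed(1) by (simp add: ogz_embedding_def left_mult_V)

lemma ogz_embedding_image: "ogz_embedding ` OGZ n r m p q = ogz_image"
  unfolding OGZ_eq image_image using ogz_embedding_left_mult ogz_image_V by (auto intro: image_eqI)

lemma ogz_embedding_hom:
  "ogz_embedding \<in> algebra_hom (OGZ_algebra n r m p q) (LM_inv_algebra n r m p q)"
proof -
  have LM: "LM_invariants n r m p q = invs" by (simp add: LM_invariants_def)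
  have "ogz_embedding \<in> ring_hom (OGZ_algebra n r m p q) (LM_inv_algebra n r m p q)"
  proof (rule ring_hom_memI)
    fix x assume "x \<in> carrier (OGZ_algebra n r m p q)"
    then obtain a where a: "a \<in> ogz_image" "x = left_mult V a" using OGZ_eq by auto
    thus "ogz_embedding x \<in> carrier (LM_inv_algebra n r m p q)"
      using ogz_image_invs ogz_image_V by (auto simp: LM ogz_embedding_left_mult)
    fix y assume "y \<in> carrier (OGZ_algebra n r m p q)"
    then obtain b where b: "b \<in> ogz_image" "y = left_mult V b" using OGZ_eq by auto
    note ab = ogz_image_V[OF a(1)] ogz_image_V[OF b(1)]
    show "ogz_embedding (x \<otimes>\<^bsub>OGZ_algebra n r m p q\<^esub> y) =
        ogz_embedding x \<otimes>\<^bsub>LM_inv_algebra n r m p q\<^esub> ogz_embedding y"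
      using left_mult_ops(1)[OF ab] ab V_closed(4)[OF ab]
      by (simp add: a b ogz_embedding_left_mult skew_algebra_simps)
    show "ogz_embedding (x \<oplus>\<^bsub>OGZ_algebra n r m p q\<^esub> y) =
        ogz_embedding x \<oplus>\<^bsub>LM_inv_algebra n r m p q\<^esub> ogz_embedding y"
      using left_mult_ops(2)[OF ab] ab V_closed(3)[OF ab]
      by (simp add: a b ogz_embedding_left_mult skew_algebra_simps)
  next
    show "ogz_embedding \<one>\<^bsub>OGZ_algebra n r m p q\<^esub> = \<one>\<^bsub>LM_inv_algebra n r m p q\<^esub>"
      using End_one_zero(1) ogz_embedding_left_mult[OF V_closed(1)] by (simp add: skew_algebra_simps)
  qed
  moreover have "ogz_embedding (c \<odot>\<^bsub>OGZ_algebra n r m p q\<^esub> x) = c \<odot>\<^bsub>LM_inv_algebra n r m p q\<^esub> ogz_embedding x"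
    if x: "x \<in> carrier (OGZ_algebra n r m p q)" for c x
  proof -
    obtain a where a: "a \<in> ogz_image" "x = left_mult V a" using x OGZ_eq by auto
    note aV = ogz_image_V[OF a(1)]
    have "coef (const c) \<in> carrier V" using invs_coef[OF const_fixed] invs_subset_V by blast
    thus ?thesis using left_mult_ops(3)[OF aV aV, of c] aV V_closed(4)[OF _ aV]
      by (simp add: a ogz_embedding_left_mult skew_algebra_simps)
  qed
  ultimately show ?thesis by (auto simp: algebra_hom_def)
qed

text \<open>The parameter R of the set products is here the module record
  \<open>LM_algebra\<close>.\<close>

lemma LM_set_prod:
  "set_prod (LM_algebra n r q) (coef ` fixed_field) ogz_image = invs"
  "set_prod (LM_algebra n r q) ogz_image (coef ` fixed_field) = invs"
proof -
  note * = ogz_image_invs coef_Gamma_ogz_image ogz_image_closed(4) ogz_image_support skew_algebra_simps(1-5)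
  show "set_prod (LM_algebra n r q) (coef ` fixed_field) ogz_image = invs" by (rule set_prod_left[OF *])
  show "set_prod (LM_algebra n r q) ogz_image (coef ` fixed_field) = invs" by (rule set_prod_right[OF *])
qed

end

theorem theorem3p9:
  fixes n m p :: nat and r :: "nat \<Rightarrow> nat" and q :: "'f::field_char_0"
  assumes "n \<ge> 1" and "\<forall>k\<in>{1..n}. r k \<ge> 1"
    and "m \<ge> 1" and "p \<ge> 1" and "p dvd m"
    and "\<exists>\<zeta>::'f. \<zeta> ^ m = 1 \<and> (\<forall>j\<in>{1..<m}. \<zeta> ^ j \<noteq> 1)"
    and "q \<noteq> 0" and "\<forall>j\<ge>1. q ^ j \<noteq> 1"
  shows "\<exists>\<phi>.
      \<phi> \<in> algebra_hom (OGZ_algebra n r m p q) (LM_inv_algebra n r m p q) \<and>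
      inj_on \<phi> (OGZ n r m p q) \<and>
      (\<forall>k\<in>{1..n - 1}. \<forall>s\<in>{1, -1}.
         \<phi> (left_mult (V_algebra n r q) (X_gen r m p q s k)) = X_gen r m p q s k) \<and>
      (\<forall>\<gamma>\<in>Gamma n r m p. \<phi> (left_mult (V_algebra n r q) (coef \<gamma>)) = coef \<gamma>) \<and>
      set_prod (LM_algebra n r q) (coef ` K_field n r m p) (\<phi> ` OGZ n r m p q)
        = LM_invariants n r m p q \<and>
      set_prod (LM_algebra n r q) (\<phi> ` OGZ n r m p q) (coef ` K_field n r m p)
        = LM_invariants n r m p q \<and>
      galois_ring (Gamma n r m p) (K_field n r m p) (L_field n r)
        (G_group n r m p :: (nat \<Rightarrow> (nat \<Rightarrow> nat) \<times> (nat \<Rightarrow> 'f)) monoid) (G_act n r)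
        (M_group n r) (shift_act q) (G_act_expo n r) (\<phi> ` OGZ n r m p q)"
proof -
  interpret ogz_parameters n m p r q by unfold_locales (use assms in auto)
  have "inj_on ogz_embedding (OGZ n r m p q)"
    unfolding OGZ_eq by (rule inj_onI) (auto simp: ogz_embedding_left_mult ogz_image_V)
  moreover have "ogz_embedding (left_mult V a) = a" if "a \<in> ogz_image" for a
    using that by (simp add: ogz_embedding_left_mult ogz_image_V)
  moreover have "galois_ring (Gamma n r m p) (K_field n r m p) (L_field n r) G (G_act n r)
      (M_group n r) (shift_act q) (G_act_expo n r) ogz_image"
    unfolding fixed_field_eq[symmetric]
    by (rule galois_ring_criterion[OF ogz_image_invs coef_Gamma_ogz_image subring_ogz_image ogz_image_support])
  ultimately show ?thesis
    using ogz_embedding_hom LM_set_prod X_gen_ogz_image coef_Gamma_ogz_image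
    by (intro exI[of _ ogz_embedding])
      (simp add: ogz_embedding_image fixed_field_eq LM_invariants_def image_subset_iff)
qed

end
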